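(* Let $\beta>0$ and $\kappa>0$, where $\kappa$ may depend on $\beta$, with $\kappa<\frac{1}{\pi\beta}$, and set $\tilde\kappa=\kappa\beta$. Then for $\beta>0$ small enough the following hold. There exists a unique minimizer $\varphi_\beta$ of $F_{\beta,\kappa}$ in $\mathcal J$. Moreover, $0<\varphi_\beta(x)<\frac{\pi}{2}$ for all $x\in(0,1)$, $\varphi_\beta\to 0$ in $\mathcal C^\infty(K)$ as $\beta\to0$ for every compact set $K\subset[0,1)$, and for every $x\in[0,1)$ $$\varphi_\beta(x)<2\arctan\left[\left(\tan\frac{\varphi_\beta(1)}{2}\right)e^{\frac{x-1}{\beta}}\right].$$ (i) If $\tilde\kappa=\kappa\beta$ is independent of $\beta$, then $\varphi_\beta(1)=\arcsin(2\tilde\kappa)+o_\beta(1)$ and $$F_{\beta,\kappa}(\varphi_\beta)=\frac{1-\sqrt{1-4\tilde\kappa^2}}{4\beta}-\frac{\tilde\kappa}{2\beta}\arcsin(2\tilde\kappa)+o_\beta(\beta^n)\quad\text{for all } n\in\mathbb N^*.$$ Besides, if $\psi_\beta(x):=\varphi_\beta(1-\beta x)$ (defined for $x\in[0,1/\beta]$), then $\psi_\beta\to\psi_0$ in $\mathcal C^\infty_{loc}([0,+\infty))$, where $\psi_0(x)=2\arctan\left[\tan\left(\frac{\arcsin(2\tilde\kappa)}{2}\right)e^{-x}\right]$. (ii) If $\kappa\beta=o_\beta(1)$, then $\varphi_\beta(1)=2\kappa\beta(1+o_\beta(1))$ and $F_{\beta,\kappa}(\varphi_\beta)=-\frac{\kappa^2\beta}{2}(1+o_\beta(1))$.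 Moreover, if $\Phi_\beta(x):=\frac{\varphi_\beta(1-\beta x)}{2\kappa\beta}$, then $\Phi_\beta\to e^{-x}$ in $\mathcal C^\infty_{loc}([0,+\infty))$.
   Context: For parameters $\beta>0$ and $\kappa>0$ define, for $\varphi\in H^1((0,1))$, $$F_{\beta,\kappa}(\varphi)=\frac18\int_0^1\left(\varphi'(x)^2+\frac{1}{\beta^2}\sin^2\varphi(x)\right)dx-\frac{\kappa}{2}\int_0^1\varphi'(x)\,dx,$$ and $\mathcal J=\{\varphi\in H^1((0,1)):\varphi(0)=0\}$. The parameter $\kappa$ is allowed to depend on $\beta$; the notations $o_\beta$, $O_\beta$ refer to the limit $\beta\to0$. *)

theory Defs
  imports "HOL-Analysis.Analysis" "HOL-Library.Landau_Symbols"
begin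

text \<open>H^1((0,1)) in one dimension: functions with an absolutely continuous
  representative on [0,1], i.e. phi x = phi 0 + integral from 0 to x of g,
  with g square integrable on [0,1] (g is the weak derivative).\<close>

definition is_wderiv :: "(real \<Rightarrow> real) \<Rightarrow> (real \<Rightarrow> real) \<Rightarrow> bool" where
  "is_wderiv \<phi> g \<longleftrightarrow>
     set_borel_measurable lborel {0..1} g \<and>
     set_integrable lborel {0..1} (\<lambda>t. (g t)\<^sup>2) \<and>
     (\<forall>x\<in>{0..1}. \<phi> x = \<phi> 0 + (LBINT t=0..x. g t))"

definition H1 :: "(real \<Rightarrow> real) \<Rightarrow> bool" where
  "H1 \<phi> \<longleftrightarrow> (\<exists>g. is_wderiv \<phi> g)"

definition wderiv :: "(real \<Rightarrow> real) \<Rightarrow> real \<Rightarrow> real" where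
  "wderiv \<phi> = (SOME g. is_wderiv \<phi> g)"

definition J :: "(real \<Rightarrow> real) set" where
  "J = {\<phi>. H1 \<phi> \<and> \<phi> 0 = 0}"

definition F :: "real \<Rightarrow> real \<Rightarrow> (real \<Rightarrow> real) \<Rightarrow> real" where
  "F \<beta> \<kappa> \<phi> =
     1/8 * (LBINT x=0..1. (wderiv \<phi> x)\<^sup>2 + (sin (\<phi> x))\<^sup>2 / \<beta>\<^sup>2)
     - \<kappa>/2 * (LBINT x=0..1. wderiv \<phi> x)"

definition is_minimizer :: "real \<Rightarrow> real \<Rightarrow> (real \<Rightarrow> real) \<Rightarrow> bool" where
  "is_minimizer \<beta> \<kappa> \<phi> \<longleftrightarrow> \<phi> \<in> J \<and> (\<forall>\<psi>\<in>J. F \<beta> \<kappa> \<phi> \<le> F \<beta> \<kappa> \<psi>)"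

text \<open>The (chosen) minimizer phi_beta; only its values on [0,1] matter.\<close>
definition minimizer :: "real \<Rightarrow> real \<Rightarrow> (real \<Rightarrow> real)" where
  "minimizer \<beta> \<kappa> = (SOME \<phi>. is_minimizer \<beta> \<kappa> \<phi>)"

fun hderiv_on :: "real set \<Rightarrow> nat \<Rightarrow> (real \<Rightarrow> real) \<Rightarrow> real \<Rightarrow> real" where
  "hderiv_on S 0 f = f"
| "hderiv_on S (Suc k) f = (\<lambda>x. SOME D. (hderiv_on S k f has_real_derivative D) (at x within S))"

definition smooth_at_within :: "real set \<Rightarrow> real set \<Rightarrow> (real \<Rightarrow> real) \<Rightarrow> bool" where
  "smooth_at_within T S f \<longleftrightarrow>
     (\<forall>k. \<forall>x\<in>T. hderiv_on S k f differentiable (at x within S))"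

end

(*
Write k = kappa * beta. The minimizer is found by a calibration: for c > 0 and
w(y) = sqrt(sin^2 y + c^2), completing the square and using the chain rule for
H^1 functions gives, for psi in J with b = psi(1),

  8 F(psi) = int_0^1 (psi' - w(psi)/beta)^2 + (2 int_0^b w - 4 k b)/beta - c^2/beta^2.

For b >= 0 the function 2 int_0^b w - 4 k b has a strict global minimum at the
point a in (0, pi/2) with sin^2 a + c^2 = 4 k^2; values b > pi reduce to b - pi by
periodicity, and k < 1/pi makes the increment over one period positive. For b < 0
one uses the square (psi' + w(psi)/beta)^2 instead. Hence the solution phi of
phi' = w(phi)/beta with phi(0) = 0, phi(1) = a is the unique minimizer as soon as c
is chosen such that this boundary value problem is solvable; c exists by the
intermediate value theorem, for every beta > 0.

On [0,1] one has cos phi >= d := sqrt(1 - 4/pi^2), so sin phi + w(phi) grows at least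
like exp(d x / beta). Thus w(phi(x)) <= 4 k exp(-d (1 - x)/beta), and in particular
c = w(phi(0)) is exponentially small. All limits follow from this together with a
Gronwall estimate; derivatives of higher order are polynomials in sin phi, cos phi and w(phi).
*)

theory Submission
  imports Defs
begin

section \<open>Weak derivatives and the calibration identity\<close>

text \<open>The parameters come from the Euler-Lagrange equation. It has the first integral (\<beta>
  phi')^2 - sin^2 phi; since phi(0) = 0, its value is a square c^2 with c = \<beta> phi'(0). The
  free endpoint carries the natural condition phi'(1) = 2 kappa, that is w(a) = 2 k, which is the
  relation between a and c. Fitting c to \<beta> is essential: for c = 0 the equation phi' = sin phi
  / \<beta> never leaves the value 0, so no competitor would reach equality. Such an exact lower
  bound gives existence, uniqueness and the minimal value at once, in place of a compactness
  argument. Its price is that the competitors are only H^1: the cross term of the square must be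
  integrated exactly for weak derivatives. Moreover the energy refers to an arbitrarily chosen weak
  derivative, so uniqueness almost everywhere has to be settled before any computation.\<close>

lemma AE_zero_of_integral_greaterThan:
  fixes h :: "real \<Rightarrow> real"
  assumes int: "integrable lborel h"
    and zero: "\<And>x. (LBINT t:{x<..}. h t) = 0"
  shows "AE t in lborel. h t = 0"
proof -
  have [measurable]: "h \<in> borel_measurable borel" using int by auto
  \<comment> \<open>\<open>ennreal\<close> cuts off negative values, so the densities of
    \<open>p\<close> and \<open>n\<close> are the positive and negative parts of \<open>h\<close>.
    The two measures agree on rays, hence everywhere.\<close>
  define p where "p = density lborel (\<lambda>t. ennreal (h t))"
  define n where "n = density lborel (\<lambda>t. ennreal (- h t))"
  have ip: "integrable lborel (\<lambda>t. indicator {x<..} t * max 0 (h t))" for x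
    using integrable_mult_indicator[of "{x<..}" lborel "\<lambda>t. max 0 (h t)"] int by auto
  have im: "integrable lborel (\<lambda>t. indicator {x<..} t * max 0 (- h t))" for x
    using integrable_mult_indicator[of "{x<..}" lborel "\<lambda>t. max 0 (- h t)"] int by auto
  have ep: "emeasure p {x<..} = ennreal (LBINT t. indicator {x<..} t * max 0 (h t))" for x
  proof -
    have "emeasure p {x<..} = (\<integral>\<^sup>+t. ennreal (indicator {x<..} t * max 0 (h t)) \<partial>lborel)"
      unfolding p_def
      by (subst emeasure_density) (auto intro!: nn_integral_cong simp: max_def ennreal_neg split: split_indicator)
    also have "\<dots> = ennreal (LBINT t. indicator {x<..} t * max 0 (h t))"
      by (intro nn_integral_eq_integral ip) auto
    finally show ?thesis .
  qed
  have en: "emeasure n {x<..} = ennreal (LBINT t. indicator {x<..} t * max 0 (- h t))" for x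
  proof -
    have "emeasure n {x<..} = (\<integral>\<^sup>+t. ennreal (indicator {x<..} t * max 0 (- h t)) \<partial>lborel)"
      unfolding n_def
      by (subst emeasure_density) (auto intro!: nn_integral_cong simp: max_def ennreal_neg split: split_indicator)
    also have "\<dots> = ennreal (LBINT t. indicator {x<..} t * max 0 (- h t))"
      by (intro nn_integral_eq_integral im) auto
    finally show ?thesis .
  qed
  have "p = n"
  proof (rule measure_eqI_lessThan)
    fix x
    show "emeasure p {x<..} < \<infinity>" by (simp add: ep)
    have "(LBINT t. indicator {x<..} t * max 0 (h t)) - (LBINT t. indicator {x<..} t * max 0 (- h t))
      = (LBINT t. indicator {x<..} t * max 0 (h t) - indicator {x<..} t * max 0 (- h t))"
      by (rule Bochner_Integration.integral_diff[symmetric]; rule ip im)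
    also have "\<dots> = (LBINT t:{x<..}. h t)"
      unfolding set_lebesgue_integral_def
      by (intro Bochner_Integration.integral_cong) (auto simp: max_def split: split_indicator)
    finally show "emeasure p {x<..} = emeasure n {x<..}" using zero by (simp add: ep en)
  qed (auto simp: p_def n_def)
  \<comment> \<open>One of the two sides is always 0, so equality forces
    \<open>h t = 0\<close>.\<close>
  then have "AE t in lborel. ennreal (h t) = ennreal (- h t)"
    unfolding p_def n_def by (intro sigma_finite_measure.density_unique[OF sigma_finite_lborel]) auto
  then show ?thesis
    by eventually_elim (metis ennreal_eq_0_iff ennreal_inj linorder_linear neg_0_le_iff_le neg_le_0_iff_le order_antisym)
qed

lemma LBINT_0_eq: "0 \<le> x \<Longrightarrow> (LBINT t=0..ereal x. g t) = (LBINT t:{0..x}. g t)"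
  for g :: "real \<Rightarrow> real"
  by (simp add: zero_ereal_def interval_integral_Icc)

lemma LBINT_0_1_eq: "(LBINT t=0..1. g t) = (LBINT t:{0..1}. g t)"
  for g :: "real \<Rightarrow> real"
  by (simp add: zero_ereal_def one_ereal_def interval_integral_Icc)

lemma is_wderiv_iff:
  "is_wderiv \<phi> g \<longleftrightarrow>
     set_borel_measurable lborel {0..1} g \<and>
     set_integrable lborel {0..1} (\<lambda>t. (g t)\<^sup>2) \<and>
     (\<forall>x\<in>{0..1}. \<phi> x = \<phi> 0 + (LBINT t:{0..x}. g t))"
  unfolding is_wderiv_def by (auto simp: LBINT_0_eq)

lemma is_wderivD:
  assumes "is_wderiv \<phi> g" "x \<in> {0..1}"
  shows "\<phi> x = \<phi> 0 + (LBINT t:{0..x}. g t)"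
  using assms unfolding is_wderiv_iff by blast

lemma is_wderiv_integrable:
  assumes "is_wderiv \<phi> g"
  shows "set_integrable lborel {0..1} g"
proof -
  have m: "set_borel_measurable lborel {0..1} g" and i: "set_integrable lborel {0..1} (\<lambda>t. (g t)\<^sup>2)"
    using assms by (auto simp: is_wderiv_iff)
  have "set_integrable lborel {0..1} (\<lambda>t. 1 + (g t)\<^sup>2)"
    by (intro set_integral_add i) (auto simp: set_integrable_def)
  then show ?thesis
    using m
  proof (rule set_integrable_bound)
    have "\<bar>y\<bar> \<le> 1 + y\<^sup>2" for y :: real
      using zero_le_power2[of "\<bar>y\<bar> - 1"] abs_ge_zero[of y] by (simp add: power2_diff)
    then show "AE t in lborel. t \<in> {0..1} \<longrightarrow> norm (g t) \<le> norm (1 + (g t)\<^sup>2)"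
      by (auto simp: abs_of_nonneg)
  qed
qed

text \<open>Makes the choice inside \<open>wderiv\<close> harmless. The difference, extended by 0,
  has zero integral over every initial interval of [0,1], hence over every ray.\<close>

lemma is_wderiv_AE_unique:
  assumes "is_wderiv \<phi> g" "is_wderiv \<phi> h"
  shows "AE t in lborel. t \<in> {0..1} \<longrightarrow> g t = h t"
proof -
  define d where "d t = indicator {0..1} t * (g t - h t)" for t
  have ig: "set_integrable lborel {0..1} g" and ih: "set_integrable lborel {0..1} h"
    using assms by (auto intro: is_wderiv_integrable)
  have sub: "set_integrable lborel {0..x} g" "set_integrable lborel {0..x} h" if "x \<le> 1" for x
    using that by (auto intro: set_integrable_subset[OF ig] set_integrable_subset[OF ih])
  have id: "integrable lborel d"
    using set_integral_diff(1)[OF ig ih] unfolding set_integrable_def d_def by simp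
  have [measurable]: "d \<in> borel_measurable borel" using id by auto
  have prim: "(LBINT t:{0..x}. d t) = 0" if "x \<in> {0..1}" for x
  proof -
    have "(LBINT t:{0..x}. d t) = (LBINT t:{0..x}. g t - h t)"
      using that by (intro set_lebesgue_integral_cong) (auto simp: d_def)
    also have "\<dots> = (LBINT t:{0..x}. g t) - (LBINT t:{0..x}. h t)"
      using that by (intro set_integral_diff sub) auto
    also have "\<dots> = 0"
    proof -
      have "\<phi> x = \<phi> 0 + (LBINT t:{0..x}. g t)" "\<phi> x = \<phi> 0 + (LBINT t:{0..x}. h t)"
        using assms that unfolding is_wderiv_iff by blast+
      then show ?thesis by linarith
    qed
    finally show ?thesis .
  qed
  have "AE t in lborel. d t = 0"
  proof (rule AE_zero_of_integral_greaterThan[OF id])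
    fix x :: real
    \<comment> \<open>Clamping \<open>x\<close> to [0,1] works because \<open>d\<close> vanishes
      outside. For \<open>x < 0\<close> the ray also contains the point 0, which
      \<open>{y<..1}\<close> misses; it is a null set.\<close>
    define y where "y = max 0 (min 1 x)"
    have y: "y \<in> {0..1}" by (auto simp: y_def)
    have s: "set_integrable lborel A d" if "A \<in> sets borel" for A
      unfolding set_integrable_def using id that by (intro integrable_mult_indicator) auto
    have "(LBINT t:{x<..}. d t) = (LBINT t:{y<..1}. d t)"
      unfolding set_lebesgue_integral_def
    proof (rule integral_cong_AE)
      show "AE t in lborel. indicator {x<..} t *\<^sub>R d t = indicator {y<..1} t *\<^sub>R d t"
        using AE_lborel_singleton[of 0]
        by eventually_elim (auto simp: d_def y_def split: split_indicator)
    qed auto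
    moreover have "{0..1} = {0..y} \<union> {y<..1}" using y by auto
    ultimately have "(LBINT t:{0..1}. d t) = (LBINT t:{0..y}. d t) + (LBINT t:{x<..}. d t)"
      using set_integral_Un[of "{0..y}" "{y<..1}" lborel d] s by (simp add: disjoint_iff)
    then show "(LBINT t:{x<..}. d t) = 0" using prim[OF y] prim[of 1] by simp
  qed
  then show ?thesis by eventually_elim (auto simp: d_def)
qed

lemma is_wderiv_continuous_on:
  assumes "is_wderiv \<phi> g"
  shows "continuous_on {0..1} \<phi>"
proof -
  have i: "set_integrable lborel {0..1} g" by (rule is_wderiv_integrable[OF assms])
  then have "g integrable_on {0..1}" by (rule set_borel_integral_eq_integral)
  then have "continuous_on {0..1} (\<lambda>x. \<phi> 0 + integral {0..x} g)"
    by (intro continuous_intros indefinite_integral_continuous_1)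
  moreover have "\<phi> x = \<phi> 0 + integral {0..x} g" if "x \<in> {0..1}" for x
  proof -
    have "set_integrable lborel {0..x} g"
      using that by (intro set_integrable_subset[OF i]) auto
    then show ?thesis
      using assms that set_borel_integral_eq_integral(2) by (metis is_wderiv_iff)
  qed
  ultimately show ?thesis by (metis (no_types, lifting) continuous_on_cong)
qed

lemma set_integrable_continuous_mult:
  fixes W g :: "real \<Rightarrow> real"
  assumes "continuous_on {a..b} W" "set_integrable lborel {a..b} g"
  shows "set_integrable lborel {a..b} (\<lambda>t. W t * g t)"
proof -
  obtain B where B: "\<And>t. t \<in> {a..b} \<Longrightarrow> \<bar>W t\<bar> \<le> B"
    using compact_imp_bounded[OF compact_continuous_image[OF assms(1) compact_Icc]]
    unfolding bounded_iff by (metis imageI real_norm_def)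
  have "set_integrable lborel {a..b} (\<lambda>t. B * g t)"
    using assms(2) by (intro set_integrable_mult_right) auto
  then show ?thesis
  proof (rule set_integrable_bound)
    have "(\<lambda>t. indicator {a..b} t *\<^sub>R W t) \<in> borel_measurable lborel"
      using borel_measurable_continuous_on_indicator[OF _ assms(1)] by simp
    moreover have "(\<lambda>t. indicator {a..b} t *\<^sub>R g t) \<in> borel_measurable lborel"
      using assms(2) unfolding set_integrable_def by (rule borel_measurable_integrable)
    ultimately have "(\<lambda>t. (indicator {a..b} t *\<^sub>R W t) * (indicator {a..b} t *\<^sub>R g t)) \<in> borel_measurable lborel"
      by (rule borel_measurable_times)
    also have "(\<lambda>t. (indicator {a..b} t *\<^sub>R W t) * (indicator {a..b} t *\<^sub>R g t))
        = (\<lambda>t. indicator {a..b} t *\<^sub>R (W t * g t))"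
      by (auto split: split_indicator)
    finally show "set_borel_measurable lborel {a..b} (\<lambda>t. W t * g t)"
      unfolding set_borel_measurable_def .
    have "\<bar>W t\<bar> * \<bar>g t\<bar> \<le> \<bar>B\<bar> * \<bar>g t\<bar>" if "t \<in> {a..b}" for t
      using B[OF that] by (intro mult_right_mono) auto
    then show "AE t in lborel. t \<in> {a..b} \<longrightarrow> norm (W t * g t) \<le> norm (B * g t)"
      by (auto simp: abs_mult)
  qed
qed

text \<open>Telescoping over a uniform grid finer than \<open>\<delta>\<close>. The local bound is
  itself an increment, of \<open>M\<close>, so the sum does not depend on the number of
  steps.\<close>

lemma small_steps_bound:
  fixes D M :: "real \<Rightarrow> real"
  assumes "\<delta> > 0"
    and step: "\<And>x y. 0 \<le> x \<Longrightarrow> x \<le> y \<Longrightarrow> y \<le> 1 \<Longrightarrow> y - x < \<delta> \<Longrightarrow> \<bar>D y - D x\<bar> \<le> e * (M y - M x)"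
  shows "\<bar>D 1 - D 0\<bar> \<le> e * (M 1 - M 0)"
proof -
  obtain n :: nat where n: "n > 0" "1 / real n < \<delta>"
    using \<open>\<delta> > 0\<close> by (metis inverse_eq_divide reals_Archimedean zero_less_Suc)
  have "i \<le> n \<Longrightarrow> \<bar>D (real i / real n) - D 0\<bar> \<le> e * (M (real i / real n) - M 0)" for i
  proof (induction i)
    case (Suc i)
    have "real (Suc i) / real n - real i / real n = 1 / real n"
      by (simp add: diff_divide_distrib[symmetric])
    then have "\<bar>D (real (Suc i) / real n) - D (real i / real n)\<bar>
        \<le> e * (M (real (Suc i) / real n) - M (real i / real n))"
      using Suc.prems n by (intro step) (auto simp: field_simps)
    with Suc show ?case by (auto simp: algebra_simps)
  qed auto
  from this[of n] n show ?thesis by simp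
qed

text \<open>On short intervals both sides differ by at most the oscillation of \<open>w \<circ> \<phi>\<close> times
  the integral of \<open>\<bar>g\<bar>\<close>, so no density argument is needed.\<close>

lemma is_wderiv_chain_rule:
  assumes wd: "is_wderiv \<phi> g"
    and H: "\<And>y. (H has_real_derivative w y) (at y)"
    and w: "continuous_on UNIV w"
  shows "(LBINT t:{0..1}. w (\<phi> t) * g t) = H (\<phi> 1) - H (\<phi> 0)"
proof -
  define W where "W = (\<lambda>t. w (\<phi> t))"
  have c\<phi>: "continuous_on {0..1} \<phi>" by (rule is_wderiv_continuous_on[OF wd])
  have cW: "continuous_on {0..1} W"
    unfolding W_def by (rule continuous_on_compose2[OF w c\<phi>]) auto
  have ig: "set_integrable lborel {0..1} g" by (rule is_wderiv_integrable[OF wd])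
  have iWg: "set_integrable lborel {0..1} (\<lambda>t. W t * g t)"
    by (rule set_integrable_continuous_mult[OF cW ig])
  have iag: "set_integrable lborel {0..1} (\<lambda>t. \<bar>g t\<bar>)" by (rule set_integrable_abs[OF ig])
  define D where "D x = H (\<phi> x) - (LBINT t:{0..x}. W t * g t)" for x
  define M where "M x = (LBINT t:{0..x}. \<bar>g t\<bar>)" for x
  have split: "(LBINT t:{0..y}. f t) = (LBINT t:{0..x}. f t) + (LBINT t:{x<..y}. f t)"
    if "0 \<le> x" "x \<le> y" "y \<le> 1" and f: "set_integrable lborel {0..1} f" for f :: "real \<Rightarrow> real" and x y
  proof -
    have "{0..y} = {0..x} \<union> {x<..y}" using that by auto
    moreover have "set_integrable lborel {0..x} f" "set_integrable lborel {x<..y} f"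
      using that by (auto intro!: set_integrable_subset[OF f])
    ultimately show ?thesis
      using set_integral_Un[of "{0..x}" "{x<..y}" lborel f] by (simp add: disjoint_iff)
  qed
  have "\<bar>D 1 - D 0\<bar> \<le> e * (M 1 - M 0)" if "e > 0" for e
  proof -
    obtain \<delta> where \<delta>: "\<delta> > 0"
      and uc: "\<And>s t. s \<in> {0..1} \<Longrightarrow> t \<in> {0..1} \<Longrightarrow> \<bar>s - t\<bar> < \<delta> \<Longrightarrow> \<bar>W s - W t\<bar> < e"
      using compact_uniformly_continuous[OF cW compact_Icc] \<open>e > 0\<close>
      unfolding uniformly_continuous_on_def dist_real_def by metis
    show ?thesis
    proof (rule small_steps_bound[OF \<delta>])
      fix x y :: real assume xy: "0 \<le> x" "x \<le> y" "y \<le> 1" "y - x < \<delta>"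
      have sub: "set_integrable lborel {x<..y} f" if f: "set_integrable lborel {0..1} f"
        for f :: "real \<Rightarrow> real"
        using xy by (intro set_integrable_subset[OF f]) auto
      have d\<phi>: "\<phi> y - \<phi> x = (LBINT t:{x<..y}. g t)"
      proof -
        have "\<phi> z = \<phi> 0 + (LBINT t:{0..z}. g t)" if "z \<in> {0..1}" for z
          using is_wderivD[OF wd that] .
        from this[of x] this[of y] show ?thesis using split[OF xy(1-3) ig] xy by simp
      qed
      \<comment> \<open>The mean value theorem for \<open>H\<close> yields a point between
        \<open>\<phi> x\<close> and \<open>\<phi> y\<close>. As \<open>\<phi>\<close> need not be
        monotone, connectedness of the image is what writes this point as
        \<open>\<phi> \<xi>\<close> with \<open>\<xi>\<close> in \<open>{x..y}\<close>.\<close>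
      have conn: "connected (\<phi> ` {x..y})"
        using xy by (intro connected_continuous_image continuous_on_subset[OF c\<phi>]) auto
      have "\<exists>\<xi>\<in>{x..y}. H (\<phi> y) - H (\<phi> x) = W \<xi> * (\<phi> y - \<phi> x)"
      proof -
        have "\<exists>z. z \<in> {min (\<phi> x) (\<phi> y)..max (\<phi> x) (\<phi> y)} \<and> H (\<phi> y) - H (\<phi> x) = w z * (\<phi> y - \<phi> x)"
        proof (cases "\<phi> x" "\<phi> y" rule: linorder_cases)
          case less
          then obtain z where "\<phi> x < z" "z < \<phi> y" "H (\<phi> y) - H (\<phi> x) = (\<phi> y - \<phi> x) * w z"
            using MVT2[of "\<phi> x" "\<phi> y" H w] H by blast
          then show ?thesis by (intro exI[of _ z]) auto
        next
          case greater
          then obtain z where "\<phi> y < z" "z < \<phi> x" "H (\<phi> x) - H (\<phi> y) = (\<phi> x - \<phi> y) * w z"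
            using MVT2[of "\<phi> y" "\<phi> x" H w] H by blast
          then show ?thesis by (intro exI[of _ z]) (auto simp: algebra_simps)
        qed auto
        moreover have "{min (\<phi> x) (\<phi> y)..max (\<phi> x) (\<phi> y)} \<subseteq> \<phi> ` {x..y}"
          using xy by (intro connected_contains_Icc[OF conn]) (auto simp: min_def max_def)
        ultimately show ?thesis unfolding W_def by (metis imageE subsetD)
      qed
      then obtain \<xi> where \<xi>: "\<xi> \<in> {x..y}" "H (\<phi> y) - H (\<phi> x) = W \<xi> * (\<phi> y - \<phi> x)" by blast
      have "D y - D x = W \<xi> * (LBINT t:{x<..y}. g t) - (LBINT t:{x<..y}. W t * g t)"
        using \<xi>(2) d\<phi> split[OF xy(1-3) iWg] by (simp add: D_def)
      also have "\<dots> = (LBINT t:{x<..y}. W \<xi> * g t) - (LBINT t:{x<..y}. W t * g t)" by simp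
      also have "\<dots> = (LBINT t:{x<..y}. W \<xi> * g t - W t * g t)"
        by (intro set_integral_diff(2)[symmetric] sub iWg set_integrable_mult_right) (use ig in auto)
      finally have "\<bar>D y - D x\<bar> = \<bar>LBINT t:{x<..y}. W \<xi> * g t - W t * g t\<bar>" by simp
      also have "\<dots> \<le> (LBINT t:{x<..y}. \<bar>W \<xi> * g t - W t * g t\<bar>)"
        unfolding set_lebesgue_integral_def
        by (rule order_trans[OF integral_abs_bound]) (simp add: abs_mult)
      also have "\<dots> \<le> (LBINT t:{x<..y}. e * \<bar>g t\<bar>)"
      proof (rule set_integral_mono)
        show "set_integrable lborel {x<..y} (\<lambda>t. \<bar>W \<xi> * g t - W t * g t\<bar>)"
          by (intro set_integrable_abs set_integral_diff sub iWg set_integrable_mult_right) (use ig in auto)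
        show "set_integrable lborel {x<..y} (\<lambda>t. e * \<bar>g t\<bar>)"
          by (intro sub set_integrable_mult_right) (use iag in auto)
        fix t assume t: "t \<in> {x<..y}"
        have "\<bar>W \<xi> - W t\<bar> < e" using t \<xi> xy by (intro uc) auto
        then have "\<bar>W \<xi> - W t\<bar> * \<bar>g t\<bar> \<le> e * \<bar>g t\<bar>" by (intro mult_right_mono) auto
        then show "\<bar>W \<xi> * g t - W t * g t\<bar> \<le> e * \<bar>g t\<bar>"
          by (simp add: abs_mult[symmetric] left_diff_distrib)
      qed
      also have "\<dots> = e * (M y - M x)" using split[OF xy(1-3) iag] by (simp add: M_def)
      finally show "\<bar>D y - D x\<bar> \<le> e * (M y - M x)" .
    qed
  qed
  note bnd = this
  have "D 1 - D 0 = 0"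
  proof (rule ccontr)
    assume ne: "D 1 - D 0 \<noteq> 0"
    define m where "m = \<bar>M 1 - M 0\<bar> + 1"
    have m: "m > 0" "M 1 - M 0 \<le> m" by (auto simp: m_def)
    \<comment> \<open>Chosen so that \<open>e * m\<close> is half of
      \<open>\<bar>D 1 - D 0\<bar>\<close>; the summand 1 in \<open>m\<close> keeps the divisor
      positive.\<close>
    define e where "e = \<bar>D 1 - D 0\<bar> / (2 * m)"
    have e: "e > 0" using ne m by (simp add: e_def)
    have "\<bar>D 1 - D 0\<bar> \<le> e * m"
      using order_trans[OF bnd[OF e] mult_left_mono[OF m(2)]] e by simp
    also have "\<dots> = \<bar>D 1 - D 0\<bar> / 2" using m by (simp add: e_def)
    finally show False using ne by simp
  qed
  moreover have "(LBINT t:{0..0}. W t * g t) = 0"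
    unfolding set_lebesgue_integral_def
    by (rule integral_eq_zero_AE) (use AE_lborel_singleton[of 0] in \<open>eventually_elim, auto\<close>)
  ultimately show ?thesis unfolding D_def by (simp add: W_def)
qed

lemma is_wderivI:
  fixes \<phi> g :: "real \<Rightarrow> real"
  assumes d: "\<And>x. x \<in> {0..1} \<Longrightarrow> (\<phi> has_real_derivative g x) (at x within {0..1})"
    and c: "continuous_on {0..1} g"
  shows "is_wderiv \<phi> g"
  unfolding is_wderiv_iff
proof (intro conjI ballI)
  show "set_borel_measurable lborel {0..1} g"
    unfolding set_borel_measurable_def
    using borel_measurable_continuous_on_indicator[OF _ c] by simp
  show "set_integrable lborel {0..1} (\<lambda>t. (g t)\<^sup>2)"
    by (intro borel_integrable_atLeastAtMost' continuous_intros c)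
  fix x :: real assume x: "x \<in> {0..1}"
  have "set_integrable lborel {0..x} g"
    using x by (intro borel_integrable_atLeastAtMost' continuous_on_subset[OF c]) auto
  then have "(LBINT t:{0..x}. g t) = integral {0..x} g" by (rule set_borel_integral_eq_integral)
  also have "(g has_integral (\<phi> x - \<phi> 0)) {0..x}"
  proof (rule fundamental_theorem_of_calculus)
    fix t assume "t \<in> {0..x}"
    then have "(\<phi> has_real_derivative g t) (at t within {0..x})"
      using x by (intro DERIV_subset[OF d]) auto
    then show "(\<phi> has_vector_derivative g t) (at t within {0..x})"
      by (simp add: has_real_derivative_iff_has_vector_derivative)
  qed (use x in auto)
  then have "integral {0..x} g = \<phi> x - \<phi> 0" by (rule integral_unique)
  finally show "\<phi> x = \<phi> 0 + (LBINT t:{0..x}. g t)" by simp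
qed

section \<open>The energy as a perfect square plus boundary terms\<close>

lemma F_eq:
  assumes "is_wderiv \<phi> g"
  shows "F \<beta> \<kappa> \<phi> = 1/8 * (LBINT x:{0..1}. (g x)\<^sup>2 + (sin (\<phi> x))\<^sup>2 / \<beta>\<^sup>2) - \<kappa>/2 * (\<phi> 1 - \<phi> 0)"
proof -
  have wd: "is_wderiv \<phi> (wderiv \<phi>)" unfolding wderiv_def by (rule someI[where P = "is_wderiv \<phi>", OF assms])
  have "\<phi> 1 = \<phi> 0 + (LBINT t:{0..1}. wderiv \<phi> t)"
    by (rule is_wderivD[OF wd]) simp
  moreover have "(LBINT x:{0..1}. (wderiv \<phi> x)\<^sup>2 + (sin (\<phi> x))\<^sup>2 / \<beta>\<^sup>2)
      = (LBINT x:{0..1}. (g x)\<^sup>2 + (sin (\<phi> x))\<^sup>2 / \<beta>\<^sup>2)"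
    unfolding set_lebesgue_integral_def
  proof (rule integral_cong_AE)
    show "AE x in lborel. indicator {0..1} x *\<^sub>R ((wderiv \<phi> x)\<^sup>2 + (sin (\<phi> x))\<^sup>2 / \<beta>\<^sup>2)
        = indicator {0..1} x *\<^sub>R ((g x)\<^sup>2 + (sin (\<phi> x))\<^sup>2 / \<beta>\<^sup>2)"
      using is_wderiv_AE_unique[OF wd assms] by eventually_elim (auto split: split_indicator)
    \<comment> \<open>At \<open>\<beta> = 0\<close> the quotient is 0 by the convention on division,
      so this case is split off from the continuity rule.\<close>
    have i: "set_integrable lborel {0..1} (\<lambda>x. (sin (\<phi> x))\<^sup>2 / \<beta>\<^sup>2)"
      using is_wderiv_continuous_on[OF assms]
      by (cases "\<beta> = 0") (auto intro!: borel_integrable_atLeastAtMost' continuous_intros)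
    have "(\<lambda>x. indicator {0..1} x *\<^sub>R ((f x)\<^sup>2 + (sin (\<phi> x))\<^sup>2 / \<beta>\<^sup>2)) \<in> borel_measurable lborel"
      if "is_wderiv \<phi> f" for f
    proof -
      have "set_integrable lborel {0..1} (\<lambda>x. (f x)\<^sup>2)" using that unfolding is_wderiv_iff by blast
      from set_integral_add(1)[OF this i] show ?thesis
        unfolding set_integrable_def by (rule borel_measurable_integrable)
    qed
    then show "(\<lambda>x. indicator {0..1} x *\<^sub>R ((wderiv \<phi> x)\<^sup>2 + (sin (\<phi> x))\<^sup>2 / \<beta>\<^sup>2)) \<in> borel_measurable lborel"
      "(\<lambda>x. indicator {0..1} x *\<^sub>R ((g x)\<^sup>2 + (sin (\<phi> x))\<^sup>2 / \<beta>\<^sup>2)) \<in> borel_measurable lborel"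
      using wd assms by blast+
  qed
  ultimately show ?thesis unfolding F_def LBINT_0_1_eq by simp
qed

text \<open>\<open>w2\<close> lets the square reproduce the potential up to the constant
  \<open>c\<^sup>2 / \<beta>\<^sup>2\<close>, and by the chain rule the cross term depends on the
  endpoint values alone. The sign \<open>\<sigma>\<close> treats increasing and decreasing solutions
  of the first-order equation in one computation.\<close>

lemma F_calibration:
  assumes wd: "is_wderiv \<phi> g"
    and H: "\<And>y. (H has_real_derivative w y) (at y)"
    and cw: "continuous_on UNIV w"
    and w2: "\<And>y. (w y)\<^sup>2 = (sin y)\<^sup>2 + c\<^sup>2"
    and \<sigma>: "\<sigma>\<^sup>2 = 1"
  shows "set_integrable lborel {0..1} (\<lambda>t. (g t - \<sigma> * w (\<phi> t) / \<beta>)\<^sup>2)"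
    and "F \<beta> \<kappa> \<phi> = 1/8 * (LBINT t:{0..1}. (g t - \<sigma> * w (\<phi> t) / \<beta>)\<^sup>2)
      + \<sigma> / (4 * \<beta>) * (H (\<phi> 1) - H (\<phi> 0)) - c\<^sup>2 / (8 * \<beta>\<^sup>2) - \<kappa>/2 * (\<phi> 1 - \<phi> 0)"
proof -
  have c\<phi>: "continuous_on {0..1} \<phi>" by (rule is_wderiv_continuous_on[OF wd])
  have cW: "continuous_on {0..1} (\<lambda>t. w (\<phi> t))"
    by (rule continuous_on_compose2[OF cw c\<phi>]) auto
  have i1: "set_integrable lborel {0..1} (\<lambda>t. (g t)\<^sup>2)" using wd by (auto simp: is_wderiv_def)
  have i2: "set_integrable lborel {0..1} (\<lambda>x. (sin (\<phi> x))\<^sup>2 / \<beta>\<^sup>2)"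
    using c\<phi> by (cases "\<beta> = 0") (auto intro!: borel_integrable_atLeastAtMost' continuous_intros)
  have i3: "set_integrable lborel {0..1} (\<lambda>t. w (\<phi> t) * g t)"
    by (rule set_integrable_continuous_mult[OF cW is_wderiv_integrable[OF wd]])
  have i4: "set_integrable lborel {0..1} (\<lambda>t::real. c\<^sup>2 / \<beta>\<^sup>2)"
    by (intro borel_integrable_atLeastAtMost' continuous_on_const)
  have eq: "(g t - \<sigma> * w (\<phi> t) / \<beta>)\<^sup>2
      = ((g t)\<^sup>2 + (sin (\<phi> t))\<^sup>2 / \<beta>\<^sup>2) - (2 * \<sigma> / \<beta> * (w (\<phi> t) * g t) - c\<^sup>2 / \<beta>\<^sup>2)" for t
  proof -
    have "(g t - \<sigma> * w (\<phi> t) / \<beta>)\<^sup>2 = (g t)\<^sup>2 - 2 * \<sigma> / \<beta> * (w (\<phi> t) * g t) + \<sigma>\<^sup>2 * (w (\<phi> t))\<^sup>2 / \<beta>\<^sup>2"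
      by (simp add: power2_diff power_divide power_mult_distrib)
    then show ?thesis unfolding w2 \<sigma> by (simp add: add_divide_distrib)
  qed
  note i12 = set_integral_add[OF i1 i2]
  have i3': "set_integrable lborel {0..1} (\<lambda>t. 2 * \<sigma> / \<beta> * (w (\<phi> t) * g t))"
    by (intro set_integrable_mult_right i3)
  note i34 = set_integral_diff[OF i3' i4]
  show "set_integrable lborel {0..1} (\<lambda>t. (g t - \<sigma> * w (\<phi> t) / \<beta>)\<^sup>2)"
    unfolding eq by (rule set_integral_diff(1)[OF i12(1) i34(1)])
  have c4: "(LBINT t::real:{0..1}. c\<^sup>2 / \<beta>\<^sup>2) = c\<^sup>2 / \<beta>\<^sup>2"
    by (simp add: set_lebesgue_integral_def)
  have "(LBINT t:{0..1}. (g t - \<sigma> * w (\<phi> t) / \<beta>)\<^sup>2)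
      = (LBINT t:{0..1}. (g t)\<^sup>2 + (sin (\<phi> t))\<^sup>2 / \<beta>\<^sup>2)
        - (2 * \<sigma> / \<beta> * (H (\<phi> 1) - H (\<phi> 0)) - c\<^sup>2 / \<beta>\<^sup>2)"
    unfolding eq set_integral_diff(2)[OF i12(1) i34(1)] i34(2) c4
      set_integral_mult_right is_wderiv_chain_rule[OF wd H cw] by simp
  moreover have "\<sigma> / (4 * \<beta>) * (H (\<phi> 1) - H (\<phi> 0)) = 1/8 * (2 * \<sigma> / \<beta> * (H (\<phi> 1) - H (\<phi> 0)))"
    "c\<^sup>2 / (8 * \<beta>\<^sup>2) = 1/8 * (c\<^sup>2 / \<beta>\<^sup>2)"
    by simp_all
  ultimately show "F \<beta> \<kappa> \<phi> = 1/8 * (LBINT t:{0..1}. (g t - \<sigma> * w (\<phi> t) / \<beta>)\<^sup>2)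
      + \<sigma> / (4 * \<beta>) * (H (\<phi> 1) - H (\<phi> 0)) - c\<^sup>2 / (8 * \<beta>\<^sup>2) - \<kappa>/2 * (\<phi> 1 - \<phi> 0)"
    unfolding F_eq[OF wd] by linarith
qed

section \<open>The first-order boundary value problem\<close>

lemma ex_antiderivative:
  fixes f :: "real \<Rightarrow> real"
  assumes "continuous_on UNIV f"
  obtains G where "G 0 = 0" "\<And>x. (G has_real_derivative f x) (at x)"
proof -
  have "isCont f x" for x using assms by (simp add: continuous_on_eq_continuous_at)
  then obtain G where "\<And>x. (G has_vector_derivative f x) (at x)"
    using einterval_antiderivative[of "-\<infinity>" \<infinity> f] by auto
  then have "((\<lambda>x. G x - G 0) has_real_derivative f x) (at x)" for x
    by (auto intro!: derivative_eq_intros simp: has_real_derivative_iff_has_vector_derivative)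
  then show ?thesis by (intro that[of "\<lambda>x. G x - G 0"]) auto
qed

text \<open>Separation of variables: \<open>T\<close> is the travel time and \<open>f\<close> its
  inverse. The bound \<open>B\<close> makes \<open>T\<close> grow at least linearly in both
  directions, so \<open>T\<close> is onto and the solution lives on the whole line; \<open>B\<close>
  is also a Lipschitz constant of \<open>f\<close>.\<close>

lemma ex_autonomous_solution:
  fixes w :: "real \<Rightarrow> real"
  assumes w: "continuous_on UNIV w" "\<And>y. 0 < w y" "\<And>y. w y \<le> B"
  obtains T f where "\<And>y. (T has_real_derivative 1 / w y) (at y)" "T 0 = 0"
    "\<And>y. f (T y) = y" "\<And>x. (f has_real_derivative w (f x)) (at x)"
proof -
  have nz: "w y \<noteq> 0" for y using w(2)[of y] by simp
  then obtain T where T: "T 0 = 0" "\<And>y. (T has_real_derivative 1 / w y) (at y)"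
  proof -
    have "continuous_on UNIV (\<lambda>y. 1 / w y)" using w(1) nz by (auto intro!: continuous_intros)
    then show ?thesis using that ex_antiderivative by metis
  qed
  have B: "B > 0" using w(2)[of 0] w(3)[of 0] by linarith
  have lower: "(y - x) / B \<le> T y - T x" if "x \<le> y" for x y
  proof (cases "x = y")
    case False
    then obtain z where "T y - T x = (y - x) * (1 / w z)"
      using MVT2[of x y T "\<lambda>z. 1 / w z"] T(2) \<open>x \<le> y\<close> by force
    moreover have "(y - x) * (1 / B) \<le> (y - x) * (1 / w z)"
      using that w(2)[of z] w(3)[of z] by (intro mult_left_mono divide_left_mono) auto
    ultimately show ?thesis by simp
  qed auto
  have inj: "x = y" if "T x = T y" for x y
    using lower[of x y] lower[of y x] that B by (cases x y rule: linorder_cases) (auto simp: field_simps)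
  define f where "f = inv T"
  have fT: "f (T y) = y" for y unfolding f_def using inj by (auto intro!: inv_f_f injI)
  have cT: "continuous_on S T" for S
    using T(2) DERIV_isCont by (blast intro: continuous_at_imp_continuous_on)
  have "\<exists>y. T y = x" for x
  proof -
    have "T (- B * \<bar>x\<bar>) \<le> x" "x \<le> T (B * \<bar>x\<bar>)"
      using lower[of "- B * \<bar>x\<bar>" 0] lower[of 0 "B * \<bar>x\<bar>"] B T(1) by (auto simp: field_simps)
    moreover have "- B * \<bar>x\<bar> \<le> B * \<bar>x\<bar>" using B by simp
    ultimately show ?thesis using IVT'[of T "- B * \<bar>x\<bar>" x "B * \<bar>x\<bar>"] cT by blast
  qed
  then have Tf: "T (f x) = x" for x unfolding f_def by (metis f_def fT)
  have lip: "\<bar>f x - f y\<bar> \<le> B * \<bar>x - y\<bar>" for x y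
  proof -
    have "f v - f u \<le> B * \<bar>v - u\<bar>" if "f u \<le> f v" for u v
    proof -
      have "f v - f u \<le> B * (v - u)" using lower[OF that] B by (simp add: Tf field_simps)
      also have "\<dots> \<le> B * \<bar>v - u\<bar>" using B by (intro mult_left_mono) auto
      finally show ?thesis .
    qed
    from this[of x y] this[of y x] show ?thesis
      using linear[of "f x" "f y"] by (auto simp: abs_le_iff abs_minus_commute)
  qed
  have "isCont f x" for x
  proof -
    have "((\<lambda>y. B * \<bar>y - x\<bar>) \<longlongrightarrow> 0) (at x)" by (auto intro!: tendsto_eq_intros)
    then have "((\<lambda>y. f y - f x) \<longlongrightarrow> 0) (at x)"
      by (rule Lim_null_comparison[rotated]) (auto intro!: always_eventually simp: lip)
    then show ?thesis unfolding isCont_def by (simp add: LIM_zero_iff)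
  qed
  then have "(f has_real_derivative inverse (1 / w (f x))) (at x)" for x
    using T(2) nz by (intro DERIV_inverse_function[where f = T and a = "x - 1" and b = "x + 1"]) (auto simp: Tf)
  then have "(f has_real_derivative w (f x)) (at x)" for x by simp
  with T fT show ?thesis using that by blast
qed

text \<open>The integral is the travel time of \<open>y' = sqrt ((sin y)\<^sup>2 + c\<^sup>2)\<close> from \<open>0\<close> to \<open>a\<close>, pulled back to
  \<open>{0..1}\<close> so that it depends continuously on \<open>c\<close>. It vanishes at \<open>c = 2 * k\<close> and is at least \<open>L\<close> at
  \<open>c = k * exp (- L)\<close>.\<close>

lemma ex_initial_slope:
  fixes k L :: real
  assumes k: "0 < k" "2 * k < 1" and L: "0 < L"
  obtains c a where "0 < c" "c < 2 * k" "0 < a" "a < pi/2" "(sin a)\<^sup>2 + c\<^sup>2 = (2 * k)\<^sup>2"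
    "integral {0..1} (\<lambda>t. a / sqrt ((sin (a * t))\<^sup>2 + c\<^sup>2)) = L"
proof -
  define q where "q c = sqrt ((2 * k)\<^sup>2 - c\<^sup>2)" for c
  define A where "A c = arcsin (q c)" for c
  define \<tau> where "\<tau> c = integral (cbox 0 1) (\<lambda>t. A c / sqrt ((sin (A c * t))\<^sup>2 + c\<^sup>2))" for c
  define c0 where "c0 = k * exp (- L)"
  have c0: "0 < c0" "c0 < k" using k L by (auto simp: c0_def)
  have r: "0 \<le> q c" "q c < 1" if "c \<in> {c0..2 * k}" for c
  proof -
    have "c\<^sup>2 \<le> (2 * k)\<^sup>2" using that c0 by (intro power_mono) auto
    then show "0 \<le> q c" by (simp add: q_def)
    have "(2 * k)\<^sup>2 < 1\<^sup>2" using k by (intro power_strict_mono) auto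
    then have "(2 * k)\<^sup>2 - c\<^sup>2 < 1" unfolding one_power2 using zero_le_power2[of c] by linarith
    then show "q c < 1" by (simp add: q_def)
  qed
  have cA: "continuous_on {c0..2 * k} A"
    unfolding A_def
  proof (rule continuous_on_arcsin)
    show "continuous_on {c0..2 * k} q" unfolding q_def by (intro continuous_intros)
    show "\<forall>x\<in>{c0..2 * k}. - 1 \<le> q x \<and> q x \<le> 1" using r by force
  qed
  have sinA: "sin (A c) = q c" if "c \<in> {c0..2 * k}" for c
    unfolding A_def by (rule sin_arcsin) (use r[OF that] in linarith)+
  have A0: "0 \<le> A c" "A c < pi / 2" if "c \<in> {c0..2 * k}" for c
    using arcsin_lt_bounded[of "q c"] r[OF that] arcsin_le_arcsin[of 0 "q c"]
    unfolding A_def by simp_all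
  have pos: "0 < (sin x)\<^sup>2 + c\<^sup>2" if "c \<in> {c0..2 * k}" for c x :: real
    using that c0 by (intro add_nonneg_pos) auto
  have "continuous_on ({c0..2 * k} \<times> cbox 0 1) (\<lambda>(c, t). A c / sqrt ((sin (A c * t))\<^sup>2 + c\<^sup>2))"
  proof -
    have c': "continuous_on ({c0..2 * k} \<times> cbox 0 1) (\<lambda>x. A (fst x))"
      by (rule continuous_on_compose2[OF cA]) (auto intro!: continuous_intros)
    show ?thesis unfolding case_prod_beta
    proof (intro continuous_intros c' ballI)
      fix x assume "x \<in> {c0..2 * k} \<times> cbox (0::real) 1"
      then show "sqrt ((sin (A (fst x) * snd x))\<^sup>2 + (fst x)\<^sup>2) \<noteq> 0"
        using pos[of "fst x" "A (fst x) * snd x"] by auto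
    qed
  qed
  then have c\<tau>: "continuous_on {c0..2 * k} \<tau>"
    unfolding \<tau>_def by (rule integral_continuous_on_param)
  have hi: "\<tau> (2 * k) = 0" by (simp add: \<tau>_def A_def q_def)
  \<comment> \<open>Since |sin(a t)| \<le> a t, the denominator is at most
    \<open>a * t + c0\<close>. The travel time is therefore at least ln((a + c0)/c0), which is at
    least ln(k/c0) = L because k \<le> sin a \<le> a. This logarithmic divergence for small c is why
    every length is reached.\<close>
  have lo: "L \<le> \<tau> c0"
  proof -
    have c0m: "c0 \<in> {c0..2 * k}" using c0 by auto
    define a where "a = A c0"
    have "k \<le> q c0"
      unfolding q_def
    proof (rule real_le_rsqrt)
      have "c0\<^sup>2 \<le> k\<^sup>2" using c0 by (intro power_mono) auto
      then show "k\<^sup>2 \<le> (2 * k)\<^sup>2 - c0\<^sup>2" using zero_le_power2[of k] by (auto simp: power_mult_distrib intro: order_trans)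
    qed
    then have ka: "k \<le> a" using sinA[OF c0m] sin_x_le_x[of a] A0[OF c0m] unfolding a_def by linarith
    have a: "0 < a" using ka k by simp
    have ineq: "a / (a * t + c0) \<le> a / sqrt ((sin (a * t))\<^sup>2 + c0\<^sup>2)" if "t \<in> {0..1}" for t
    proof (rule divide_left_mono)
      have "\<bar>sin (a * t)\<bar> \<le> a * t" using abs_sin_x_le_abs_x[of "a * t"] a that by simp
      then have "(sin (a * t))\<^sup>2 \<le> (a * t)\<^sup>2" by (metis abs_ge_zero power2_abs power_mono)
      then show "sqrt ((sin (a * t))\<^sup>2 + c0\<^sup>2) \<le> a * t + c0"
        using a that c0 by (intro real_le_lsqrt) (auto simp: power2_sum intro!: add_increasing2)
      show "0 < (a * t + c0) * sqrt ((sin (a * t))\<^sup>2 + c0\<^sup>2)"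
      proof (rule mult_pos_pos)
        show "0 < a * t + c0" using a that c0 by (intro add_nonneg_pos) auto
        show "0 < sqrt ((sin (a * t))\<^sup>2 + c0\<^sup>2)" by (rule real_sqrt_gt_zero[OF pos[OF c0m]])
      qed
    qed (use a in auto)
    have hi: "((\<lambda>t. a / (a * t + c0)) has_integral (ln (a * 1 + c0) - ln (a * 0 + c0))) {0..1}"
    proof (rule fundamental_theorem_of_calculus)
      fix t :: real assume t: "t \<in> {0..1}"
      then have "0 < a * t + c0" using a c0 by (intro add_nonneg_pos) auto
      then have "((\<lambda>t. ln (a * t + c0)) has_real_derivative a / (a * t + c0)) (at t within {0..1})"
        by (auto intro!: derivative_eq_intros)
      then show "((\<lambda>t. ln (a * t + c0)) has_vector_derivative a / (a * t + c0)) (at t within {0..1})"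
        by (simp add: has_real_derivative_iff_has_vector_derivative)
    qed auto
    have "k / c0 = exp L" using k by (simp add: c0_def exp_minus divide_inverse)
    then have "L = ln (k / c0)" by simp
    also have "\<dots> = ln k - ln c0" using k c0 by (simp add: ln_div)
    also have "\<dots> \<le> ln (a * 1 + c0) - ln (a * 0 + c0)"
      using ka k c0 by simp
    also have "\<dots> = integral {0..1} (\<lambda>t. a / (a * t + c0))"
      by (rule integral_unique[OF hi, symmetric])
    also have "\<dots> \<le> integral {0..1} (\<lambda>t. a / sqrt ((sin (a * t))\<^sup>2 + c0\<^sup>2))"
    proof (rule integral_le)
      show "(\<lambda>t. a / sqrt ((sin (a * t))\<^sup>2 + c0\<^sup>2)) integrable_on {0..1}"
      proof (intro integrable_continuous_interval continuous_intros ballI)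
        fix t show "sqrt ((sin (a * t))\<^sup>2 + c0\<^sup>2) \<noteq> 0"
          using real_sqrt_gt_zero[OF pos[OF c0m, of "a * t"]] by linarith
      qed
    qed (use hi ineq in auto)
    finally show ?thesis by (simp add: \<tau>_def a_def)
  qed
  obtain c where c: "c \<in> {c0..2 * k}" "\<tau> c = L"
    using IVT2'[of \<tau> "2 * k" L c0] hi lo L c\<tau> c0 k by auto
  have ne: "c \<noteq> 2 * k" using hi c L by auto
  show ?thesis
  proof (rule that[of c "A c"])
    show "0 < c" "c < 2 * k" using c c0 ne by auto
    then have "c\<^sup>2 < (2 * k)\<^sup>2" by (intro power_strict_mono) auto
    then show s: "(sin (A c))\<^sup>2 + c\<^sup>2 = (2 * k)\<^sup>2" using sinA[OF c(1)] by (simp add: q_def)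
    show "A c < pi / 2" using A0[OF c(1)] by simp
    have "A c \<noteq> 0" using s \<open>c\<^sup>2 < (2 * k)\<^sup>2\<close> by auto
    then show "0 < A c" using A0[OF c(1)] by simp
    show "integral {0..1} (\<lambda>t. A c / sqrt ((sin (A c * t))\<^sup>2 + c\<^sup>2)) = L"
      using c(2) by (simp add: \<tau>_def)
  qed
qed

text \<open>The Euler-Lagrange equation, integrated once: \<open>c\<close> is \<beta> times the
  slope at 0, and \<open>sin_a\<close> says that the slope at 1 is \<open>2 * k / \<beta>\<close>,
  the natural boundary condition. The equation is posed on the whole line so that derivatives at 0
  and 1 are two-sided.\<close>

locale profile =
  fixes \<beta> k c a :: real and \<phi> :: "real \<Rightarrow> real"
  assumes \<beta>: "0 < \<beta>" and k: "0 < k" "k < 1 / pi" and c: "0 < c" and a: "0 < a" "a < pi / 2"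
    and sin_a: "(sin a)\<^sup>2 + c\<^sup>2 = (2 * k)\<^sup>2"
    and \<phi>_0: "\<phi> 0 = 0" and \<phi>_1: "\<phi> 1 = a"
    and \<phi>_deriv: "\<And>x. (\<phi> has_real_derivative sqrt ((sin (\<phi> x))\<^sup>2 + c\<^sup>2) / \<beta>) (at x)"

lemma ex_profile:
  assumes "0 < \<beta>" "0 < k" "k < 1 / pi"
  obtains c a \<phi> where "profile \<beta> k c a \<phi>"
proof -
  have "2 * k < 2 / pi" using assms by simp
  also have "\<dots> < 1" using pi_gt3 by simp
  finally have "2 * k < 1" .
  then obtain c a where ca: "0 < c" "c < 2 * k" "0 < a" "a < pi/2" "(sin a)\<^sup>2 + c\<^sup>2 = (2 * k)\<^sup>2"
    and int: "integral {0..1} (\<lambda>t. a / sqrt ((sin (a * t))\<^sup>2 + c\<^sup>2)) = 1 / \<beta>"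
    using ex_initial_slope[of k "1 / \<beta>"] assms by auto
  define w where "w y = sqrt ((sin y)\<^sup>2 + c\<^sup>2) / \<beta>" for y
  have pos: "0 < (sin y)\<^sup>2 + c\<^sup>2" for y using ca by (intro add_nonneg_pos) auto
  have wpos: "0 < w y" for y unfolding w_def using pos \<open>0 < \<beta>\<close> by simp
  have "sqrt ((sin y)\<^sup>2 + c\<^sup>2) \<le> sqrt (1 + c\<^sup>2)" for y
    by (simp add: abs_square_le_1)
  then have wB: "w y \<le> sqrt (1 + c\<^sup>2) / \<beta>" for y
    unfolding w_def using \<open>0 < \<beta>\<close> by (intro divide_right_mono) auto
  have cw: "continuous_on UNIV w" unfolding w_def using \<open>0 < \<beta>\<close> by (auto intro!: continuous_intros)
  obtain T f where T: "\<And>y. (T has_real_derivative 1 / w y) (at y)" "T 0 = 0"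
    and f: "\<And>y. f (T y) = y" "\<And>x. (f has_real_derivative w (f x)) (at x)"
    by (rule ex_autonomous_solution[OF cw wpos wB]) (rule that; assumption)
  \<comment> \<open>The travel time from 0 to \<open>a\<close>, with y = a t substituted. It is
    \<beta> times the integral over \<open>{0..1}\<close>, so the prescribed length 1 / \<beta>
    makes the arrival time 1.\<close>
  have "((\<lambda>t. \<beta> * (a / sqrt ((sin (a * t))\<^sup>2 + c\<^sup>2))) has_integral (T (a * 1) - T (a * 0))) {0..1}"
  proof (rule fundamental_theorem_of_calculus)
    fix t :: real
    have "((\<lambda>t. T (a * t)) has_real_derivative (1 / w (a * t)) * a) (at t within {0..1})"
      by (rule DERIV_chain2[OF T(1)]) (auto intro!: derivative_eq_intros)
    then show "((\<lambda>t. T (a * t)) has_vector_derivative \<beta> * (a / sqrt ((sin (a * t))\<^sup>2 + c\<^sup>2))) (at t within {0..1})"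
      using \<open>0 < \<beta>\<close> by (simp add: has_real_derivative_iff_has_vector_derivative[symmetric] w_def mult.commute)
  qed auto
  then have "\<beta> * integral {0..1} (\<lambda>t. a / sqrt ((sin (a * t))\<^sup>2 + c\<^sup>2)) = T (a * 1) - T (a * 0)"
    by (metis integral_mult_right integral_unique)
  then have "T a = 1" using int T(2) \<open>0 < \<beta>\<close> by simp
  then have "f 0 = 0" "f 1 = a" using f(1)[of 0] f(1)[of a] T(2) by simp_all
  moreover have "(f has_real_derivative sqrt ((sin (f x))\<^sup>2 + c\<^sup>2) / \<beta>) (at x)" for x
    using f(2)[of x] unfolding w_def .
  ultimately have "profile \<beta> k c a f"
    unfolding profile_def using assms ca by blast
  then show ?thesis using that by blast
qed

section \<open>Minimality and uniqueness\<close>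

text \<open>Positivity of \<open>w\<close> takes the place of a Lipschitz condition: along any
  solution \<open>T (f x) - x\<close> is constant, and the travel time \<open>T\<close> is
  injective.\<close>

lemma autonomous_unique:
  fixes w :: "real \<Rightarrow> real"
  assumes w: "continuous_on UNIV w" "\<And>y. 0 < w y"
    and f: "\<And>x. x \<in> {0..1} \<Longrightarrow> (f has_real_derivative w (f x)) (at x within {0..1})"
    and g: "\<And>x. x \<in> {0..1} \<Longrightarrow> (g has_real_derivative w (g x)) (at x within {0..1})"
    and "f 0 = g 0" and x: "x \<in> {0..1}"
  shows "f x = g x"
proof -
  have nz: "w y \<noteq> 0" for y using w(2)[of y] by simp
  have "continuous_on UNIV (\<lambda>y. 1 / w y)" using w(1) nz by (auto intro!: continuous_intros)
  then obtain T where T: "\<And>y. (T has_real_derivative 1 / w y) (at y)"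
    using ex_antiderivative by metis
  have "T y < T z" if "y < z" for y z
    using DERIV_pos_imp_increasing[OF that] T w(2) by (metis zero_less_divide_1_iff)
  then have inj: "y = z" if "T y = T z" for y z using that by (metis less_irrefl linorder_neqE_linordered_idom)
  have key: "T (h x) - T (h 0) = x"
    if h: "\<And>x. x \<in> {0..1} \<Longrightarrow> (h has_real_derivative w (h x)) (at x within {0..1})" for h
  proof -
    have "((\<lambda>y. T (h y) - y) has_real_derivative 0) (at y within {0..1})" if "y \<in> {0..1}" for y
    proof -
      have "((\<lambda>y. T (h y)) has_real_derivative (1 / w (h y)) * w (h y)) (at y within {0..1})"
        by (rule DERIV_chain2[OF T h[OF that]])
      then show ?thesis using nz[of "h y"] by (auto intro!: derivative_eq_intros)
    qed
    then have "\<exists>C. \<forall>y\<in>{0..1}. T (h y) - y = C"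
      by (intro has_field_derivative_zero_constant) auto
    then obtain C where C: "\<And>y. y \<in> {0..1} \<Longrightarrow> T (h y) - y = C" by blast
    from C[of 0] C[OF x] show ?thesis by simp
  qed
  from key[OF f] key[OF g] \<open>f 0 = g 0\<close> have "T (f x) = T (g x)" by simp
  then show ?thesis by (rule inj)
qed

lemma set_integral_square_nonneg: "0 \<le> (LBINT t:A. (f t)\<^sup>2)" for f :: "real \<Rightarrow> real"
  unfolding set_lebesgue_integral_def by (rule Bochner_Integration.integral_nonneg) auto

context profile
begin

definition w :: "real \<Rightarrow> real" where "w y = sqrt ((sin y)\<^sup>2 + c\<^sup>2)"

lemma w_pos: "0 < w y"
  unfolding w_def using c by (intro real_sqrt_gt_zero add_nonneg_pos) auto

lemma w_sq: "(w y)\<^sup>2 = (sin y)\<^sup>2 + c\<^sup>2"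
  unfolding w_def by simp

lemma continuous_w: "continuous_on S w"
  unfolding w_def by (intro continuous_intros)

lemma abs_sin_less_w: "\<bar>sin y\<bar> < w y"
  unfolding w_def using c by (intro real_less_rsqrt) simp

lemma w_le: "w y \<le> \<bar>sin y\<bar> + c"
  unfolding w_def using sqrt_add_le_add_sqrt[of "(sin y)\<^sup>2" "c\<^sup>2"] c by simp

lemma w_periodic: "w (y + pi) = w y"
  by (simp add: w_def)

lemma w_a: "w a = 2 * k"
  unfolding w_def sin_a real_sqrt_abs using k by simp

lemma \<phi>_deriv': "(\<phi> has_real_derivative w (\<phi> x) / \<beta>) (at x)"
  using \<phi>_deriv unfolding w_def .

section \<open>The boundary term as a function of the endpoint value\<close>

definition H :: "real \<Rightarrow> real" where
  "H = (SOME G. G 0 = 0 \<and> (\<forall>x. (G has_real_derivative w x) (at x)))"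

lemma H_0: "H 0 = 0" and H_deriv: "(H has_real_derivative w x) (at x)"
proof -
  obtain G where "G 0 = 0" "\<And>x. (G has_real_derivative w x) (at x)"
    using ex_antiderivative[OF continuous_w] by metis
  then have "\<exists>G. G 0 = 0 \<and> (\<forall>x. (G has_real_derivative w x) (at x))" by blast
  from someI_ex[OF this] show "H 0 = 0" "(H has_real_derivative w x) (at x)"
    unfolding H_def by auto
qed

lemma H_neg: "y < 0 \<Longrightarrow> H y < 0"
  using DERIV_pos_imp_increasing[of y 0 H] H_deriv w_pos H_0 by metis

text \<open>\<open>8 * \<beta>\<close> times the part of the energy that depends on the endpoint
  value. Its critical points solve \<open>w y = 2 * k\<close>, the natural boundary
  condition.\<close>

definition h :: "real \<Rightarrow> real" where "h y = 2 * H y - 4 * k * y"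

lemma h_0: "h 0 = 0" by (simp add: h_def H_0)

lemma h_deriv: "(h has_real_derivative 2 * w x - 4 * k) (at x)"
  unfolding h_def by (auto intro!: derivative_eq_intros H_deriv)

lemma continuous_on_h: "continuous_on S h"
  using h_deriv DERIV_isCont by (blast intro: continuous_at_imp_continuous_on)

text \<open>As \<open>w a = 2 * k\<close>, the sign of the derivative of \<open>h\<close> becomes a
  comparison of sines; this cuts [0, pi] at \<open>a\<close> and \<open>pi - a\<close>.\<close>

lemma w_less_iff: "w y < 2 * k \<longleftrightarrow> \<bar>sin y\<bar> < sin a"
proof -
  have "0 < sin a" using a by (intro sin_gt_zero) auto
  have "w y < w a \<longleftrightarrow> (sin y)\<^sup>2 < (sin a)\<^sup>2" by (simp add: w_def)
  also have "\<dots> \<longleftrightarrow> \<bar>sin y\<bar> < \<bar>sin a\<bar>" by (metis abs_le_square_iff not_le)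
  finally show ?thesis using \<open>0 < sin a\<close> by (simp add: w_a)
qed

lemma w_greater_iff: "2 * k < w y \<longleftrightarrow> sin a < \<bar>sin y\<bar>"
proof -
  have "0 < sin a" using a by (intro sin_gt_zero) auto
  have "w a < w y \<longleftrightarrow> (sin a)\<^sup>2 < (sin y)\<^sup>2" by (simp add: w_def)
  also have "\<dots> \<longleftrightarrow> \<bar>sin a\<bar> < \<bar>sin y\<bar>" by (metis abs_le_square_iff not_le)
  finally show ?thesis using \<open>0 < sin a\<close> by (simp add: w_a)
qed

lemma h_decreasing_left:
  assumes "0 \<le> x" "x < y" "y \<le> a"
  shows "h y < h x"
proof (rule DERIV_neg_imp_decreasing_open[where f = h, OF assms(2)])
  fix t assume "x < t" "t < y"
  then have "0 < t" "t < a" using assms by auto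
  then have "0 < sin t" "sin t < sin a" using a by (auto intro!: sin_gt_zero sin_monotone_2pi)
  then have "w t < 2 * k" by (simp add: w_less_iff)
  then show "\<exists>y. DERIV h t :> y \<and> y < 0" using h_deriv by (intro exI conjI) auto
qed (rule continuous_on_h)

lemma h_increasing_middle:
  assumes "a \<le> x" "x < y" "y \<le> pi - a"
  shows "h x < h y"
proof (rule DERIV_pos_imp_increasing_open[where f = h, OF assms(2)])
  fix t assume "x < t" "t < y"
  then have t: "a < t" "t < pi - a" using assms by auto
  have "sin a < sin t"
  proof (cases "t \<le> pi / 2")
    case True
    then show ?thesis using t a by (intro sin_monotone_2pi) auto
  next
    case False
    \<comment> \<open>Reflection at pi/2 returns to the interval on which the sine
      increases.\<close>
    then have "sin a < sin (pi - t)" using t a by (intro sin_monotone_2pi) auto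
    then show ?thesis by simp
  qed
  then have "2 * k < w t" by (simp add: w_greater_iff)
  then show "\<exists>y. DERIV h t :> y \<and> 0 < y" using h_deriv by (intro exI conjI) auto
qed (rule continuous_on_h)

lemma h_decreasing_right:
  assumes "pi - a \<le> x" "x < y" "y \<le> pi"
  shows "h y < h x"
proof (rule DERIV_neg_imp_decreasing_open[where f = h, OF assms(2)])
  fix t assume "x < t" "t < y"
  then have "0 < pi - t" "pi - t < a" using assms by auto
  then have "0 < sin (pi - t)" "sin (pi - t) < sin a" using a by (auto intro!: sin_gt_zero sin_monotone_2pi simp del: sin_pi_minus)
  then have "w t < 2 * k" by (simp add: w_less_iff)
  then show "\<exists>y. DERIV h t :> y \<and> y < 0" using h_deriv by (intro exI conjI) auto
qed (rule continuous_on_h)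

text \<open>Comparing \<open>w\<close> with the sine gives \<open>2 \<le> H pi\<close>, the area
  under one arch, while the linear term \<open>4 * k * pi\<close> is below 4.\<close>

lemma h_pi_pos: "0 < h pi"
proof -
  have "((\<lambda>x. H x + cos x) has_real_derivative w x - sin x) (at x)" for x
    by (auto intro!: derivative_eq_intros H_deriv)
  moreover have "0 \<le> w x - sin x" for x using abs_sin_less_w[of x] by linarith
  ultimately have "H 0 + cos 0 \<le> H pi + cos pi"
    using DERIV_nonneg_imp_nondecreasing[of 0 pi "\<lambda>x. H x + cos x"] pi_ge_zero by blast
  then have "2 \<le> H pi" by (simp add: H_0)
  moreover have "pi * k < 1" using k by (simp add: field_simps)
  ultimately show ?thesis by (simp add: h_def mult.commute)
qed

lemma h_shift: "h (y + pi) = h y + h pi"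
proof -
  have "((\<lambda>y. H (y + pi) - H y) has_real_derivative w (y + pi) * 1 - w y) (at y)" for y
    by (intro derivative_intros DERIV_chain2[OF H_deriv] H_deriv) (auto intro!: derivative_eq_intros)
  then have "\<forall>y. ((\<lambda>y. H (y + pi) - H y) has_real_derivative 0) (at y)" by (simp add: w_periodic)
  from DERIV_isconst_all[OF this, of y 0] have "H (y + pi) - H y = H pi" by (simp add: H_0)
  then show ?thesis by (simp add: h_def algebra_simps)
qed

lemma h_a_neg: "h a < 0"
  using h_decreasing_left[of 0 a] a h_0 by simp

lemma h_strict_min: "0 \<le> b \<Longrightarrow> b \<noteq> a \<Longrightarrow> h a < h b"
proof -
  have "b \<le> real n * pi \<Longrightarrow> 0 \<le> b \<Longrightarrow> b \<noteq> a \<Longrightarrow> h a < h b" for n b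
  proof (induction n arbitrary: b)
    case 0
    then show ?case using h_a_neg h_0 by auto
  next
    case (Suc n)
    consider "b < a" | "a < b" "b \<le> pi - a" | "pi - a < b" "b \<le> pi" | "pi < b"
      using Suc.prems by linarith
    then show ?case
    proof cases
      case 1
      then show ?thesis using h_decreasing_left[of b a] Suc.prems by simp
    next
      case 2
      then show ?thesis using h_increasing_middle[of a b] by simp
    next
      case 3
      then have "h pi \<le> h b" using h_decreasing_right[of b pi] by (cases "b = pi") auto
      then show ?thesis using h_pi_pos h_a_neg by linarith
    next
      case 4
      \<comment> \<open>\<open>b - pi\<close> may coincide with \<open>a\<close>, which the
        induction hypothesis excludes. A weak inequality suffices here, since the increment
        \<open>h pi\<close> supplies the strictness.\<close>
      have "h a \<le> h (b - pi)"
        using Suc.IH[of "b - pi"] Suc.prems 4 by (cases "b - pi = a") (auto simp: algebra_simps)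
      then show ?thesis using h_shift[of "b - pi"] h_pi_pos by simp
    qed
  qed
  moreover obtain n where "b \<le> real n * pi"
    using real_arch_simple[of "b / pi"] by (auto simp: field_simps)
  ultimately show "0 \<le> b \<Longrightarrow> b \<noteq> a \<Longrightarrow> h a < h b" by blast
qed

section \<open>Comparison of energies\<close>

definition V :: real where "V = h a / (8 * \<beta>) - c\<^sup>2 / (8 * \<beta>\<^sup>2)"

lemma F_eq_square:
  assumes wd: "is_wderiv \<psi> g" and "\<psi> 0 = 0"
  shows "F \<beta> (k / \<beta>) \<psi> = 1/8 * (LBINT t:{0..1}. (g t - w (\<psi> t) / \<beta>)\<^sup>2)
    + h (\<psi> 1) / (8 * \<beta>) - c\<^sup>2 / (8 * \<beta>\<^sup>2)"
proof -
  have "1 / (4 * \<beta>) * H (\<psi> 1) - k / \<beta> / 2 * \<psi> 1 = h (\<psi> 1) / (8 * \<beta>)"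
    using \<beta> by (simp add: h_def field_simps)
  then show ?thesis
    using F_calibration(2)[OF wd H_deriv continuous_w w_sq, of 1 \<beta> "k / \<beta>"] assms(2) H_0 by simp
qed

text \<open>With the opposite sign of the calibration, the contribution of \<open>H\<close> is
  positive because \<open>H\<close> is negative on the left half-line, and so is the linear term. On
  the other side, \<open>h a < 0\<close> puts \<open>V\<close> below the common constant.\<close>

lemma F_greater_if_neg:
  assumes wd: "is_wderiv \<psi> g" and "\<psi> 0 = 0" "\<psi> 1 < 0"
  shows "V < F \<beta> (k / \<beta>) \<psi>"
proof -
  have "F \<beta> (k / \<beta>) \<psi> = 1/8 * (LBINT t:{0..1}. (g t - (-1) * w (\<psi> t) / \<beta>)\<^sup>2)
      + (-1) / (4 * \<beta>) * H (\<psi> 1) - c\<^sup>2 / (8 * \<beta>\<^sup>2) - k / \<beta> / 2 * \<psi> 1"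
    using F_calibration(2)[OF wd H_deriv continuous_w w_sq, of "-1" \<beta> "k / \<beta>"] assms(2) H_0 by simp
  moreover have "0 \<le> (LBINT t:{0..1}. (g t - (-1) * w (\<psi> t) / \<beta>)\<^sup>2)"
    by (rule set_integral_square_nonneg)
  moreover have "0 < (-1) / (4 * \<beta>) * H (\<psi> 1)"
    using H_neg[OF assms(3)] \<beta> by (simp add: mult_neg_neg divide_neg_pos field_simps)
  moreover have "k / \<beta> / 2 * \<psi> 1 < 0" using k \<beta> assms(3) by (intro mult_pos_neg) auto
  moreover have "h a / (8 * \<beta>) < 0" using h_a_neg \<beta> by (intro divide_neg_pos) auto
  ultimately show ?thesis unfolding V_def by linarith
qed

lemma is_wderiv_\<phi>: "is_wderiv \<phi> (\<lambda>x. w (\<phi> x) / \<beta>)"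
proof (rule is_wderivI)
  show "(\<phi> has_real_derivative w (\<phi> x) / \<beta>) (at x within {0..1})" for x
    by (rule has_field_derivative_at_within[OF \<phi>_deriv'])
  have "continuous_on {0..1} \<phi>"
    using \<phi>_deriv' DERIV_isCont by (blast intro: continuous_at_imp_continuous_on)
  then have "continuous_on {0..1} (\<lambda>x. w (\<phi> x))"
    by (rule continuous_on_compose2[OF continuous_w[of UNIV]]) auto
  then show "continuous_on {0..1} (\<lambda>x. w (\<phi> x) / \<beta>)"
    using \<beta> by (intro continuous_intros) auto
qed

lemma F_\<phi>: "F \<beta> (k / \<beta>) \<phi> = V"
  using F_eq_square[OF is_wderiv_\<phi> \<phi>_0] by (simp add: V_def \<phi>_1 set_lebesgue_integral_def)

lemma F_ge:
  assumes wd: "is_wderiv \<psi> g" and "\<psi> 0 = 0"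
  shows "V \<le> F \<beta> (k / \<beta>) \<psi>"
proof (cases "\<psi> 1 < 0")
  case True
  then show ?thesis using F_greater_if_neg[OF assms] by simp
next
  case False
  have "h a \<le> h (\<psi> 1)" using h_strict_min[of "\<psi> 1"] False by (cases "\<psi> 1 = a") auto
  then have "h a / (8 * \<beta>) \<le> h (\<psi> 1) / (8 * \<beta>)" using \<beta> by (intro divide_right_mono) auto
  moreover have "0 \<le> (LBINT t:{0..1}. (g t - w (\<psi> t) / \<beta>)\<^sup>2)"
    by (rule set_integral_square_nonneg)
  ultimately show ?thesis unfolding F_eq_square[OF assms] V_def by linarith
qed

text \<open>Equality kills the square, so \<open>g\<close> agrees almost everywhere with the
  continuous function \<open>w (\<psi> t) / \<beta>\<close>. Integrating makes \<open>\<psi>\<close>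
  a classical solution, which its value at 0 determines.\<close>

lemma F_eq_V_imp:
  assumes wd: "is_wderiv \<psi> g" and \<psi>0: "\<psi> 0 = 0" and eq: "F \<beta> (k / \<beta>) \<psi> = V" and x: "x \<in> {0..1}"
  shows "\<psi> x = \<phi> x"
proof -
  define I where "I = (LBINT t:{0..1}. (g t - w (\<psi> t) / \<beta>)\<^sup>2)"
  have I: "0 \<le> I" unfolding I_def by (rule set_integral_square_nonneg)
  have nn: "0 \<le> \<psi> 1" using F_greater_if_neg[OF wd \<psi>0] eq by linarith
  have "h a \<le> h (\<psi> 1)" using h_strict_min[of "\<psi> 1"] nn by (cases "\<psi> 1 = a") auto
  then have "h a / (8 * \<beta>) \<le> h (\<psi> 1) / (8 * \<beta>)" using \<beta> by (intro divide_right_mono) auto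
  then have "I = 0" using I eq unfolding F_eq_square[OF wd \<psi>0] V_def I_def[symmetric] by linarith
  have int: "integrable lborel (\<lambda>t. indicator {0..1} t *\<^sub>R (g t - w (\<psi> t) / \<beta>)\<^sup>2)"
    using F_calibration(1)[OF wd H_deriv continuous_w w_sq, of 1 \<beta>] unfolding set_integrable_def by simp
  have "AE t in lborel. indicator {0..1} t *\<^sub>R (g t - w (\<psi> t) / \<beta>)\<^sup>2 = 0"
    using \<open>I = 0\<close> unfolding I_def set_lebesgue_integral_def
    by (subst (asm) integral_nonneg_eq_0_iff_AE[OF int]) auto
  then have ae: "AE t in lborel. t \<in> {0..1} \<longrightarrow> g t = w (\<psi> t) / \<beta>"
    by eventually_elim (auto split: split_indicator)
  have c\<psi>: "continuous_on {0..1} \<psi>" by (rule is_wderiv_continuous_on[OF wd])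
  have cW: "continuous_on {0..1} (\<lambda>t. w (\<psi> t) / \<beta>)"
    using \<beta> by (intro continuous_intros continuous_on_compose2[OF continuous_w[of UNIV] c\<psi>]) auto
  have \<psi>_eq: "\<psi> y = integral {0..y} (\<lambda>t. w (\<psi> t) / \<beta>)" if "y \<in> {0..1}" for y
  proof -
    have "set_integrable lborel {0..y} g"
      using that by (intro set_integrable_subset[OF is_wderiv_integrable[OF wd]]) auto
    moreover have i: "set_integrable lborel {0..y} (\<lambda>t. w (\<psi> t) / \<beta>)"
      using that by (intro borel_integrable_atLeastAtMost' continuous_on_subset[OF cW]) auto
    moreover have "AE t in lborel. indicator {0..y} t *\<^sub>R g t = indicator {0..y} t *\<^sub>R (w (\<psi> t) / \<beta>)"
      using ae by eventually_elim (use that in \<open>auto split: split_indicator\<close>)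
    ultimately have "(LBINT t:{0..y}. g t) = (LBINT t:{0..y}. w (\<psi> t) / \<beta>)"
      unfolding set_lebesgue_integral_def set_integrable_def
      by (intro integral_cong_AE borel_measurable_integrable)
    then show ?thesis
      using is_wderivD[OF wd that] \<psi>0 set_borel_integral_eq_integral(2)[OF i] by simp
  qed
  have d\<psi>: "(\<psi> has_real_derivative w (\<psi> y) / \<beta>) (at y within {0..1})" if y: "y \<in> {0..1}" for y
  proof -
    have "((\<lambda>u. integral {0..u} (\<lambda>t. w (\<psi> t) / \<beta>)) has_real_derivative w (\<psi> y) / \<beta>) (at y within {0..1})"
      by (rule integral_has_real_derivative[OF cW y])
    then show ?thesis
      by (rule has_field_derivative_transform_within[OF _ zero_less_one y]) (simp add: \<psi>_eq)
  qed
  have "continuous_on UNIV (\<lambda>y. w y / \<beta>)"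
    using \<beta> continuous_w by (intro continuous_intros) auto
  moreover have "0 < w y / \<beta>" for y using w_pos \<beta> by simp
  ultimately show ?thesis
    by (rule autonomous_unique[where w = "\<lambda>y. w y / \<beta>"])
       (use d\<psi> \<phi>_deriv' \<psi>0 \<phi>_0 x in \<open>auto intro: has_field_derivative_at_within\<close>)
qed

lemma is_minimizer_\<phi>: "is_minimizer \<beta> (k / \<beta>) \<phi>"
  unfolding is_minimizer_def J_def H1_def using is_wderiv_\<phi> \<phi>_0 F_\<phi> F_ge by auto

lemma is_minimizer_unique:
  assumes "is_minimizer \<beta> (k / \<beta>) \<psi>" "x \<in> {0..1}"
  shows "\<psi> x = \<phi> x"
proof -
  obtain g where g: "is_wderiv \<psi> g" "\<psi> 0 = 0"
    using assms(1) unfolding is_minimizer_def J_def H1_def by blast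
  have "\<phi> \<in> J" using is_minimizer_\<phi> unfolding is_minimizer_def by blast
  then have "F \<beta> (k / \<beta>) \<psi> \<le> V" using assms(1) F_\<phi> unfolding is_minimizer_def by force
  then show ?thesis using F_ge[OF g] F_eq_V_imp[OF g _ assms(2)] by linarith
qed

lemma minimizer_eq:
  assumes "x \<in> {0..1}"
  shows "minimizer \<beta> (k / \<beta>) x = \<phi> x"
  using is_minimizer_unique[OF _ assms] someI[of "is_minimizer \<beta> (k / \<beta>)", OF is_minimizer_\<phi>]
  unfolding minimizer_def by blast

lemma F_minimizer: "F \<beta> (k / \<beta>) (minimizer \<beta> (k / \<beta>)) = V"
proof -
  have "is_minimizer \<beta> (k / \<beta>) (minimizer \<beta> (k / \<beta>))"
    unfolding minimizer_def by (rule someI[of "is_minimizer \<beta> (k / \<beta>)", OF is_minimizer_\<phi>])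
  \<comment> \<open>\<open>minimizer\<close> and \<open>\<phi>\<close> may differ outside [0,1], so
    the energies are compared through the minimality of both rather than by substitution.\<close>
  then have "F \<beta> (k / \<beta>) (minimizer \<beta> (k / \<beta>)) = F \<beta> (k / \<beta>) \<phi>"
    using is_minimizer_\<phi> unfolding is_minimizer_def by (meson order_antisym)
  then show ?thesis by (simp add: F_\<phi>)
qed

end

section \<open>Exponential decay and the minimal energy\<close>

text \<open>A rate common to all parameters: the sine of the angle is at most
  \<open>2 * k < 2 / pi\<close>, whatever \<beta> is.\<close>

definition decay_rate :: real where "decay_rate = sqrt (1 - (2 / pi)\<^sup>2)"

lemma decay_rate_pos: "0 < decay_rate" and decay_rate_le_1: "decay_rate \<le> 1"
proof -
  have "(2 / pi)\<^sup>2 < 1\<^sup>2" using pi_gt3 by (intro power_strict_mono) auto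
  then show "0 < decay_rate" "decay_rate \<le> 1" by (auto simp: decay_rate_def)
qed

lemma decay_rate_le_cos:
  assumes "0 \<le> sin x" "sin x \<le> 2 / pi" "0 \<le> cos x"
  shows "decay_rate \<le> cos x"
proof -
  have "(sin x)\<^sup>2 \<le> (2 / pi)\<^sup>2" using assms by (intro power_mono) auto
  then have "1 - (2 / pi)\<^sup>2 \<le> (cos x)\<^sup>2" using sin_cos_squared_add[of x] by linarith
  then show ?thesis unfolding decay_rate_def using assms(3) by (intro real_le_lsqrt) auto
qed

context profile
begin

lemma two_k: "2 * k < 2 / pi" "2 * k < 1"
proof -
  show "2 * k < 2 / pi" using k by simp
  also have "2 / pi < 1" using pi_gt3 by simp
  finally show "2 * k < 1" .
qed

lemma sin_a_pos: "0 < sin a"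
  using a by (intro sin_gt_zero) auto

lemma c_less: "c < 2 * k"
proof -
  have "c\<^sup>2 < (2 * k)\<^sup>2" using sin_a zero_less_power[OF sin_a_pos, of 2] by linarith
  then show ?thesis using k by (intro power_less_imp_less_base[of c 2]) auto
qed

lemma sin_a_le: "sin a \<le> 2 * k"
proof -
  have "(sin a)\<^sup>2 \<le> (2 * k)\<^sup>2" using sin_a zero_le_power2[of c] by linarith
  then show ?thesis by (rule power2_le_imp_le) (use k in auto)
qed

lemma sin_a_ge: "2 * k - c \<le> sin a"
proof -
  have "(2 * k - c)\<^sup>2 = (2 * k)\<^sup>2 - c\<^sup>2 - 2 * c * (2 * k - c)" by (simp add: power2_eq_square algebra_simps)
  also have "\<dots> \<le> (sin a)\<^sup>2"
  proof -
    have "0 \<le> 2 * c * (2 * k - c)" using c c_less by (intro mult_nonneg_nonneg) auto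
    then show ?thesis using sin_a by linarith
  qed
  finally show ?thesis by (rule power2_le_imp_le) (use sin_a_pos in auto)
qed

lemma \<phi>_strict_mono: "x < y \<Longrightarrow> \<phi> x < \<phi> y"
  using DERIV_pos_imp_increasing[of x y \<phi>] \<phi>_deriv' w_pos \<beta> by (metis divide_pos_pos)

lemma \<phi>_mono: "x \<le> y \<Longrightarrow> \<phi> x \<le> \<phi> y"
  using \<phi>_strict_mono by (cases "x = y") (auto simp: less_imp_le)

lemma \<phi>_bounds: "x \<in> {0..1} \<Longrightarrow> 0 \<le> \<phi> x \<and> \<phi> x \<le> a"
  using \<phi>_mono[of 0 x] \<phi>_mono[of x 1] by (simp add: \<phi>_0 \<phi>_1)

lemma \<phi>_strict_bounds: "x \<in> {0<..<1} \<Longrightarrow> 0 < \<phi> x \<and> \<phi> x < pi / 2"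
  using \<phi>_strict_mono[of 0 x] \<phi>_strict_mono[of x 1] a by (simp add: \<phi>_0 \<phi>_1)

lemma cos_\<phi>_pos: "x \<in> {0..1} \<Longrightarrow> 0 < cos (\<phi> x)"
  using \<phi>_bounds[of x] a by (intro cos_gt_zero_pi) auto

lemma sin_\<phi>_bounds: "x \<in> {0..1} \<Longrightarrow> 0 \<le> sin (\<phi> x) \<and> sin (\<phi> x) \<le> sin a"
  using \<phi>_bounds[of x] a by (intro conjI sin_ge_zero sin_monotone_2pi_le) auto

lemma cos_\<phi>_ge: "x \<in> {0..1} \<Longrightarrow> decay_rate \<le> cos (\<phi> x)"
  using sin_\<phi>_bounds[of x] sin_a_le two_k cos_\<phi>_pos[of x] by (intro decay_rate_le_cos) auto

lemma w_deriv: "(w has_real_derivative sin y * cos y / w y) (at y)"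
proof -
  have "(sin y)\<^sup>2 + c\<^sup>2 > 0" using c by (intro add_nonneg_pos) auto
  then have "((\<lambda>y. sqrt ((sin y)\<^sup>2 + c\<^sup>2)) has_real_derivative
      (2 * sin y * cos y) * (inverse (sqrt ((sin y)\<^sup>2 + c\<^sup>2)) / 2)) (at y)"
    by (auto intro!: derivative_eq_intros)
  then have "(w has_real_derivative (2 * sin y * cos y) * (inverse (w y) / 2)) (at y)"
    unfolding w_def[abs_def] .
  then show ?thesis by (rule DERIV_cong) (use w_pos[of y] in \<open>simp add: field_simps\<close>)
qed

lemma w_\<phi>_deriv: "((\<lambda>x. w (\<phi> x)) has_real_derivative sin (\<phi> x) * cos (\<phi> x) / \<beta>) (at x)"
  using DERIV_chain2[OF w_deriv \<phi>_deriv', of x] w_pos[of "\<phi> x"] by simp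

text \<open>Along the flow, each of \<open>sin \<phi>\<close> and \<open>w \<phi>\<close> has as
  derivative the other one times \<open>cos \<phi> / \<beta>\<close>. Their sum thus solves a linear
  equation with this coefficient, and the exponential weight leaves the nonnegative factor
  \<open>cos \<phi> - decay_rate\<close>.\<close>

lemma decay:
  assumes "x \<in> {0..1}"
  shows "w (\<phi> x) \<le> 4 * k * exp (- decay_rate * (1 - x) / \<beta>)"
proof -
  define u where "u x = (sin (\<phi> x) + w (\<phi> x)) * exp (decay_rate * (1 - x) / \<beta>)" for x
  have "u x \<le> u 1"
  proof (rule DERIV_nonneg_imp_nondecreasing[where f = u])
    fix y assume "x \<le> y" "y \<le> 1"
    then have y: "y \<in> {0..1}" using assms by auto
    define u' where "u' = (cos (\<phi> y) - decay_rate) * (sin (\<phi> y) + w (\<phi> y)) / \<beta> * exp (decay_rate * (1 - y) / \<beta>)"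
    have ed: "((\<lambda>x. exp (decay_rate * (1 - x) / \<beta>)) has_real_derivative
        - decay_rate / \<beta> * exp (decay_rate * (1 - y) / \<beta>)) (at y)"
      using \<beta> by (auto intro!: derivative_eq_intros)
    have "(u has_real_derivative u') (at y)"
      unfolding u_def u'_def
      by (rule DERIV_cong[OF DERIV_mult[OF DERIV_add[OF DERIV_chain2[OF DERIV_sin \<phi>_deriv'] w_\<phi>_deriv] ed]])
        (simp add: algebra_simps add_divide_distrib diff_divide_distrib)
    moreover have "0 \<le> u'"
      unfolding u'_def using cos_\<phi>_ge[OF y] sin_\<phi>_bounds[OF y] w_pos[of "\<phi> y"] \<beta>
      by (intro mult_nonneg_nonneg divide_nonneg_pos) auto
    ultimately show "\<exists>d. (u has_real_derivative d) (at y) \<and> 0 \<le> d" by blast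
  qed (use assms in auto)
  \<comment> \<open>At the right end \<open>w a = 2 * k\<close> and
    \<open>sin a \<le> 2 * k\<close>, whence the constant 4.\<close>
  also have "u 1 \<le> 4 * k" using sin_a_le w_a by (simp add: u_def \<phi>_1)
  finally have "u x \<le> 4 * k" .
  moreover have "0 \<le> sin (\<phi> x) * exp (decay_rate * (1 - x) / \<beta>)"
    using sin_\<phi>_bounds[OF assms] by simp
  ultimately have "w (\<phi> x) * exp (decay_rate * (1 - x) / \<beta>) \<le> 4 * k"
    unfolding u_def distrib_right by linarith
  then have "w (\<phi> x) \<le> 4 * k / exp (decay_rate * (1 - x) / \<beta>)" by (simp add: pos_le_divide_eq)
  then show ?thesis by (simp add: exp_minus divide_inverse)
qed

lemma c_le: "c \<le> 4 * k * exp (- decay_rate / \<beta>)"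
  using decay[of 0] c by (simp add: \<phi>_0 w_def)

text \<open>The slope bound passes to \<open>\<phi>\<close> by the mean value theorem, starting from
  \<open>\<phi> 0 = 0\<close>; the exponential only grows when the intermediate point is moved to
  \<open>x\<close>. The lost factor 1 / \<beta> is harmless against exponential decay.\<close>

lemma \<phi>_le:
  assumes "x \<in> {0..1}"
  shows "\<phi> x \<le> 4 * k * exp (- decay_rate * (1 - x) / \<beta>) / \<beta>"
proof (cases "x = 0")
  case False
  then obtain z where z: "0 < z" "z < x" "\<phi> x - \<phi> 0 = (x - 0) * (w (\<phi> z) / \<beta>)"
    using MVT2[of 0 x \<phi> "\<lambda>z. w (\<phi> z) / \<beta>"] \<phi>_deriv' assms by force
  have "\<phi> x \<le> w (\<phi> z) / \<beta>"
    using z(3) assms w_pos[of "\<phi> z"] \<beta> mult_right_mono[of x 1 "w (\<phi> z) / \<beta>"] by (simp add: \<phi>_0)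
  also have "\<dots> \<le> 4 * k * exp (- decay_rate * (1 - z) / \<beta>) / \<beta>"
    using decay[of z] z assms \<beta> by (intro divide_right_mono) auto
  also have "\<dots> \<le> 4 * k * exp (- decay_rate * (1 - x) / \<beta>) / \<beta>"
  proof -
    have "- decay_rate * (1 - z) / \<beta> \<le> - decay_rate * (1 - x) / \<beta>"
      using z \<beta> decay_rate_pos by (intro divide_right_mono mult_left_mono_neg) auto
    then show ?thesis using \<beta> k by (intro divide_right_mono mult_left_mono) auto
  qed
  finally show ?thesis .
qed (use \<phi>_0 k \<beta> in auto)

text \<open>For solutions of u' = sin u / \<beta> the quantity tan(u/2) exp((1 - x)/\<beta>) is
  conserved. Here the slope strictly exceeds \<open>sin (\<phi> x) / \<beta>\<close>, so the
  quantity strictly increases towards \<open>tan (a / 2)\<close>.\<close>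

lemma \<phi>_less_arctan:
  assumes "x \<in> {0..<1}"
  shows "\<phi> x < 2 * arctan (tan (a / 2) * exp ((x - 1) / \<beta>))"
proof -
  define q where "q x = tan (\<phi> x / 2) * exp ((1 - x) / \<beta>)" for x
  have "q x < q 1"
  proof (rule DERIV_pos_imp_increasing[where f = q])
    fix y assume "x \<le> y" "y \<le> 1"
    then have y: "y \<in> {0..1}" using assms by auto
    have "0 < cos (\<phi> y / 2)" using \<phi>_bounds[OF y] a by (intro cos_gt_zero_pi) auto
    then have nz: "cos (\<phi> y / 2) \<noteq> 0" by simp
    define C where "C = cos (\<phi> y / 2)"
    have t: "tan (\<phi> y / 2) = sin (\<phi> y) / (2 * C\<^sup>2)"
      using sin_double[of "\<phi> y / 2"] nz by (simp add: tan_def C_def power2_eq_square)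
    define q' where "q' = (w (\<phi> y) - sin (\<phi> y)) / (2 * \<beta> * C\<^sup>2) * exp ((1 - y) / \<beta>)"
    have "(q has_real_derivative
       (w (\<phi> y) / \<beta> / 2 * inverse (C\<^sup>2)) * exp ((1 - y) / \<beta>) + tan (\<phi> y / 2) * (exp ((1 - y) / \<beta>) * (- 1 / \<beta>))) (at y)"
      unfolding q_def C_def using nz \<beta>
      by (auto intro!: derivative_eq_intros \<phi>_deriv' simp: mult_ac)
    also have "(w (\<phi> y) / \<beta> / 2 * inverse (C\<^sup>2)) * exp ((1 - y) / \<beta>) + tan (\<phi> y / 2) * (exp ((1 - y) / \<beta>) * (- 1 / \<beta>)) = q'"
    proof -
      have "(p / \<beta> / 2 * inverse D) * X + s / (2 * D) * (X * (- 1 / \<beta>)) = (p - s) / (2 * \<beta> * D) * X"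
        if "D \<noteq> 0" for p s D X :: real
        using that \<beta> by (simp add: field_simps)
      then show ?thesis unfolding t q'_def using nz by (simp add: C_def)
    qed
    finally have "(q has_real_derivative q') (at y)" .
    moreover have "0 < q'"
      unfolding q'_def using abs_sin_less_w[of "\<phi> y"] \<beta> nz
      by (intro mult_pos_pos divide_pos_pos) (auto simp: C_def)
    ultimately show "\<exists>d. (q has_real_derivative d) (at y) \<and> 0 < d" by blast
  qed (use assms in auto)
  then have "tan (\<phi> x / 2) * exp ((1 - x) / \<beta>) < tan (a / 2)" by (simp add: q_def \<phi>_1)
  then have "tan (\<phi> x / 2) < tan (a / 2) * exp ((x - 1) / \<beta>)"
  proof -
    have "exp ((x - 1) / \<beta>) = inverse (exp ((1 - x) / \<beta>))"
      by (simp add: exp_minus[symmetric] minus_divide_left)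
    with \<open>tan (\<phi> x / 2) * exp ((1 - x) / \<beta>) < tan (a / 2)\<close> show ?thesis
      by (simp add: divide_inverse[symmetric] pos_less_divide_eq)
  qed
  then have "arctan (tan (\<phi> x / 2)) < arctan (tan (a / 2) * exp ((x - 1) / \<beta>))"
    by (rule arctan_monotone)
  moreover have "arctan (tan (\<phi> x / 2)) = \<phi> x / 2"
    using \<phi>_bounds[of x] assms a by (intro arctan_tan) auto
  ultimately show ?thesis by simp
qed

text \<open>The sines of the two angles are \<open>2 * k\<close> and at least
  \<open>2 * k - c\<close>, and between them the cosine stays above
  \<open>decay_rate\<close>.\<close>

lemma arcsin_minus_a: "0 \<le> arcsin (2 * k) - a" "decay_rate * (arcsin (2 * k) - a) \<le> c"
proof -
  define a0 where "a0 = arcsin (2 * k)"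
  have b: "- 1 \<le> 2 * k" "2 * k \<le> 1" using two_k k by auto
  have s0: "sin a0 = 2 * k" unfolding a0_def using b by (rule sin_arcsin)
  have "arcsin (sin a) = a" using a by (intro arcsin_sin) auto
  then have le: "a \<le> a0" unfolding a0_def using arcsin_le_arcsin[of "sin a" "2 * k"] sin_a_le b sin_a_pos by simp
  have a0: "a0 < pi / 2" unfolding a0_def using arcsin_lt_bounded[of "2 * k"] two_k k by simp
  show "0 \<le> arcsin (2 * k) - a" using le by (simp add: a0_def)
  have "decay_rate * (a0 - a) \<le> c"
  proof (cases "a = a0")
    case False
    then obtain z where z: "a < z" "z < a0" "sin a0 - sin a = (a0 - a) * cos z"
      using MVT2[of a a0 sin cos] le by (auto intro: DERIV_sin)
    have "sin z \<le> sin a0" using z a a0 by (intro sin_monotone_2pi_le) auto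
    then have "decay_rate \<le> cos z"
      using z a a0 s0 two_k by (intro decay_rate_le_cos cos_ge_zero sin_ge_zero) auto
    then have "decay_rate * (a0 - a) \<le> (a0 - a) * cos z" using le by (simp add: mult.commute mult_right_mono)
    also have "\<dots> \<le> c" using z(3) s0 sin_a_ge by linarith
    finally show ?thesis .
  qed (use c in simp)
  then show "decay_rate * (arcsin (2 * k) - a) \<le> c" by (simp add: a0_def)
qed

text \<open>On [0, a] the function \<open>w\<close> lies between \<open>sin\<close> and
  \<open>sin + c\<close>. This replaces the elliptic integral \<open>H a\<close> by an elementary
  value with an error linear in \<open>c\<close>.\<close>

lemma H_a_bounds: "1 - cos a \<le> H a" "H a \<le> 1 - cos a + c * a"
proof -
  have d1: "((\<lambda>x. H x + cos x) has_real_derivative w x - sin x) (at x)" for x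
    by (auto intro!: derivative_eq_intros H_deriv)
  have d2: "((\<lambda>x. c * x - H x - cos x) has_real_derivative c - w x + sin x) (at x)" for x
    by (auto intro!: derivative_eq_intros H_deriv)
  have "0 \<le> w x - sin x" for x using abs_sin_less_w[of x] by linarith
  then have "H 0 + cos 0 \<le> H a + cos a"
    using DERIV_nonneg_imp_nondecreasing[of 0 a "\<lambda>x. H x + cos x"] d1 a by (metis less_imp_le)
  then show "1 - cos a \<le> H a" by (simp add: H_0)
  have "0 \<le> c - w x + sin x" if "0 \<le> x" "x \<le> a" for x
    using w_le[of x] sin_ge_zero[of x] that a by simp
  then have "c * 0 - H 0 - cos 0 \<le> c * a - H a - cos a"
    using DERIV_nonneg_imp_nondecreasing[of 0 a "\<lambda>x. c * x - H x - cos x"] d2 a by (metis less_imp_le)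
  then show "H a \<le> 1 - cos a + c * a" by (simp add: H_0)
qed

text \<open>Replacing \<open>H a\<close> by \<open>1 - cos a\<close> and then \<open>a\<close> by
  \<open>a0\<close> costs terms linear in \<open>c\<close>; what remains is
  \<open>c\<^sup>2 / \<beta>\<close>. As \<open>c\<close> is exponentially small, so is the total,
  up to powers of 1 / \<beta>.\<close>

lemma V_estimate:
  defines "a0 \<equiv> arcsin (2 * k)" and "e \<equiv> exp (- decay_rate / \<beta>)"
  shows "\<bar>V - ((1 - sqrt (1 - 4 * k\<^sup>2)) / (4 * \<beta>) - k / (2 * \<beta>) * a0)\<bar>
    \<le> (1 + 1 / decay_rate) * (e / \<beta>) + e / \<beta>\<^sup>2"
proof -
  note d = decay_rate_pos
  have e: "0 < e" "e \<le> 1" unfolding e_def using d \<beta> by auto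
  have "4 * k * e \<le> 2 * e" using two_k e by (intro mult_right_mono) auto
  then have ce: "c \<le> 2 * e" using c_le unfolding e_def[symmetric] by linarith
  have c1: "c \<le> 1" using c_less two_k by linarith
  have b: "- 1 \<le> 2 * k" "2 * k \<le> 1" using two_k k by auto
  have cos0: "sqrt (1 - 4 * k\<^sup>2) = cos a0" unfolding a0_def using b by (subst cos_arcsin) (auto simp: power_mult_distrib)
  have am: "0 \<le> a0 - a" "a0 - a \<le> c / decay_rate"
    using arcsin_minus_a d by (auto simp: a0_def field_simps)
  have "\<bar>cos a0 - cos a\<bar> \<le> a0 - a"
  proof (cases "a = a0")
    case False
    then obtain z where "cos a0 - cos a = (a0 - a) * (- sin z)"
      using MVT2[of a a0 cos "\<lambda>x. - sin x"] am DERIV_cos by force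
    then have "\<bar>cos a0 - cos a\<bar> = (a0 - a) * \<bar>sin z\<bar>" using am by (simp add: abs_mult)
    also have "\<dots> \<le> (a0 - a) * 1" using am by (intro mult_left_mono) auto
    finally show ?thesis by simp
  qed simp
  moreover have "\<bar>4 * k * (a0 - a)\<bar> \<le> 2 * (a0 - a)"
    using two_k k am mult_right_mono[of "4 * k" 2 "a0 - a"] by simp
  moreover have "c * a \<le> c * 2" using c a pi_less_4 by (intro mult_left_mono) auto
  moreover have "c * c \<le> 2 * e * 1" using ce c1 c e by (intro mult_mono) auto
  then have "c\<^sup>2 / \<beta> \<le> 2 * e / \<beta>" using \<beta> by (intro divide_right_mono) (auto simp: power2_eq_square)
  moreover have "0 \<le> c\<^sup>2 / \<beta>" using \<beta> by simp
  moreover have "c / decay_rate \<le> 2 * e / decay_rate" using ce d by (intro divide_right_mono) auto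
  \<comment> \<open>The first term is at most \<open>2 * c * a \<le> 4 * c \<le> 8 * e\<close>. The
    cosine difference and the linear term together stay below
    \<open>4 * (a0 - a) \<le> 8 * e / decay_rate\<close>, and the last one below
    \<open>2 * e / \<beta>\<close>.\<close>
  ultimately have "\<bar>2 * (H a - (1 - cos a)) + 2 * (cos a0 - cos a) + 4 * k * (a0 - a) - c\<^sup>2 / \<beta>\<bar>
      \<le> 8 * e + 8 * (e / decay_rate) + 8 * (e / \<beta>)"
    using H_a_bounds ce am e by (simp only: abs_le_iff) (intro conjI; simp; linarith)
  then have "\<bar>2 * (H a - (1 - cos a)) + 2 * (cos a0 - cos a) + 4 * k * (a0 - a) - c\<^sup>2 / \<beta>\<bar> / (8 * \<beta>)
      \<le> (8 * e + 8 * (e / decay_rate) + 8 * (e / \<beta>)) / (8 * \<beta>)"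
    using \<beta> by (intro divide_right_mono) auto
  moreover have "\<bar>x / (8 * \<beta>)\<bar> = \<bar>x\<bar> / (8 * \<beta>)" for x
    using \<beta> by (simp add: abs_divide abs_mult)
  moreover have "V - ((1 - sqrt (1 - 4 * k\<^sup>2)) / (4 * \<beta>) - k / (2 * \<beta>) * a0)
      = (2 * (H a - (1 - cos a)) + 2 * (cos a0 - cos a) + 4 * k * (a0 - a) - c\<^sup>2 / \<beta>) / (8 * \<beta>)"
    unfolding cos0 V_def h_def using \<beta> by (simp add: field_simps power2_eq_square)
  moreover have "(1 + 1 / decay_rate) * (e / \<beta>) + e / \<beta>\<^sup>2 = (8 * e + 8 * (e / decay_rate) + 8 * (e / \<beta>)) / (8 * \<beta>)"
    using \<beta> d by (simp add: field_simps power2_eq_square)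
  ultimately show ?thesis by (simp only:)
qed

end

section \<open>Derivatives of all orders\<close>

text \<open>\<open>hderiv_on\<close> picks each derivative by choice, and derivatives within
  \<open>X\<close> are unique only where \<open>X\<close> accumulates. A chain of functions, each
  the derivative of the one before, then pins down all orders.\<close>

lemma hderiv_on_eq:
  assumes nontriv: "\<And>x. x \<in> X \<Longrightarrow> at x within X \<noteq> bot"
    and f: "\<And>x. x \<in> X \<Longrightarrow> f x = g 0 x"
    and g: "\<And>k x. x \<in> X \<Longrightarrow> (g k has_real_derivative g (Suc k) x) (at x within X)"
  shows "x \<in> X \<Longrightarrow> hderiv_on X k f x = g k x"
proof (induction k arbitrary: x)
  case (Suc k)
  have d: "(hderiv_on X k f has_real_derivative g (Suc k) x) (at x within X)"
    by (rule has_field_derivative_transform_within[OF g[OF Suc.prems] zero_less_one Suc.prems])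
       (simp add: Suc.IH)
  then have "(hderiv_on X k f has_real_derivative hderiv_on X (Suc k) f x) (at x within X)"
    by (simp add: someI[where P = "\<lambda>D. (hderiv_on X k f has_real_derivative D) (at x within X)"])
  with d show ?case
    unfolding has_field_derivative_iff by (metis tendsto_unique nontriv Suc.prems)
qed (simp add: f)

lemma smooth_at_withinI:
  assumes nontriv: "\<And>x. x \<in> X \<Longrightarrow> at x within X \<noteq> bot"
    and f: "\<And>x. x \<in> X \<Longrightarrow> f x = g 0 x"
    and g: "\<And>k x. x \<in> X \<Longrightarrow> (g k has_real_derivative g (Suc k) x) (at x within X)"
    and "T \<subseteq> X"
  shows "smooth_at_within T X f"
  unfolding smooth_at_within_def
proof (intro allI ballI)
  fix k x assume "x \<in> T"
  then have x: "x \<in> X" using assms by blast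
  have "(hderiv_on X k f has_real_derivative g (Suc k) x) (at x within X)"
    by (rule has_field_derivative_transform_within[OF g[OF x] zero_less_one x])
       (simp add: hderiv_on_eq[OF nontriv f g])
  then show "hderiv_on X k f differentiable (at x within X)"
    using real_differentiable_def by blast
qed

text \<open>Polynomial expressions in the components of a solution of the system below (and its
  parameter \<open>\<epsilon>\<close>, the variable \<open>VE\<close>); \<open>der\<close> is the derivation induced by the system.\<close>

datatype dexp = VS | VC | VD | VE | Num real | Plus dexp dexp | Times dexp dexp

primrec ev :: "dexp \<Rightarrow> real \<Rightarrow> real \<Rightarrow> real \<Rightarrow> real \<Rightarrow> real" where
  "ev VS s c d e = s"
| "ev VC s c d e = c"
| "ev VD s c d e = d"
| "ev VE s c d e = e"
| "ev (Num r) s c d e = r"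
| "ev (Plus p q) s c d e = ev p s c d e + ev q s c d e"
| "ev (Times p q) s c d e = ev p s c d e * ev q s c d e"

primrec der :: "dexp \<Rightarrow> dexp" where
  "der VS = Times VC VD"
| "der VC = Times (Num (-1)) (Times (Times VE VE) (Times VS VD))"
| "der VD = Times VS VC"
| "der VE = Num 0"
| "der (Num r) = Num 0"
| "der (Plus p q) = Plus (der p) (der q)"
| "der (Times p q) = Plus (Times (der p) q) (Times p (der q))"

text \<open>For \<open>u'' = l\<^sup>2 * sin u * cos u\<close> this is satisfied by \<open>f = u / \<epsilon>\<close>, \<open>S = sin u / \<epsilon>\<close>, \<open>C = cos u\<close> and
  \<open>D = u' / (l * \<epsilon>)\<close>. The amplitude \<open>\<epsilon>\<close> is kept as a parameter because the system makes sense at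
  \<open>\<epsilon> = 0\<close>, where it describes the linearized limit.\<close>

definition pendulum ::
  "real \<Rightarrow> real set \<Rightarrow> real \<Rightarrow> (real \<Rightarrow> real) \<Rightarrow> (real \<Rightarrow> real) \<Rightarrow> (real \<Rightarrow> real) \<Rightarrow> (real \<Rightarrow> real) \<Rightarrow> bool" where
  "pendulum l X \<epsilon> f S C D \<longleftrightarrow> (\<forall>x\<in>X.
     (f has_real_derivative l * D x) (at x within X) \<and>
     (S has_real_derivative l * (C x * D x)) (at x within X) \<and>
     (C has_real_derivative l * (- (\<epsilon>\<^sup>2 * (S x * D x)))) (at x within X) \<and>
     (D has_real_derivative l * (S x * C x)) (at x within X))"

lemma pendulum_subset: "pendulum l X \<epsilon> f S C D \<Longrightarrow> Y \<subseteq> X \<Longrightarrow> pendulum l Y \<epsilon> f S C D"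
  unfolding pendulum_def by (meson DERIV_subset subsetD)

lemma pendulum_cong:
  assumes "pendulum l X \<epsilon> f S C D" "\<And>x. x \<in> X \<Longrightarrow> g x = f x"
  shows "pendulum l X \<epsilon> g S C D"
proof -
  have "(g has_real_derivative l * D x) (at x within X)" if x: "x \<in> X" for x
  proof (rule has_field_derivative_transform_within[OF _ zero_less_one x])
    show "(f has_real_derivative l * D x) (at x within X)" using assms(1) x unfolding pendulum_def by blast
  qed (simp add: assms(2))
  with assms(1) show ?thesis unfolding pendulum_def by blast
qed

text \<open>Meant for \<open>b = 1\<close> and \<open>m = - \<beta>\<close>: stretching turns the
  rate 1 / \<beta> into -1, so the systems for different \<beta> differ only in the amplitude
  \<epsilon>.\<close>

lemma pendulum_affine:
  assumes "pendulum l UNIV \<epsilon> f S C D"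
  shows "pendulum (l * m) UNIV \<epsilon> (\<lambda>x. f (b + m * x)) (\<lambda>x. S (b + m * x)) (\<lambda>x. C (b + m * x)) (\<lambda>x. D (b + m * x))"
proof -
  have chain: "((\<lambda>x. h (b + m * x)) has_real_derivative l * m * h' (b + m * x)) (at x)"
    if "\<And>y. (h has_real_derivative l * h' y) (at y)" for h h' x
    by (rule DERIV_cong[OF DERIV_chain2[OF that]]) (auto intro!: derivative_eq_intros)
  have d: "(f has_real_derivative l * D y) (at y)" "(S has_real_derivative l * (C y * D y)) (at y)"
    "(C has_real_derivative l * (- (\<epsilon>\<^sup>2 * (S y * D y)))) (at y)" "(D has_real_derivative l * (S y * C y)) (at y)" for y
    using assms unfolding pendulum_def by auto
  show ?thesis
    unfolding pendulum_def
    using chain[of f D, OF d(1)] chain[of S "\<lambda>y. C y * D y", OF d(2)]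
      chain[of C "\<lambda>y. - (\<epsilon>\<^sup>2 * (S y * D y))", OF d(3)] chain[of D "\<lambda>y. S y * C y", OF d(4)] by blast
qed

lemma ev_deriv:
  assumes "pendulum l X \<epsilon> f S C D" "x \<in> X"
  shows "((\<lambda>x. ev p (S x) (C x) (D x) \<epsilon>) has_real_derivative l * ev (der p) (S x) (C x) (D x) \<epsilon>) (at x within X)"
proof (induction p)
  case (Times p q)
  show ?case
    using DERIV_mult[OF Times.IH] by (simp add: algebra_simps)
next
  case (Plus p q)
  show ?case
    using DERIV_add[OF Plus.IH] by (simp add: algebra_simps)
qed (use assms in \<open>auto simp: pendulum_def power2_eq_square mult_ac\<close>)

text \<open>Order 0 is separate because \<open>f\<close> itself is not a polynomial in the other
  components. From order 1 on, \<open>f' = l * D\<close> starts the iteration at \<open>VD\<close>,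
  and each further derivative contributes one factor \<open>l\<close>.\<close>

definition nderiv ::
  "real \<Rightarrow> real \<Rightarrow> (real \<Rightarrow> real) \<Rightarrow> (real \<Rightarrow> real) \<Rightarrow> (real \<Rightarrow> real) \<Rightarrow> (real \<Rightarrow> real) \<Rightarrow> nat \<Rightarrow> real \<Rightarrow> real" where
  "nderiv l \<epsilon> f S C D k x = (case k of 0 \<Rightarrow> f x | Suc j \<Rightarrow> l ^ k * ev ((der ^^ j) VD) (S x) (C x) (D x) \<epsilon>)"

lemma nderiv_0: "nderiv l \<epsilon> f S C D 0 = f"
  and nderiv_Suc: "nderiv l \<epsilon> f S C D (Suc j) = (\<lambda>x. l ^ Suc j * ev ((der ^^ j) VD) (S x) (C x) (D x) \<epsilon>)"
  unfolding nderiv_def by simp_all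

lemma nderiv_deriv:
  assumes "pendulum l X \<epsilon> f S C D" "x \<in> X"
  shows "(nderiv l \<epsilon> f S C D k has_real_derivative nderiv l \<epsilon> f S C D (Suc k) x) (at x within X)"
proof (cases k)
  case 0
  then show ?thesis using assms unfolding 0 nderiv_0 nderiv_Suc pendulum_def by simp
next
  case (Suc j)
  have "((\<lambda>x. l ^ Suc j * ev ((der ^^ j) VD) (S x) (C x) (D x) \<epsilon>) has_real_derivative
      l ^ Suc j * (l * ev (der ((der ^^ j) VD)) (S x) (C x) (D x) \<epsilon>)) (at x within X)"
    by (rule DERIV_cmult[OF ev_deriv[OF assms]])
  then show ?thesis unfolding Suc nderiv_Suc by (simp add: mult_ac)
qed

lemma pendulum_hderiv_on:
  assumes "\<And>x. x \<in> X \<Longrightarrow> at x within X \<noteq> bot" "pendulum l X \<epsilon> f S C D" "x \<in> X"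
  shows "hderiv_on X k f x = nderiv l \<epsilon> f S C D k x"
  by (rule hderiv_on_eq[where X = X]) (auto simp: nderiv_0 assms intro: nderiv_deriv[OF assms(2)])

lemma pendulum_hderiv_on_cmult:
  assumes "\<And>x. x \<in> X \<Longrightarrow> at x within X \<noteq> bot" "pendulum l X \<epsilon> f S C D" "x \<in> X"
    and "\<And>x. x \<in> X \<Longrightarrow> g x = r * f x"
  shows "hderiv_on X k g x = r * nderiv l \<epsilon> f S C D k x"
  by (rule hderiv_on_eq[where X = X and g = "\<lambda>k x. r * nderiv l \<epsilon> f S C D k x"])
     (auto simp: nderiv_0 assms intro!: DERIV_cmult nderiv_deriv[OF assms(2)])

lemma pendulum_smooth:
  assumes "\<And>x. x \<in> X \<Longrightarrow> at x within X \<noteq> bot" "pendulum l X \<epsilon> f S C D" "T \<subseteq> X"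
  shows "smooth_at_within T X f"
  by (rule smooth_at_withinI[where g = "nderiv l \<epsilon> f S C D"])
     (auto simp: nderiv_0 assms intro: nderiv_deriv[OF assms(2)])

lemma ev_bounded:
  "\<exists>M. \<forall>s c d e. \<bar>s\<bar> \<le> B \<longrightarrow> \<bar>c\<bar> \<le> B \<longrightarrow> \<bar>d\<bar> \<le> B \<longrightarrow> \<bar>e\<bar> \<le> B \<longrightarrow> \<bar>ev p s c d e\<bar> \<le> M"
proof (induction p)
  case (Plus p q)
  obtain M where M: "\<And>s c d e. \<bar>s\<bar> \<le> B \<Longrightarrow> \<bar>c\<bar> \<le> B \<Longrightarrow> \<bar>d\<bar> \<le> B \<Longrightarrow> \<bar>e\<bar> \<le> B \<Longrightarrow> \<bar>ev p s c d e\<bar> \<le> M"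
    using Plus.IH(1) by blast
  obtain N where N: "\<And>s c d e. \<bar>s\<bar> \<le> B \<Longrightarrow> \<bar>c\<bar> \<le> B \<Longrightarrow> \<bar>d\<bar> \<le> B \<Longrightarrow> \<bar>e\<bar> \<le> B \<Longrightarrow> \<bar>ev q s c d e\<bar> \<le> N"
    using Plus.IH(2) by blast
  have "\<bar>ev (Plus p q) s c d e\<bar> \<le> M + N"
    if "\<bar>s\<bar> \<le> B" "\<bar>c\<bar> \<le> B" "\<bar>d\<bar> \<le> B" "\<bar>e\<bar> \<le> B" for s c d e
    using M[OF that] N[OF that] by simp
  then show ?case by blast
next
  case (Times p q)
  obtain M where M: "\<And>s c d e. \<bar>s\<bar> \<le> B \<Longrightarrow> \<bar>c\<bar> \<le> B \<Longrightarrow> \<bar>d\<bar> \<le> B \<Longrightarrow> \<bar>e\<bar> \<le> B \<Longrightarrow> \<bar>ev p s c d e\<bar> \<le> M"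
    using Times.IH(1) by blast
  obtain N where N: "\<And>s c d e. \<bar>s\<bar> \<le> B \<Longrightarrow> \<bar>c\<bar> \<le> B \<Longrightarrow> \<bar>d\<bar> \<le> B \<Longrightarrow> \<bar>e\<bar> \<le> B \<Longrightarrow> \<bar>ev q s c d e\<bar> \<le> N"
    using Times.IH(2) by blast
  have "\<bar>ev (Times p q) s c d e\<bar> \<le> M * N"
    if "\<bar>s\<bar> \<le> B" "\<bar>c\<bar> \<le> B" "\<bar>d\<bar> \<le> B" "\<bar>e\<bar> \<le> B" for s c d e
    unfolding ev.simps abs_mult by (intro mult_mono'[OF M[OF that] N[OF that]] abs_ge_zero)
  then show ?case by blast
qed auto

text \<open>Multiplying uniform limits calls for bounded limit functions, so boundedness is carried
  through the induction together with convergence.\<close>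

lemma ev_uniform_limit:
  fixes S C D :: "'b \<Rightarrow> real \<Rightarrow> real"
  assumes "uniform_limit K S S0 \<F>" "uniform_limit K C C0 \<F>" "uniform_limit K D D0 \<F>" "(E \<longlongrightarrow> E0) \<F>"
    and "bounded (S0 ` K)" "bounded (C0 ` K)" "bounded (D0 ` K)"
  shows "uniform_limit K (\<lambda>b x. ev p (S b x) (C b x) (D b x) (E b)) (\<lambda>x. ev p (S0 x) (C0 x) (D0 x) E0) \<F>
    \<and> bounded ((\<lambda>x. ev p (S0 x) (C0 x) (D0 x) E0) ` K)"
proof (induction p)
  case VE
  have "uniform_limit K (\<lambda>b x. E b) (\<lambda>x. E0) \<F>"
    using assms(4) unfolding uniform_limit_iff tendsto_iff by (auto elim: eventually_mono)
  then show ?case by (auto simp: bounded_iff)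
next
  case (Num r)
  then show ?case by (auto simp: bounded_iff intro!: uniform_limit_const)
next
  case (Plus p q)
  then show ?case
    using bounded_plus_comp[of "\<lambda>x. ev p (S0 x) (C0 x) (D0 x) E0" K "\<lambda>x. ev q (S0 x) (C0 x) (D0 x) E0"]
    by (auto intro!: uniform_limit_add)
next
  case (Times p q)
  then have b: "bounded ((\<lambda>x. ev p (S0 x) (C0 x) (D0 x) E0) ` K)" "bounded ((\<lambda>x. ev q (S0 x) (C0 x) (D0 x) E0) ` K)"
    by auto
  obtain M where M: "\<And>x. x \<in> K \<Longrightarrow> \<bar>ev p (S0 x) (C0 x) (D0 x) E0\<bar> \<le> M"
    using b(1) unfolding bounded_iff by auto
  obtain N where N: "\<And>x. x \<in> K \<Longrightarrow> \<bar>ev q (S0 x) (C0 x) (D0 x) E0\<bar> \<le> N"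
    using b(2) unfolding bounded_iff by auto
  have "\<bar>ev p (S0 x) (C0 x) (D0 x) E0 * ev q (S0 x) (C0 x) (D0 x) E0\<bar> \<le> M * N" if "x \<in> K" for x
    unfolding abs_mult by (intro mult_mono'[OF M[OF that] N[OF that]] abs_ge_zero)
  then have "bounded ((\<lambda>x. ev p (S0 x) (C0 x) (D0 x) E0 * ev q (S0 x) (C0 x) (D0 x) E0) ` K)"
    unfolding bounded_iff by (auto intro!: exI[of _ "M * N"])
  moreover have "uniform_limit K (\<lambda>b x. ev p (S b x) (C b x) (D b x) (E b) * ev q (S b x) (C b x) (D b x) (E b))
      (\<lambda>x. ev p (S0 x) (C0 x) (D0 x) E0 * ev q (S0 x) (C0 x) (D0 x) E0) \<F>"
    using Times b by (intro uniform_lim_mult) blast+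
  ultimately show ?case by simp
qed (use assms in auto)

lemma at_within_Icc_nontrivial:
  fixes x :: real
  assumes "a < b" "x \<in> {a..b}"
  shows "at x within {a..b} \<noteq> bot"
  using assms by (simp add: trivial_limit_within islimpt_Icc)

lemma at_within_atLeast_nontrivial:
  fixes x :: real
  assumes "x \<in> {a..}"
  shows "at x within {a..} \<noteq> bot"
proof -
  have "x islimpt {a..x + 1}" using assms by (simp add: islimpt_Icc)
  then have "x islimpt {a..}" by (rule islimpt_subset) auto
  then show ?thesis by (simp add: trivial_limit_within)
qed

text \<open>Derivatives of every order are fixed polynomials in the components, so uniform
  convergence of the components suffices and no limit is interchanged with differentiation.\<close>

lemma pendulum_uniform_limit:
  assumes K: "compact K" "K \<subseteq> {0..}"
    and traj: "\<forall>\<^sub>F \<beta> in at_right 0. pendulum l {0..1/\<beta>} (E \<beta>) (f \<beta>) (S \<beta>) (C \<beta>) (D \<beta>)"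
    and traj0: "pendulum l {0..} E0 f0 S0 C0 D0"
    and f: "uniform_limit K f f0 (at_right 0)"
    and lims: "uniform_limit K S S0 (at_right 0)" "uniform_limit K C C0 (at_right 0)"
      "uniform_limit K D D0 (at_right 0)" "(E \<longlongrightarrow> E0) (at_right 0)"
  shows "uniform_limit K (\<lambda>\<beta>. hderiv_on {0..1/\<beta>} k (f \<beta>)) (hderiv_on {0..} k f0) (at_right 0)"
proof -
  have "continuous_on {0..} S0" "continuous_on {0..} C0" "continuous_on {0..} D0"
    using traj0 unfolding pendulum_def by (auto intro!: DERIV_continuous_on)
  then have b: "bounded (S0 ` K)" "bounded (C0 ` K)" "bounded (D0 ` K)"
    using K by (meson compact_continuous_image compact_imp_bounded continuous_on_subset)+
  have lim: "uniform_limit K (\<lambda>\<beta>. nderiv l (E \<beta>) (f \<beta>) (S \<beta>) (C \<beta>) (D \<beta>) k) (nderiv l E0 f0 S0 C0 D0 k) (at_right 0)"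
  proof (cases k)
    case 0
    then show ?thesis using f by (simp add: nderiv_0)
  next
    case (Suc j)
    have "uniform_limit K (\<lambda>\<beta> x. ev ((der ^^ j) VD) (S \<beta> x) (C \<beta> x) (D \<beta> x) (E \<beta>))
        (\<lambda>x. ev ((der ^^ j) VD) (S0 x) (C0 x) (D0 x) E0) (at_right 0)"
      using ev_uniform_limit[OF lims b] by blast
    from bounded_linear.uniform_limit[OF bounded_linear_mult_right this, of "l ^ Suc j"]
    show ?thesis unfolding Suc nderiv_Suc by (simp add: comp_def)
  qed
  \<comment> \<open>Once \<open>\<beta> < 1 / (\<bar>R\<bar> + 1)\<close>, the growing interval
    \<open>{0..1/\<beta>}\<close> contains \<open>K\<close>.\<close>
  obtain R where R: "\<And>x. x \<in> K \<Longrightarrow> x \<le> R"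
    using compact_imp_bounded[OF K(1)] unfolding bounded_iff by (metis abs_le_iff real_norm_def)
  have "\<forall>\<^sub>F \<beta> in at_right (0::real). \<beta> < 1 / (\<bar>R\<bar> + 1)"
    by (rule eventually_at_right_real[THEN eventually_mono]) auto
  then have ev: "\<forall>\<^sub>F \<beta> in at_right 0. \<forall>x\<in>K. nderiv l (E \<beta>) (f \<beta>) (S \<beta>) (C \<beta>) (D \<beta>) k x = hderiv_on {0..1/\<beta>} k (f \<beta>) x"
    using traj eventually_at_right_less[of 0]
  proof eventually_elim
    case (elim \<beta>)
    have "\<bar>R\<bar> + 1 < 1 / \<beta>" using elim by (simp add: field_simps)
    then have "x \<in> {0..1/\<beta>}" if "x \<in> K" for x using R[OF that] K(2) that by auto
    then show ?case
      using pendulum_hderiv_on[OF at_within_Icc_nontrivial elim(2)] elim(3) by simp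
  qed
  have eq0: "nderiv l E0 f0 S0 C0 D0 k x = hderiv_on {0..} k f0 x" if "x \<in> K" for x
    using pendulum_hderiv_on[OF at_within_atLeast_nontrivial traj0] K(2) that by auto
  show ?thesis
    using lim by (subst (asm) uniform_limit_cong[OF ev eq0]) auto
qed

section \<open>Rescaled limits\<close>

lemma abs_sin_diff_le: "\<bar>sin x - sin y\<bar> \<le> \<bar>x - y\<bar>" for x y :: real
proof -
  have "\<bar>sin x - sin y\<bar> = 2 * \<bar>sin ((x - y) / 2)\<bar> * \<bar>cos ((x + y) / 2)\<bar>"
    by (simp add: sin_diff_sin abs_mult)
  also have "\<dots> \<le> 2 * \<bar>(x - y) / 2\<bar> * 1"
    by (intro mult_mono abs_sin_x_le_abs_x order_refl) auto
  finally show ?thesis by simp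
qed

lemma abs_cos_diff_le: "\<bar>cos x - cos y\<bar> \<le> \<bar>x - y\<bar>" for x y :: real
  using abs_sin_diff_le[of "pi / 2 - x" "pi / 2 - y"] by (simp add: sin_diff abs_minus_commute)

text \<open>A quadratic bound is enough: for \<open>x\<close> of order \<open>k\<close> it still
  vanishes with \<open>k\<close> after division by \<open>2 * k\<close>.\<close>

lemma diff_sin_le_square:
  fixes x :: real
  assumes "0 \<le> x"
  shows "x - sin x \<le> x\<^sup>2"
proof (cases "x = 0")
  case False
  then obtain z where z: "0 < z" "z < x" "(x - sin x) - (0 - sin 0) = (x - 0) * (1 - cos z)"
    using MVT2[of 0 x "\<lambda>x. x - sin x" "\<lambda>z. 1 - cos z"] assms
    by (force intro!: derivative_eq_intros)
  have "1 - cos z \<le> x" using abs_cos_diff_le[of 0 z] z by simp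
  then have "x * (1 - cos z) \<le> x * x" using assms by (intro mult_left_mono)
  then show ?thesis using z by (simp add: power2_eq_square)
qed simp

text \<open>The quantity \<open>u\<^sup>2 + r\<^sup>2\<close> is differentiated because the absolute
  value is not smooth at zeros of \<open>u\<close>; 2|u|(|u| + r) \<le> 3(u^2 + r^2) explains the
  exponent. Measuring the initial error in multiples of \<open>r\<close> keeps the bound
  proportional to \<open>r\<close>.\<close>

lemma gronwall_square:
  fixes u u' :: "real \<Rightarrow> real"
  assumes "\<And>x. x \<in> {0..X} \<Longrightarrow> (u has_real_derivative u' x) (at x)"
    and "\<And>x. x \<in> {0..X} \<Longrightarrow> \<bar>u' x\<bar> \<le> \<bar>u x\<bar> + r"
    and "0 \<le> r" "\<bar>u 0\<bar> \<le> m * r" "x \<in> {0..X}"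
  shows "\<bar>u x\<bar> \<le> r * sqrt ((m\<^sup>2 + 1) * exp (3 * x))"
proof -
  define g where "g x = ((u x)\<^sup>2 + r\<^sup>2) * exp (- (3 * x))" for x
  have "g x \<le> g 0"
  proof (rule DERIV_nonpos_imp_nonincreasing[where f = g])
    fix y assume "0 \<le> y" "y \<le> x"
    then have y: "y \<in> {0..X}" using assms(5) by auto
    define g' where "g' = (2 * u y * u' y - 3 * ((u y)\<^sup>2 + r\<^sup>2)) * exp (- (3 * y))"
    have "(g has_real_derivative g') (at y)"
      unfolding g_def g'_def by (auto intro!: derivative_eq_intros assms(1)[OF y] simp: algebra_simps)
    moreover have "2 * u y * u' y - 3 * ((u y)\<^sup>2 + r\<^sup>2) \<le> 0"
    proof -
      have "2 * u y * u' y \<le> 2 * (\<bar>u y\<bar> * \<bar>u' y\<bar>)" using abs_ge_self[of "u y * u' y"] by (simp add: abs_mult)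
      also have "\<dots> \<le> 2 * (\<bar>u y\<bar> * (\<bar>u y\<bar> + r))" using assms(2)[OF y] by (intro mult_left_mono) auto
      also have "\<dots> \<le> 3 * ((u y)\<^sup>2 + r\<^sup>2)"
      proof -
        have "2 * (\<bar>u y\<bar> * (\<bar>u y\<bar> + r)) = 2 * (u y)\<^sup>2 + 2 * \<bar>u y\<bar> * r"
          by (simp add: power2_eq_square algebra_simps)
        moreover have "2 * \<bar>u y\<bar> * r \<le> (u y)\<^sup>2 + r\<^sup>2" using sum_squares_bound[of "\<bar>u y\<bar>" r] by simp
        ultimately show ?thesis using zero_le_power2[of r] unfolding distrib_left by linarith
      qed
      finally show ?thesis by simp
    qed
    then have "g' \<le> 0" unfolding g'_def by (intro mult_nonpos_nonneg) auto
    ultimately show "\<exists>d. (g has_real_derivative d) (at y) \<and> d \<le> 0" by blast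
  qed (use assms in auto)
  also have "g 0 \<le> (m\<^sup>2 + 1) * r\<^sup>2"
  proof -
    have "\<bar>u 0\<bar>\<^sup>2 \<le> (m * r)\<^sup>2" using assms(4) by (intro power_mono) auto
    then show ?thesis by (simp add: g_def power_mult_distrib algebra_simps)
  qed
  finally have "((u x)\<^sup>2 + r\<^sup>2) * exp (- (3 * x)) \<le> (m\<^sup>2 + 1) * r\<^sup>2" by (simp add: g_def)
  then have "(u x)\<^sup>2 + r\<^sup>2 \<le> (m\<^sup>2 + 1) * r\<^sup>2 * exp (3 * x)"
    by (simp add: exp_minus divide_inverse[symmetric] pos_divide_le_eq)
  then have "(u x)\<^sup>2 \<le> r\<^sup>2 * ((m\<^sup>2 + 1) * exp (3 * x))"
    using zero_le_power2[of r] by (simp only: mult_ac)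
  then have "sqrt ((u x)\<^sup>2) \<le> sqrt (r\<^sup>2 * ((m\<^sup>2 + 1) * exp (3 * x)))" by (rule real_sqrt_le_mono)
  then show ?thesis using assms(3) by (simp add: real_sqrt_mult)
qed

lemma exp_decay_power_tendsto_0:
  fixes d :: real
  assumes "0 < d"
  shows "((\<lambda>\<beta>. exp (- (d / \<beta>)) * (1 / \<beta>) ^ n) \<longlongrightarrow> 0) (at_right 0)"
proof -
  have "((\<lambda>y. (y / d) ^ n * exp (- y)) \<longlongrightarrow> 0) at_top"
    using tendsto_mult[OF tendsto_const[of "1 / d ^ n"] tendsto_power_div_exp_0[of n]]
    by (simp add: exp_minus power_mult_distrib power_inverse divide_inverse mult_ac)
  moreover have "filterlim (\<lambda>\<beta>. d * inverse \<beta>) at_top (at_right 0)"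
    by (intro filterlim_tendsto_pos_mult_at_top[OF tendsto_const assms] filterlim_inverse_at_top_right)
  ultimately have "((\<lambda>\<beta>. (d * inverse \<beta> / d) ^ n * exp (- (d * inverse \<beta>))) \<longlongrightarrow> 0) (at_right 0)"
    by (rule filterlim_compose)
  then have "((\<lambda>\<beta>. inverse \<beta> ^ n * exp (- (d * inverse \<beta>))) \<longlongrightarrow> 0) (at_right 0)"
    using assms by simp
  then show ?thesis by (simp add: divide_inverse mult.commute)
qed

lemma uniform_limit_by_bound:
  fixes f :: "'b \<Rightarrow> 'c \<Rightarrow> real"
  assumes "\<forall>\<^sub>F b in \<F>. \<forall>x\<in>K. \<bar>f b x - f0 x\<bar> \<le> r b" "(r \<longlongrightarrow> 0) \<F>"
  shows "uniform_limit K f f0 \<F>"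
  unfolding uniform_limit_iff
proof (intro allI impI)
  fix e :: real assume "0 < e"
  then have "\<forall>\<^sub>F b in \<F>. r b < e" using assms(2) by (simp add: order_tendstoD)
  with assms(1) show "\<forall>\<^sub>F b in \<F>. \<forall>x\<in>K. dist (f b x) (f0 x) < e"
    by eventually_elim (auto simp: dist_real_def intro: le_less_trans)
qed

section \<open>The profile in the stretched variable\<close>

context profile
begin

lemma pendulum_\<phi>:
  assumes "\<epsilon> \<noteq> 0"
  shows "pendulum (1 / \<beta>) UNIV \<epsilon> (\<lambda>x. \<phi> x / \<epsilon>) (\<lambda>x. sin (\<phi> x) / \<epsilon>) (\<lambda>x. cos (\<phi> x)) (\<lambda>x. w (\<phi> x) / \<epsilon>)"
proof -
  have 1: "((\<lambda>x. \<phi> x / \<epsilon>) has_real_derivative 1 / \<beta> * (w (\<phi> x) / \<epsilon>)) (at x)" for x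
    by (rule DERIV_cong[OF DERIV_cdivide[OF \<phi>_deriv']]) simp
  have 2: "((\<lambda>x. sin (\<phi> x) / \<epsilon>) has_real_derivative 1 / \<beta> * (cos (\<phi> x) * (w (\<phi> x) / \<epsilon>))) (at x)" for x
    by (rule DERIV_cong[OF DERIV_cdivide[OF DERIV_chain2[OF DERIV_sin \<phi>_deriv']]]) simp
  have 3: "((\<lambda>x. cos (\<phi> x)) has_real_derivative 1 / \<beta> * (- (\<epsilon>\<^sup>2 * (sin (\<phi> x) / \<epsilon> * (w (\<phi> x) / \<epsilon>))))) (at x)" for x
    by (rule DERIV_cong[OF DERIV_chain2[OF DERIV_cos \<phi>_deriv']]) (use assms in \<open>simp add: power2_eq_square\<close>)
  have 4: "((\<lambda>x. w (\<phi> x) / \<epsilon>) has_real_derivative 1 / \<beta> * (sin (\<phi> x) / \<epsilon> * cos (\<phi> x))) (at x)" for x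
    by (rule DERIV_cong[OF DERIV_cdivide[OF w_\<phi>_deriv]]) simp
  show ?thesis unfolding pendulum_def using 1 2 3 4 by blast
qed

lemma pendulum_minimizer:
  assumes "\<epsilon> \<noteq> 0"
  shows "pendulum (1 / \<beta>) {0..1} \<epsilon> (\<lambda>x. minimizer \<beta> (k / \<beta>) x / \<epsilon>)
    (\<lambda>x. sin (\<phi> x) / \<epsilon>) (\<lambda>x. cos (\<phi> x)) (\<lambda>x. w (\<phi> x) / \<epsilon>)"
  by (rule pendulum_cong[OF pendulum_subset[OF pendulum_\<phi>[OF assms]]]) (auto simp: minimizer_eq)

lemma pendulum_rescaled:
  assumes "\<epsilon> \<noteq> 0"
  shows "pendulum (- 1) {0..1/\<beta>} \<epsilon> (\<lambda>x. minimizer \<beta> (k / \<beta>) (1 - \<beta> * x) / \<epsilon>)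
    (\<lambda>x. sin (\<phi> (1 - \<beta> * x)) / \<epsilon>) (\<lambda>x. cos (\<phi> (1 - \<beta> * x))) (\<lambda>x. w (\<phi> (1 - \<beta> * x)) / \<epsilon>)"
proof -
  have "pendulum (- 1) UNIV \<epsilon> (\<lambda>x. \<phi> (1 - \<beta> * x) / \<epsilon>)
    (\<lambda>x. sin (\<phi> (1 - \<beta> * x)) / \<epsilon>) (\<lambda>x. cos (\<phi> (1 - \<beta> * x))) (\<lambda>x. w (\<phi> (1 - \<beta> * x)) / \<epsilon>)"
    using pendulum_affine[OF pendulum_\<phi>[OF assms], of "- \<beta>" 1] \<beta> by simp
  then show ?thesis
  proof (rule pendulum_cong[OF pendulum_subset])
    fix x assume "x \<in> {0..1/\<beta>}"
    then have "1 - \<beta> * x \<in> {0..1}" using \<beta> by (auto simp: field_simps)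
    then show "minimizer \<beta> (k / \<beta>) (1 - \<beta> * x) / \<epsilon> = \<phi> (1 - \<beta> * x) / \<epsilon>" by (simp add: minimizer_eq)
  qed auto
qed

lemma rescaled_in: "x \<in> {0..1/\<beta>} \<Longrightarrow> 1 - \<beta> * x \<in> {0..1}"
  using \<beta> by (auto simp: field_simps)

lemma rescaled_deriv: "((\<lambda>x. \<phi> (1 - \<beta> * x)) has_real_derivative - w (\<phi> (1 - \<beta> * x))) (at x)"
  by (rule DERIV_cong[OF DERIV_chain2[OF \<phi>_deriv']]) (use \<beta> in \<open>auto intro!: derivative_eq_intros\<close>)

lemma w_minus_sin: "x \<in> {0..1} \<Longrightarrow> \<bar>w (\<phi> x) - sin (\<phi> x)\<bar> \<le> c"
  using w_le[of "\<phi> x"] abs_sin_less_w[of "\<phi> x"] sin_\<phi>_bounds[of x] by simp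

text \<open>The stretched profile solves v' = - w(v), its limit v' = - sin v. The right-hand sides
  differ by at most \<open>c\<close> at the profile and the initial values by at most
  \<open>c / decay_rate\<close>, so the whole error is proportional to \<open>c\<close>.\<close>

lemma rescaled_minus_limit:
  assumes \<psi>: "\<And>x. x \<in> {0..X} \<Longrightarrow> (\<psi> has_real_derivative - sin (\<psi> x)) (at x)"
    and "\<psi> 0 = arcsin (2 * k)" and X: "X \<le> 1 / \<beta>" and x: "x \<in> {0..X}"
  shows "\<bar>\<phi> (1 - \<beta> * x) - \<psi> x\<bar> \<le> c * sqrt (((1 / decay_rate)\<^sup>2 + 1) * exp (3 * X))"
proof -
  have "\<bar>\<phi> (1 - \<beta> * x) - \<psi> x\<bar> \<le> c * sqrt (((1 / decay_rate)\<^sup>2 + 1) * exp (3 * x))"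
  proof (rule gronwall_square[where X = X and u = "\<lambda>x. \<phi> (1 - \<beta> * x) - \<psi> x"
        and u' = "\<lambda>x. - w (\<phi> (1 - \<beta> * x)) - (- sin (\<psi> x))"])
    fix y assume y: "y \<in> {0..X}"
    show "((\<lambda>x. \<phi> (1 - \<beta> * x) - \<psi> x) has_real_derivative - w (\<phi> (1 - \<beta> * y)) - (- sin (\<psi> y))) (at y)"
      by (rule DERIV_diff[OF rescaled_deriv \<psi>[OF y]])
    have "1 - \<beta> * y \<in> {0..1}" using y X by (intro rescaled_in) auto
    from w_minus_sin[OF this] abs_sin_diff_le[of "\<phi> (1 - \<beta> * y)" "\<psi> y"]
    show "\<bar>- w (\<phi> (1 - \<beta> * y)) - (- sin (\<psi> y))\<bar> \<le> \<bar>\<phi> (1 - \<beta> * y) - \<psi> y\<bar> + c" by linarith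
  next
    show "\<bar>\<phi> (1 - \<beta> * 0) - \<psi> 0\<bar> \<le> 1 / decay_rate * c"
      using arcsin_minus_a decay_rate_pos assms(2) by (simp add: \<phi>_1 field_simps)
  qed (use c x in auto)
  also have "\<dots> \<le> c * sqrt (((1 / decay_rate)\<^sup>2 + 1) * exp (3 * X))"
    using c x by (intro mult_left_mono real_sqrt_le_mono) auto
  finally show ?thesis .
qed

lemma a_le: "a \<le> 2 * k / decay_rate"
proof -
  obtain z where z: "0 < z" "z < a" "sin a - sin 0 = (a - 0) * cos z"
    using MVT2[of 0 a sin cos] a by (auto intro: DERIV_sin)
  have "sin z \<le> sin a" using z a by (intro sin_monotone_2pi_le) auto
  then have "decay_rate \<le> cos z"
    using z a sin_a_le two_k by (intro decay_rate_le_cos cos_ge_zero sin_ge_zero) auto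
  then have "a * decay_rate \<le> a * cos z" using a by (intro mult_left_mono) auto
  also have "\<dots> \<le> 2 * k" using z sin_a_le by simp
  finally show ?thesis using decay_rate_pos by (simp add: pos_le_divide_eq)
qed

text \<open>Relative error of the linearization: the first summand bounds
  \<open>(y - sin y) / (2 * k)\<close> for y \<le> a \<le> 2k/decay_rate, the second bounds
  \<open>c / (2 * k)\<close>.\<close>

definition err :: real where "err = 2 * k / decay_rate\<^sup>2 + 2 * exp (- decay_rate / \<beta>)"

lemma c_quotient_le: "c / (2 * k) \<le> 2 * exp (- decay_rate / \<beta>)"
  using c_le k by (simp add: field_simps)

lemma err_bounds:
  assumes "0 \<le> y" "y \<le> a"
  shows "(y - sin y + c) / (2 * k) \<le> err"
proof -
  have "y - sin y \<le> y\<^sup>2" using assms by (intro diff_sin_le_square)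
  also have "\<dots> \<le> (2 * k / decay_rate)\<^sup>2" using assms a_le by (intro power_mono) auto
  finally have "(y - sin y) / (2 * k) \<le> (2 * k / decay_rate)\<^sup>2 / (2 * k)" using k by (intro divide_right_mono) auto
  also have "\<dots> = 2 * k / decay_rate\<^sup>2" using k by (simp add: power2_eq_square)
  finally show ?thesis using c_quotient_le unfolding err_def add_divide_distrib by linarith
qed

lemma err_nonneg: "0 \<le> err"
  using k by (auto simp: err_def intro!: add_nonneg_nonneg)

lemma a_quotient: "\<bar>a / (2 * k) - 1\<bar> \<le> err"
proof -
  have "(a - sin a + c) / (2 * k) \<le> err" using a by (intro err_bounds) auto
  moreover have q: "a / (2 * k) - 1 = (a - 2 * k) / (2 * k)" using k by (simp add: diff_divide_distrib)
  moreover have "(a - 2 * k) / (2 * k) \<le> (a - sin a + c) / (2 * k)"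
    using sin_a_le c k by (intro divide_right_mono) auto
  moreover have "sin a \<le> a" using a by (intro sin_x_le_x) auto
  then have "(2 * k - a) / (2 * k) \<le> (a - sin a + c) / (2 * k)"
    using sin_a_ge k a by (intro divide_right_mono) auto
  moreover have "(2 * k - a) / (2 * k) = - ((a - 2 * k) / (2 * k))" by (simp add: minus_divide_left)
  ultimately show ?thesis by linarith
qed

text \<open>Divided by \<open>2 * k\<close>, the profile solves v' = - v up to \<open>err\<close>
  and starts within \<open>err\<close> of 1, so the Gronwall bound applies with
  \<open>m = 1\<close>. The sine and the slope stay within another \<open>err\<close> of the
  profile.\<close>

lemma rescaled_quotient:
  assumes "X \<le> 1 / \<beta>" and x: "x \<in> {0..X}"
  shows "\<bar>\<phi> (1 - \<beta> * x) / (2 * k) - exp (- x)\<bar> \<le> err * sqrt (2 * exp (3 * X))"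
    and "\<bar>sin (\<phi> (1 - \<beta> * x)) / (2 * k) - exp (- x)\<bar> \<le> err * sqrt (2 * exp (3 * X)) + err"
    and "\<bar>w (\<phi> (1 - \<beta> * x)) / (2 * k) - exp (- x)\<bar> \<le> err * sqrt (2 * exp (3 * X)) + err"
    and "\<bar>cos (\<phi> (1 - \<beta> * x)) - 1\<bar> \<le> 2 * k / decay_rate"
proof -
  have near: "\<bar>w (\<phi> (1 - \<beta> * y)) / (2 * k) - \<phi> (1 - \<beta> * y) / (2 * k)\<bar> \<le> err"
    "\<bar>sin (\<phi> (1 - \<beta> * y)) / (2 * k) - \<phi> (1 - \<beta> * y) / (2 * k)\<bar> \<le> err" if "y \<in> {0..X}" for y
  proof -
    have y: "1 - \<beta> * y \<in> {0..1}" using that assms by (intro rescaled_in) auto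
    define p where "p = \<phi> (1 - \<beta> * y)"
    have p: "0 \<le> p" "p \<le> a" "\<bar>w p - sin p\<bar> \<le> c" "sin p \<le> p"
      using \<phi>_bounds[OF y] w_minus_sin[OF y] by (auto simp: p_def intro: sin_x_le_x)
    have "\<bar>w p - p\<bar> / (2 * k) \<le> (p - sin p + c) / (2 * k)"
      using p k c by (intro divide_right_mono) auto
    moreover have "\<bar>sin p - p\<bar> / (2 * k) \<le> (p - sin p + c) / (2 * k)"
      using p k c by (intro divide_right_mono) auto
    ultimately have "\<bar>w p - p\<bar> / (2 * k) \<le> err" "\<bar>sin p - p\<bar> / (2 * k) \<le> err"
      using err_bounds[OF p(1,2)] by linarith+
    then show "\<bar>w (\<phi> (1 - \<beta> * y)) / (2 * k) - \<phi> (1 - \<beta> * y) / (2 * k)\<bar> \<le> err"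
      "\<bar>sin (\<phi> (1 - \<beta> * y)) / (2 * k) - \<phi> (1 - \<beta> * y) / (2 * k)\<bar> \<le> err"
      unfolding p_def[symmetric] diff_divide_distrib[symmetric] abs_divide using k by simp_all
  qed
  have "\<bar>\<phi> (1 - \<beta> * x) / (2 * k) - exp (- x)\<bar> \<le> err * sqrt ((1\<^sup>2 + 1) * exp (3 * x))"
  proof (rule gronwall_square[where X = X and u = "\<lambda>x. \<phi> (1 - \<beta> * x) / (2 * k) - exp (- x)"
        and u' = "\<lambda>x. - w (\<phi> (1 - \<beta> * x)) / (2 * k) - (- exp (- x))"])
    fix y assume y: "y \<in> {0..X}"
    show "((\<lambda>x. \<phi> (1 - \<beta> * x) / (2 * k) - exp (- x)) has_real_derivative
        - w (\<phi> (1 - \<beta> * y)) / (2 * k) - (- exp (- y))) (at y)"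
      by (intro DERIV_diff DERIV_cdivide rescaled_deriv) (auto intro!: derivative_eq_intros)
    show "\<bar>- w (\<phi> (1 - \<beta> * y)) / (2 * k) - (- exp (- y))\<bar> \<le> \<bar>\<phi> (1 - \<beta> * y) / (2 * k) - exp (- y)\<bar> + err"
      using near(1)[OF y] unfolding minus_divide_left[symmetric] by linarith
  qed (use a_quotient err_nonneg x in \<open>auto simp: \<phi>_1\<close>)
  also have "\<dots> \<le> err * sqrt (2 * exp (3 * X))"
    using err_nonneg x by (intro mult_left_mono real_sqrt_le_mono) auto
  finally show main: "\<bar>\<phi> (1 - \<beta> * x) / (2 * k) - exp (- x)\<bar> \<le> err * sqrt (2 * exp (3 * X))" .
  show "\<bar>sin (\<phi> (1 - \<beta> * x)) / (2 * k) - exp (- x)\<bar> \<le> err * sqrt (2 * exp (3 * X)) + err"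
    using main near(2)[OF x] by linarith
  show "\<bar>w (\<phi> (1 - \<beta> * x)) / (2 * k) - exp (- x)\<bar> \<le> err * sqrt (2 * exp (3 * X)) + err"
    using main near(1)[OF x] by linarith
  have "1 - \<beta> * x \<in> {0..1}" using x assms by (intro rescaled_in) auto
  from \<phi>_bounds[OF this] show "\<bar>cos (\<phi> (1 - \<beta> * x)) - 1\<bar> \<le> 2 * k / decay_rate"
    using abs_cos_diff_le[of "\<phi> (1 - \<beta> * x)" 0] a_le by simp
qed

text \<open>The divisor is the expected leading term of the energy. When \<open>k\<close> tends to 0
  together with \<beta>, the three terms on the right tend to 2, 1 and 0.\<close>

lemma V_quotient:
  "V / (- (k\<^sup>2 / (2 * \<beta>))) = 2 * (a / (2 * k)) - 2 * H a / (2 * k)\<^sup>2 + (c / (2 * k))\<^sup>2 / \<beta>"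
  unfolding V_def h_def using \<beta> k by (simp add: field_simps power2_eq_square)

end

text \<open>Dividing by \<open>\<epsilon> = exp (- (decay_rate * \<eta> / \<beta>))\<close> keeps the pendulum variables bounded on \<open>{0..1 - \<eta>}\<close>,
  so that derivatives of every order are \<open>\<epsilon>\<close> times a power of \<open>1 / \<beta>\<close>.\<close>

lemma minimizer_hderiv_bound:
  "\<exists>M m. \<forall>\<beta> k c a \<phi> \<eta>. profile \<beta> k c a \<phi> \<longrightarrow> 0 \<le> \<eta> \<longrightarrow> (\<forall>x\<in>{0..1}. x \<le> 1 - \<eta> \<longrightarrow>
     \<bar>hderiv_on {0..1} n (minimizer \<beta> (k / \<beta>)) x\<bar> \<le> M * (exp (- (decay_rate * \<eta> / \<beta>)) * (1 / \<beta>) ^ m))"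
proof (cases n)
  case 0
  \<comment> \<open>Order 0 lies outside the polynomial formula; its bound comes from
    \<open>\<phi>_le\<close> and costs one power of \<open>1 / \<beta>\<close>.\<close>
  have "\<bar>minimizer \<beta> (k / \<beta>) x\<bar> \<le> 2 * (exp (- (decay_rate * \<eta> / \<beta>)) * (1 / \<beta>) ^ 1)"
    if "profile \<beta> k c a \<phi>" "0 \<le> \<eta>" "x \<in> {0..1}" "x \<le> 1 - \<eta>" for \<beta> k c a \<phi> \<eta> x
  proof -
    interpret profile \<beta> k c a \<phi> by fact
    have "\<bar>minimizer \<beta> (k / \<beta>) x\<bar> \<le> 4 * k * exp (- decay_rate * (1 - x) / \<beta>) / \<beta>"
      using \<phi>_le[OF that(3)] \<phi>_bounds[OF that(3)] minimizer_eq[OF that(3)] by simp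
    also have "\<dots> \<le> 2 * exp (- (decay_rate * \<eta> / \<beta>)) / \<beta>"
    proof (intro divide_right_mono mult_mono)
      have "decay_rate * \<eta> / \<beta> \<le> decay_rate * (1 - x) / \<beta>"
        using that(4) decay_rate_pos \<beta> by (intro divide_right_mono mult_left_mono) auto
      then show "exp (- decay_rate * (1 - x) / \<beta>) \<le> exp (- (decay_rate * \<eta> / \<beta>))" by simp
    qed (use two_k \<beta> in auto)
    finally show ?thesis by simp
  qed
  then show ?thesis unfolding 0 hderiv_on.simps by blast
next
  case (Suc j)
  obtain M where M: "\<And>s c d e. \<bar>s\<bar> \<le> 2 \<Longrightarrow> \<bar>c\<bar> \<le> 2 \<Longrightarrow> \<bar>d\<bar> \<le> 2 \<Longrightarrow> \<bar>e\<bar> \<le> 2 \<Longrightarrow> \<bar>ev ((der ^^ j) VD) s c d e\<bar> \<le> M"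
    using ev_bounded[of 2 "(der ^^ j) VD"] by blast
  have "\<bar>hderiv_on {0..1} n (minimizer \<beta> (k / \<beta>)) x\<bar> \<le> M * (exp (- (decay_rate * \<eta> / \<beta>)) * (1 / \<beta>) ^ n)"
    if "profile \<beta> k c a \<phi>" "0 \<le> \<eta>" "x \<in> {0..1}" "x \<le> 1 - \<eta>" for \<beta> k c a \<phi> \<eta> x
  proof -
    interpret profile \<beta> k c a \<phi> by fact
    define \<epsilon> where "\<epsilon> = exp (- (decay_rate * \<eta> / \<beta>))"
    have \<epsilon>: "0 < \<epsilon>" "\<epsilon> \<le> 1" using decay_rate_pos that \<beta> by (auto simp: \<epsilon>_def)
    have "decay_rate * \<eta> / \<beta> \<le> decay_rate * (1 - x) / \<beta>"
      using that(4) decay_rate_pos \<beta> by (intro divide_right_mono mult_left_mono) auto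
    then have "exp (- decay_rate * (1 - x) / \<beta>) \<le> \<epsilon>" by (simp add: \<epsilon>_def)
    then have "4 * k * exp (- decay_rate * (1 - x) / \<beta>) \<le> 2 * \<epsilon>"
      using two_k k by (intro mult_mono) auto
    \<comment> \<open>This also controls the sine, so both quotients by \<epsilon> lie in the box of
      radius 2 for which \<open>M\<close> was chosen.\<close>
    then have w: "w (\<phi> x) \<le> 2 * \<epsilon>" using decay[OF that(3)] by linarith
    have D: "\<bar>w (\<phi> x) / \<epsilon>\<bar> \<le> 2" using w w_pos[of "\<phi> x"] \<epsilon> by (simp add: pos_divide_le_eq)
    have S: "\<bar>sin (\<phi> x) / \<epsilon>\<bar> \<le> 2"
      using w abs_sin_less_w[of "\<phi> x"] \<epsilon> by (simp add: abs_divide pos_divide_le_eq)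
    have "\<bar>cos (\<phi> x)\<bar> \<le> 2" using abs_cos_le_one[of "\<phi> x"] by linarith
    then have ev: "\<bar>ev ((der ^^ j) VD) (sin (\<phi> x) / \<epsilon>) (cos (\<phi> x)) (w (\<phi> x) / \<epsilon>) \<epsilon>\<bar> \<le> M"
      using \<epsilon> by (intro M S D) auto
    have "hderiv_on {0..1} n (minimizer \<beta> (k / \<beta>)) x
      = \<epsilon> * ((1 / \<beta>) ^ n * ev ((der ^^ j) VD) (sin (\<phi> x) / \<epsilon>) (cos (\<phi> x)) (w (\<phi> x) / \<epsilon>) \<epsilon>)"
      using pendulum_hderiv_on_cmult[OF at_within_Icc_nontrivial[OF zero_less_one] pendulum_minimizer[of \<epsilon>] that(3),
          of "minimizer \<beta> (k / \<beta>)" \<epsilon> n] \<epsilon> unfolding Suc nderiv_Suc by simp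
    then have "\<bar>hderiv_on {0..1} n (minimizer \<beta> (k / \<beta>)) x\<bar>
      = \<epsilon> * (1 / \<beta>) ^ n * \<bar>ev ((der ^^ j) VD) (sin (\<phi> x) / \<epsilon>) (cos (\<phi> x)) (w (\<phi> x) / \<epsilon>) \<epsilon>\<bar>"
      using \<epsilon> \<beta> by (simp add: abs_mult power_abs)
    also have "\<dots> \<le> \<epsilon> * (1 / \<beta>) ^ n * M" using ev \<epsilon> \<beta> by (intro mult_left_mono) auto
    finally show ?thesis by (simp add: \<epsilon>_def mult_ac)
  qed
  then show ?thesis by blast
qed

text \<open>Half-angle substitution: y = \<open>t * exp (- x)\<close> satisfies y' = - y, so 2
  arctan y has derivative -2y/(1 + y^2), which is - sin(2 arctan y).\<close>

lemma minimizer_limit_profile: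
  fixes k :: real
  assumes k: "0 < k" "2 * k < 1"
  defines "\<psi> \<equiv> \<lambda>x. 2 * arctan (tan (arcsin (2 * k) / 2) * exp (- x))"
  shows "(\<psi> has_real_derivative - sin (\<psi> x)) (at x)" and "\<psi> 0 = arcsin (2 * k)"
proof -
  define t where "t = tan (arcsin (2 * k) / 2)"
  have sq: "sqrt (1 + y\<^sup>2) * sqrt (1 + y\<^sup>2) = 1 + y\<^sup>2" for y :: real by simp
  have s: "sin (2 * arctan y) = 2 * y / (1 + y\<^sup>2)" for y :: real
    unfolding sin_double sin_arctan cos_arctan by (simp add: sq)
  have nz: "1 + (t * exp (- x))\<^sup>2 \<noteq> 0" by (metis add_pos_nonneg less_irrefl zero_le_power2 zero_less_one)
  have "((\<lambda>x. 2 * arctan (t * exp (- x))) has_real_derivative 2 * (inverse (1 + (t * exp (- x))\<^sup>2) * (- (t * exp (- x))))) (at x)"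
    by (auto intro!: derivative_eq_intros)
  then show "(\<psi> has_real_derivative - sin (\<psi> x)) (at x)"
    unfolding \<psi>_def t_def[symmetric] s by (simp add: divide_inverse mult_ac)
  have "\<bar>arcsin (2 * k)\<bar> < pi / 2" using arcsin_lt_bounded[of "2 * k"] k unfolding abs_less_iff by auto
  then show "\<psi> 0 = arcsin (2 * k)" unfolding \<psi>_def by (simp add: arctan_tan abs_less_iff field_simps)
qed

lemma pendulum_reversed_sin:
  assumes "\<And>x. (\<psi> has_real_derivative - sin (\<psi> x)) (at x)"
  shows "pendulum (- 1) X 1 \<psi> (\<lambda>x. sin (\<psi> x)) (\<lambda>x. cos (\<psi> x)) (\<lambda>x. sin (\<psi> x))"
  unfolding pendulum_def
  by (auto intro!: derivative_eq_intros has_field_derivative_at_within[OF assms] simp: power2_eq_square)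

text \<open>At amplitude 0 the cosine component is frozen at 1 and the system is linear.\<close>

lemma pendulum_exp: "pendulum (- 1) X 0 (\<lambda>x. exp (- x)) (\<lambda>x. exp (- x)) (\<lambda>x. 1) (\<lambda>x. exp (- x))"
  unfolding pendulum_def by (auto intro!: derivative_eq_intros)

lemma compact_bounded_above:
  fixes K :: "real set"
  assumes "compact K"
  obtains R where "0 \<le> R" "\<And>x. x \<in> K \<Longrightarrow> x \<le> R"
proof -
  obtain R where R: "\<forall>x\<in>K. \<bar>x\<bar> \<le> R"
    using compact_imp_bounded[OF assms] unfolding bounded_iff by auto
  show ?thesis by (rule that[of "\<bar>R\<bar>"]) (use R in force)+
qed

lemma compact_below_1:
  fixes K :: "real set"
  assumes "compact K" "K \<subseteq> {0..<1}"
  obtains \<eta> where "0 < \<eta>" "\<And>x. x \<in> K \<Longrightarrow> x \<le> 1 - \<eta>"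
proof (cases "K = {}")
  case True
  then show ?thesis by (intro that[of 1]) auto
next
  case False
  then obtain s where s: "s \<in> K" "\<And>t. t \<in> K \<Longrightarrow> t \<le> s"
    using compact_attains_sup[OF assms(1)] by blast
  then show ?thesis using assms(2) by (intro that[of "1 - s"]) auto
qed

section \<open>Passage to the limit in both regimes of \<open>\<kappa>\<close>\<close>

theorem theorem1:
  fixes \<kappa> :: "real \<Rightarrow> real"
  assumes kpos: "\<forall>\<beta>>0. 0 < \<kappa> \<beta>"
      and kbound: "\<forall>\<beta>>0. \<kappa> \<beta> < 1 / (pi * \<beta>)"
  defines "\<phi> \<equiv> (\<lambda>\<beta>. minimizer \<beta> (\<kappa> \<beta>))"
  shows
    "(\<forall>\<^sub>F \<beta> in at_right 0.
        (\<exists>\<phi>0. is_minimizer \<beta> (\<kappa> \<beta>) \<phi>0 \<and>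
              (\<forall>\<psi>. is_minimizer \<beta> (\<kappa> \<beta>) \<psi> \<longrightarrow> (\<forall>x\<in>{0..1}. \<psi> x = \<phi>0 x))) \<and>
        (\<forall>x\<in>{0<..<1}. 0 < \<phi> \<beta> x \<and> \<phi> \<beta> x < pi/2) \<and>
        (\<forall>x\<in>{0..<1}. \<phi> \<beta> x < 2 * arctan (tan (\<phi> \<beta> 1 / 2) * exp ((x - 1) / \<beta>))) \<and>
        smooth_at_within {0..<1} {0..1} (\<phi> \<beta>))
     \<and> (\<forall>K. compact K \<and> K \<subseteq> {0..<1} \<longrightarrow>
          (\<forall>k. uniform_limit K (\<lambda>\<beta>. hderiv_on {0..1} k (\<phi> \<beta>)) (\<lambda>x. 0) (at_right 0)))
     \<and> ((\<forall>\<kappa>t. (\<forall>\<beta>>0. \<kappa> \<beta> * \<beta> = \<kappa>t) \<longrightarrow>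
            ((\<lambda>\<beta>. \<phi> \<beta> 1) \<longlongrightarrow> arcsin (2 * \<kappa>t)) (at_right 0) \<and>
            (\<forall>n::nat. n \<ge> 1 \<longrightarrow>
               (\<lambda>\<beta>. F \<beta> (\<kappa> \<beta>) (\<phi> \<beta>)
                  - ((1 - sqrt (1 - 4 * \<kappa>t\<^sup>2)) / (4 * \<beta>) - \<kappa>t / (2 * \<beta>) * arcsin (2 * \<kappa>t)))
               \<in> o[at_right 0](\<lambda>\<beta>. \<beta> ^ n)) \<and>
            (\<forall>\<^sub>F \<beta> in at_right 0.
               smooth_at_within {0..1/\<beta>} {0..1/\<beta>} (\<lambda>x. \<phi> \<beta> (1 - \<beta> * x))) \<and>
            (\<forall>K. compact K \<and> K \<subseteq> {0..} \<longrightarrow>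
               (\<forall>k. uniform_limit K
                      (\<lambda>\<beta>. hderiv_on {0..1/\<beta>} k (\<lambda>x. \<phi> \<beta> (1 - \<beta> * x)))
                      (hderiv_on {0..} k
                         (\<lambda>x. 2 * arctan (tan (arcsin (2 * \<kappa>t) / 2) * exp (- x))))
                      (at_right 0)))))
     \<and> (((\<lambda>\<beta>. \<kappa> \<beta> * \<beta>) \<longlongrightarrow> 0) (at_right 0) \<longrightarrow>
          (\<lambda>\<beta>. \<phi> \<beta> 1) \<sim>[at_right 0] (\<lambda>\<beta>. 2 * \<kappa> \<beta> * \<beta>) \<and>
          (\<lambda>\<beta>. F \<beta> (\<kappa> \<beta>) (\<phi> \<beta>)) \<sim>[at_right 0] (\<lambda>\<beta>. - ((\<kappa> \<beta>)\<^sup>2 * \<beta> / 2)) \<and>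
          (\<forall>\<^sub>F \<beta> in at_right 0.
             smooth_at_within {0..1/\<beta>} {0..1/\<beta>} (\<lambda>x. \<phi> \<beta> (1 - \<beta> * x) / (2 * \<kappa> \<beta> * \<beta>))) \<and>
          (\<forall>K. compact K \<and> K \<subseteq> {0..} \<longrightarrow>
             (\<forall>k. uniform_limit K
                    (\<lambda>\<beta>. hderiv_on {0..1/\<beta>} k (\<lambda>x. \<phi> \<beta> (1 - \<beta> * x) / (2 * \<kappa> \<beta> * \<beta>)))
                    (hderiv_on {0..} k (\<lambda>x. exp (- x)))
                    (at_right 0))))"
proof -
  have pos: "\<forall>\<^sub>F \<beta> in at_right 0. (0::real) < \<beta>" by (rule eventually_at_right_less)
  have "\<exists>c a \<Phi>. profile \<beta> (\<kappa> \<beta> * \<beta>) c a \<Phi>" if "0 < \<beta>" for \<beta>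
  proof -
    have "\<kappa> \<beta> * \<beta> < 1 / (pi * \<beta>) * \<beta>" using kbound that by (intro mult_strict_right_mono) auto
    then have "\<kappa> \<beta> * \<beta> < 1 / pi" using that by simp
    moreover have "0 < \<kappa> \<beta> * \<beta>" using kpos that by simp
    ultimately show ?thesis using ex_profile[OF that] by metis
  qed
  \<comment> \<open>Choice turns the profile data into functions of \<beta> whose limits can be
    studied. They are meaningful for positive \<beta> only, hence the constant recourse to
    \<open>pos\<close>.\<close>
  then obtain c a \<Phi> where P: "\<And>\<beta>. 0 < \<beta> \<Longrightarrow> profile \<beta> (\<kappa> \<beta> * \<beta>) (c \<beta>) (a \<beta>) (\<Phi> \<beta>)"
    by metis
  define k where "k \<beta> = \<kappa> \<beta> * \<beta>" for \<beta>
  have P: "profile \<beta> (k \<beta>) (c \<beta>) (a \<beta>) (\<Phi> \<beta>)" if "0 < \<beta>" for \<beta>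
    using P[OF that] by (simp add: k_def)
  have \<phi>_eq: "\<phi> \<beta> = minimizer \<beta> (k \<beta> / \<beta>)" if "0 < \<beta>" for \<beta>
    using that by (simp add: \<phi>_def k_def)
  have \<kappa>_eq: "\<kappa> \<beta> = k \<beta> / \<beta>" if "0 < \<beta>" for \<beta> using that by (simp add: k_def)
  have \<phi>_\<Phi>: "\<phi> \<beta> x = \<Phi> \<beta> x" if "0 < \<beta>" "x \<in> {0..1}" for \<beta> x
    using profile.minimizer_eq[OF P[OF that(1)] that(2)] \<phi>_eq[OF that(1)] by simp
  have \<phi>_at_1: "\<phi> \<beta> 1 = a \<beta>" if "0 < \<beta>" for \<beta>
    using \<phi>_\<Phi>[OF that, of 1] profile.\<phi>_1[OF P[OF that]] by simp
  have F_V: "F \<beta> (\<kappa> \<beta>) (\<phi> \<beta>) = profile.V \<beta> (k \<beta>) (c \<beta>) (a \<beta>)" if "0 < \<beta>" for \<beta>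
    using profile.F_minimizer[OF P[OF that]] \<phi>_eq[OF that] \<kappa>_eq[OF that] by simp
  have e0: "((\<lambda>\<beta>. exp (- decay_rate / \<beta>)) \<longlongrightarrow> 0) (at_right 0)"
    using exp_decay_power_tendsto_0[OF decay_rate_pos, of 0] by simp
  have c_le: "c \<beta> \<le> 2 * exp (- decay_rate / \<beta>)" if "0 < \<beta>" for \<beta>
  proof -
    interpret profile \<beta> "k \<beta>" "c \<beta>" "a \<beta>" "\<Phi> \<beta>" by (rule P[OF that])
    have "4 * k \<beta> * exp (- decay_rate / \<beta>) \<le> 2 * exp (- decay_rate / \<beta>)"
      using two_k by (intro mult_right_mono) auto
    with c_le show ?thesis by linarith
  qed
  have c0: "(c \<longlongrightarrow> 0) (at_right 0)"
  proof (rule tendsto_sandwich[where f = "\<lambda>_. 0"])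
    show "((\<lambda>\<beta>. 2 * exp (- decay_rate / \<beta>)) \<longlongrightarrow> 0) (at_right 0)"
      using tendsto_mult[OF tendsto_const[of 2] e0] by simp
    show "\<forall>\<^sub>F \<beta> in at_right 0. c \<beta> \<le> 2 * exp (- decay_rate / \<beta>)"
      using pos by eventually_elim (rule c_le)
    show "\<forall>\<^sub>F \<beta> in at_right 0. 0 \<le> c \<beta>"
      using pos by eventually_elim (use P profile.c in \<open>force intro: less_imp_le\<close>)
  qed simp
  have large: "\<forall>\<^sub>F \<beta> in at_right 0. R \<le> 1 / \<beta>" for R :: real
    using filterlim_inverse_at_top_right unfolding filterlim_at_top by (simp add: divide_inverse)

  have A: "\<forall>\<^sub>F \<beta> in at_right 0.
        (\<exists>\<phi>0. is_minimizer \<beta> (\<kappa> \<beta>) \<phi>0 \<and>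
              (\<forall>\<psi>. is_minimizer \<beta> (\<kappa> \<beta>) \<psi> \<longrightarrow> (\<forall>x\<in>{0..1}. \<psi> x = \<phi>0 x))) \<and>
        (\<forall>x\<in>{0<..<1}. 0 < \<phi> \<beta> x \<and> \<phi> \<beta> x < pi/2) \<and>
        (\<forall>x\<in>{0..<1}. \<phi> \<beta> x < 2 * arctan (tan (\<phi> \<beta> 1 / 2) * exp ((x - 1) / \<beta>))) \<and>
        smooth_at_within {0..<1} {0..1} (\<phi> \<beta>)"
    using pos
  proof eventually_elim
    case (elim \<beta>)
    interpret profile \<beta> "k \<beta>" "c \<beta>" "a \<beta>" "\<Phi> \<beta>" by (rule P[OF elim])
    have "smooth_at_within {0..<1} {0..1} (\<phi> \<beta>)"
    proof -
      have "{0..<1} \<subseteq> {0..1::real}" by auto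
      from pendulum_smooth[OF at_within_Icc_nontrivial[OF zero_less_one] pendulum_minimizer[OF one_neq_zero] this]
      show ?thesis by (simp add: \<phi>_eq[OF elim])
    qed
    moreover have "is_minimizer \<beta> (\<kappa> \<beta>) (\<Phi> \<beta>)" "\<And>\<psi> x. is_minimizer \<beta> (\<kappa> \<beta>) \<psi> \<Longrightarrow> x \<in> {0..1} \<Longrightarrow> \<psi> x = \<Phi> \<beta> x"
      using is_minimizer_\<phi> is_minimizer_unique unfolding \<kappa>_eq[OF elim] by blast+
    moreover have "0 < \<phi> \<beta> x \<and> \<phi> \<beta> x < pi/2" if "x \<in> {0<..<1}" for x
      using \<phi>_strict_bounds[OF that] \<phi>_\<Phi>[OF elim, of x] that by simp
    moreover have "\<phi> \<beta> x < 2 * arctan (tan (\<phi> \<beta> 1 / 2) * exp ((x - 1) / \<beta>))" if "x \<in> {0..<1}" for x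
      using \<phi>_less_arctan[OF that] \<phi>_\<Phi>[OF elim, of x] that unfolding \<phi>_at_1[OF elim] by simp
    ultimately show ?case by blast
  qed

  have B: "uniform_limit K (\<lambda>\<beta>. hderiv_on {0..1} n (\<phi> \<beta>)) (\<lambda>x. 0) (at_right 0)"
    if K: "compact K" "K \<subseteq> {0..<1}" for K n
  proof -
    obtain \<eta> where \<eta>: "0 < \<eta>" "\<And>x. x \<in> K \<Longrightarrow> x \<le> 1 - \<eta>"
      using compact_below_1[OF K] by blast
    obtain M m where Mm: "\<And>\<beta> k c a \<phi> \<eta> x. profile \<beta> k c a \<phi> \<Longrightarrow> 0 \<le> \<eta> \<Longrightarrow> x \<in> {0..1} \<Longrightarrow> x \<le> 1 - \<eta> \<Longrightarrow>
       \<bar>hderiv_on {0..1} n (minimizer \<beta> (k / \<beta>)) x\<bar> \<le> M * (exp (- (decay_rate * \<eta> / \<beta>)) * (1 / \<beta>) ^ m)"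
      using minimizer_hderiv_bound[of n] by blast
    show ?thesis
    proof (rule uniform_limit_by_bound)
      show "\<forall>\<^sub>F \<beta> in at_right 0. \<forall>x\<in>K. \<bar>hderiv_on {0..1} n (\<phi> \<beta>) x - 0\<bar> \<le> M * (exp (- (decay_rate * \<eta> / \<beta>)) * (1 / \<beta>) ^ m)"
        using pos
      proof eventually_elim
        case (elim \<beta>)
        show ?case
        proof
          fix x assume x: "x \<in> K"
          then have "x \<in> {0..1}" using K(2) by auto
          from Mm[OF P[OF elim] less_imp_le[OF \<eta>(1)] this \<eta>(2)[OF x]]
          show "\<bar>hderiv_on {0..1} n (\<phi> \<beta>) x - 0\<bar> \<le> M * (exp (- (decay_rate * \<eta> / \<beta>)) * (1 / \<beta>) ^ m)"
            by (simp add: \<phi>_eq[OF elim])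
        qed
      qed
      \<comment> \<open>The distance \<open>\<eta>\<close> from 1 yields exponential smallness,
        which beats the powers of \<open>1 / \<beta>\<close> produced by differentiation.\<close>
      show "((\<lambda>\<beta>. M * (exp (- (decay_rate * \<eta> / \<beta>)) * (1 / \<beta>) ^ m)) \<longlongrightarrow> 0) (at_right 0)"
        using tendsto_mult[OF tendsto_const exp_decay_power_tendsto_0[of "decay_rate * \<eta>" m], of M] decay_rate_pos \<eta>(1)
        by simp
    qed
  qed

  have C: "((\<lambda>\<beta>. \<phi> \<beta> 1) \<longlongrightarrow> arcsin (2 * \<kappa>t)) (at_right 0) \<and>
        (\<forall>n::nat. n \<ge> 1 \<longrightarrow>
           (\<lambda>\<beta>. F \<beta> (\<kappa> \<beta>) (\<phi> \<beta>)
              - ((1 - sqrt (1 - 4 * \<kappa>t\<^sup>2)) / (4 * \<beta>) - \<kappa>t / (2 * \<beta>) * arcsin (2 * \<kappa>t)))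
           \<in> o[at_right 0](\<lambda>\<beta>. \<beta> ^ n)) \<and>
        (\<forall>\<^sub>F \<beta> in at_right 0.
           smooth_at_within {0..1/\<beta>} {0..1/\<beta>} (\<lambda>x. \<phi> \<beta> (1 - \<beta> * x))) \<and>
        (\<forall>K. compact K \<and> K \<subseteq> {0..} \<longrightarrow>
           (\<forall>k. uniform_limit K
                  (\<lambda>\<beta>. hderiv_on {0..1/\<beta>} k (\<lambda>x. \<phi> \<beta> (1 - \<beta> * x)))
                  (hderiv_on {0..} k
                     (\<lambda>x. 2 * arctan (tan (arcsin (2 * \<kappa>t) / 2) * exp (- x))))
                  (at_right 0)))"
    if \<kappa>t: "\<forall>\<beta>>0. \<kappa> \<beta> * \<beta> = \<kappa>t" for \<kappa>t
  proof (intro conjI allI impI)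
    have k_eq: "k \<beta> = \<kappa>t" if "0 < \<beta>" for \<beta> using \<kappa>t that by (simp add: k_def)
    have Pt: "profile \<beta> \<kappa>t (c \<beta>) (a \<beta>) (\<Phi> \<beta>)" if "0 < \<beta>" for \<beta> using P[OF that] k_eq[OF that] by simp
    \<comment> \<open>These bounds do not involve \<beta>, so they are read off from the profile at
      \<beta> = 1.\<close>
    have \<kappa>t_bounds: "0 < \<kappa>t" "2 * \<kappa>t < 1" using profile.k[OF Pt[OF zero_less_one]] profile.two_k[OF Pt[OF zero_less_one]] by auto
    define \<psi> where "\<psi> = (\<lambda>x. 2 * arctan (tan (arcsin (2 * \<kappa>t) / 2) * exp (- x)))"
    have \<psi>: "(\<psi> has_real_derivative - sin (\<psi> x)) (at x)" "\<psi> 0 = arcsin (2 * \<kappa>t)" for x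
      unfolding \<psi>_def using minimizer_limit_profile[OF \<kappa>t_bounds] by blast+
    show "((\<lambda>\<beta>. \<phi> \<beta> 1) \<longlongrightarrow> arcsin (2 * \<kappa>t)) (at_right 0)"
    proof (rule tendsto_sandwich)
      show "\<forall>\<^sub>F \<beta> in at_right 0. arcsin (2 * \<kappa>t) - c \<beta> / decay_rate \<le> \<phi> \<beta> 1"
        using pos
      proof eventually_elim
        case (elim \<beta>)
        have "arcsin (2 * \<kappa>t) - a \<beta> \<le> c \<beta> / decay_rate"
          using profile.arcsin_minus_a(2)[OF Pt[OF elim]] decay_rate_pos by (simp add: pos_le_divide_eq mult.commute)
        then show ?case by (simp add: \<phi>_at_1[OF elim])
      qed
      show "\<forall>\<^sub>F \<beta> in at_right 0. \<phi> \<beta> 1 \<le> arcsin (2 * \<kappa>t)"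
        using pos
      proof eventually_elim
        case (elim \<beta>)
        then show ?case using profile.arcsin_minus_a(1)[OF Pt[OF elim]] by (simp add: \<phi>_at_1)
      qed
      show "((\<lambda>\<beta>. arcsin (2 * \<kappa>t) - c \<beta> / decay_rate) \<longlongrightarrow> arcsin (2 * \<kappa>t)) (at_right 0)"
        using tendsto_diff[OF tendsto_const tendsto_divide[OF c0 tendsto_const], of decay_rate "arcsin (2 * \<kappa>t)"] decay_rate_pos
        by simp
    qed simp
    show "(\<lambda>\<beta>. F \<beta> (\<kappa> \<beta>) (\<phi> \<beta>)
              - ((1 - sqrt (1 - 4 * \<kappa>t\<^sup>2)) / (4 * \<beta>) - \<kappa>t / (2 * \<beta>) * arcsin (2 * \<kappa>t)))
           \<in> o[at_right 0](\<lambda>\<beta>. \<beta> ^ n)" for n :: nat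
    proof (rule smalloI_tendsto)
      \<comment> \<open>Division by \<open>\<beta> ^ n\<close> merely raises the powers of
        \<open>1 / \<beta>\<close> in the estimate of \<open>V\<close>.\<close>
      define r where "r \<beta> = (1 + 1 / decay_rate) * (exp (- (decay_rate / \<beta>)) * (1 / \<beta>) ^ (n + 1))
        + exp (- (decay_rate / \<beta>)) * (1 / \<beta>) ^ (n + 2)" for \<beta>
      show "((\<lambda>\<beta>. (F \<beta> (\<kappa> \<beta>) (\<phi> \<beta>)
              - ((1 - sqrt (1 - 4 * \<kappa>t\<^sup>2)) / (4 * \<beta>) - \<kappa>t / (2 * \<beta>) * arcsin (2 * \<kappa>t))) / \<beta> ^ n) \<longlongrightarrow> 0) (at_right 0)"
      proof (rule Lim_null_comparison)
        show "(r \<longlongrightarrow> 0) (at_right 0)"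
          unfolding r_def
          using tendsto_add[OF tendsto_mult[OF tendsto_const[of "1 + 1 / decay_rate"]
              exp_decay_power_tendsto_0[OF decay_rate_pos, of "n + 1"]] exp_decay_power_tendsto_0[OF decay_rate_pos, of "n + 2"]]
          by simp
        show "\<forall>\<^sub>F \<beta> in at_right 0. norm ((F \<beta> (\<kappa> \<beta>) (\<phi> \<beta>)
              - ((1 - sqrt (1 - 4 * \<kappa>t\<^sup>2)) / (4 * \<beta>) - \<kappa>t / (2 * \<beta>) * arcsin (2 * \<kappa>t))) / \<beta> ^ n) \<le> r \<beta>"
          using pos
        proof eventually_elim
          case (elim \<beta>)
          define e where "e = exp (- (decay_rate / \<beta>))"
          have "\<bar>F \<beta> (\<kappa> \<beta>) (\<phi> \<beta>) - ((1 - sqrt (1 - 4 * \<kappa>t\<^sup>2)) / (4 * \<beta>) - \<kappa>t / (2 * \<beta>) * arcsin (2 * \<kappa>t))\<bar> / \<beta> ^ n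
            \<le> ((1 + 1 / decay_rate) * (e / \<beta>) + e / \<beta>\<^sup>2) / \<beta> ^ n"
            using profile.V_estimate[OF Pt[OF elim]] elim
            unfolding F_V[OF elim] k_eq[OF elim] e_def by (intro divide_right_mono) auto
          also have "\<dots> = (1 + 1 / decay_rate) * (e * (1 / \<beta>) ^ (n + 1)) + e * (1 / \<beta>) ^ (n + 2)"
          proof -
            have "x / \<beta> / \<beta> ^ n = x * (1 / \<beta>) ^ (n + 1)" "x / \<beta>\<^sup>2 / \<beta> ^ n = x * (1 / \<beta>) ^ (n + 2)" for x
              by (simp_all add: power_inverse power2_eq_square divide_inverse mult_ac)
            from this[of e] show ?thesis by (simp only: add_divide_distrib times_divide_eq_right[symmetric])
          qed
          finally show ?case using elim by (simp add: r_def e_def abs_divide)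
        qed
      qed
      show "\<forall>\<^sub>F \<beta> in at_right 0. \<beta> ^ n \<noteq> (0::real)" using pos by eventually_elim simp
    qed
    show "\<forall>\<^sub>F \<beta> in at_right 0. smooth_at_within {0..1/\<beta>} {0..1/\<beta>} (\<lambda>x. \<phi> \<beta> (1 - \<beta> * x))"
      using pos
    proof eventually_elim
      case (elim \<beta>)
      have "0 < 1 / \<beta>" using elim by simp
      from pendulum_smooth[OF at_within_Icc_nontrivial[OF this] profile.pendulum_rescaled[OF P[OF elim], of 1] order_refl]
      show ?case by (simp add: \<phi>_eq[OF elim])
    qed
    fix K :: "real set" and n :: nat assume "compact K \<and> K \<subseteq> {0..}"
    then have K: "compact K" "K \<subseteq> {0..}" by auto
    obtain R where R: "0 \<le> R" "\<And>x. x \<in> K \<Longrightarrow> x \<le> R" using compact_bounded_above[OF K(1)] by blast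
    define m where "m = sqrt (((1 / decay_rate)\<^sup>2 + 1) * exp (3 * R))"
    \<comment> \<open>As soon as \<open>R \<le> 1 / \<beta>\<close>, the points
      \<open>1 - \<beta> * x\<close> with \<open>x\<close> in \<open>K\<close> stay in [0,1], where
      the profile estimates hold.\<close>
    have est: "\<forall>\<^sub>F \<beta> in at_right 0. \<forall>x\<in>K. \<bar>\<Phi> \<beta> (1 - \<beta> * x) - \<psi> x\<bar> \<le> c \<beta> * m
        \<and> \<bar>profile.w (c \<beta>) (\<Phi> \<beta> (1 - \<beta> * x)) - sin (\<Phi> \<beta> (1 - \<beta> * x))\<bar> \<le> c \<beta> \<and> 1 - \<beta> * x \<in> {0..1}"
      using pos large[of R]
    proof eventually_elim
      case (elim \<beta>)
      show ?case
      proof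
        fix x assume "x \<in> K"
        then have x: "x \<in> {0..R}" using R K by auto
        then have "1 - \<beta> * x \<in> {0..1}" using elim by (intro profile.rescaled_in[OF Pt[OF elim(1)]]) auto
        with profile.rescaled_minus_limit[OF Pt[OF elim(1)] \<psi>(1) \<psi>(2) elim(2) x] profile.w_minus_sin[OF Pt[OF elim(1)] this]
        show "\<bar>\<Phi> \<beta> (1 - \<beta> * x) - \<psi> x\<bar> \<le> c \<beta> * m
            \<and> \<bar>profile.w (c \<beta>) (\<Phi> \<beta> (1 - \<beta> * x)) - sin (\<Phi> \<beta> (1 - \<beta> * x))\<bar> \<le> c \<beta> \<and> 1 - \<beta> * x \<in> {0..1}"
          unfolding m_def by blast
      qed
    qed
    have r: "((\<lambda>\<beta>. c \<beta> * m + c \<beta>) \<longlongrightarrow> 0) (at_right 0)" "((\<lambda>\<beta>. c \<beta> * m) \<longlongrightarrow> 0) (at_right 0)"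
      using tendsto_mult[OF c0 tendsto_const[of m]] tendsto_add[OF tendsto_mult[OF c0 tendsto_const[of m]] c0] by auto
    show "uniform_limit K (\<lambda>\<beta>. hderiv_on {0..1/\<beta>} n (\<lambda>x. \<phi> \<beta> (1 - \<beta> * x)))
        (hderiv_on {0..} n (\<lambda>x. 2 * arctan (tan (arcsin (2 * \<kappa>t) / 2) * exp (- x)))) (at_right 0)"
      unfolding \<psi>_def[symmetric]
    \<comment> \<open>The angle stays of order 1 in this regime, so the amplitude is fixed at 1. The
      slope component tends to \<open>sin (\<psi> x)\<close> because \<open>w\<close> and the sine
      differ by at most \<open>c\<close> along the profile.\<close>
    proof (rule pendulum_uniform_limit[OF K, where E = "\<lambda>_. 1"])
      show "\<forall>\<^sub>F \<beta> in at_right 0. pendulum (- 1) {0..1/\<beta>} 1 (\<lambda>x. \<phi> \<beta> (1 - \<beta> * x))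
        (\<lambda>x. sin (\<Phi> \<beta> (1 - \<beta> * x))) (\<lambda>x. cos (\<Phi> \<beta> (1 - \<beta> * x))) (\<lambda>x. profile.w (c \<beta>) (\<Phi> \<beta> (1 - \<beta> * x)))"
        using pos
      proof eventually_elim
        case (elim \<beta>)
        show ?case using profile.pendulum_rescaled[OF P[OF elim], of 1] by (simp add: \<phi>_eq[OF elim])
      qed
      show "pendulum (- 1) {0..} 1 \<psi> (\<lambda>x. sin (\<psi> x)) (\<lambda>x. cos (\<psi> x)) (\<lambda>x. sin (\<psi> x))"
        by (rule pendulum_reversed_sin[OF \<psi>(1)])
      show "uniform_limit K (\<lambda>\<beta> x. \<phi> \<beta> (1 - \<beta> * x)) \<psi> (at_right 0)"
        by (rule uniform_limit_by_bound[OF _ r(2)]) (use est pos in \<open>eventually_elim, simp add: \<phi>_\<Phi>\<close>)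
      show "uniform_limit K (\<lambda>\<beta> x. sin (\<Phi> \<beta> (1 - \<beta> * x))) (\<lambda>x. sin (\<psi> x)) (at_right 0)"
        by (rule uniform_limit_by_bound[OF _ r(2)])
          (use est in \<open>eventually_elim, blast intro: order_trans[OF abs_sin_diff_le]\<close>)
      show "uniform_limit K (\<lambda>\<beta> x. cos (\<Phi> \<beta> (1 - \<beta> * x))) (\<lambda>x. cos (\<psi> x)) (at_right 0)"
        by (rule uniform_limit_by_bound[OF _ r(2)])
          (use est in \<open>eventually_elim, blast intro: order_trans[OF abs_cos_diff_le]\<close>)
      have tri: "\<bar>p - sin z\<bar> \<le> C * m + C" if "\<bar>y - z\<bar> \<le> C * m" "\<bar>p - sin y\<bar> \<le> C" for p y z C
        using that abs_sin_diff_le[of y z] by linarith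
      show "uniform_limit K (\<lambda>\<beta> x. profile.w (c \<beta>) (\<Phi> \<beta> (1 - \<beta> * x))) (\<lambda>x. sin (\<psi> x)) (at_right 0)"
        by (rule uniform_limit_by_bound[OF _ r(1)]) (use est in \<open>eventually_elim, blast intro: tri\<close>)
    qed simp
  qed

  have D: "(\<lambda>\<beta>. \<phi> \<beta> 1) \<sim>[at_right 0] (\<lambda>\<beta>. 2 * \<kappa> \<beta> * \<beta>) \<and>
        (\<lambda>\<beta>. F \<beta> (\<kappa> \<beta>) (\<phi> \<beta>)) \<sim>[at_right 0] (\<lambda>\<beta>. - ((\<kappa> \<beta>)\<^sup>2 * \<beta> / 2)) \<and>
        (\<forall>\<^sub>F \<beta> in at_right 0.
           smooth_at_within {0..1/\<beta>} {0..1/\<beta>} (\<lambda>x. \<phi> \<beta> (1 - \<beta> * x) / (2 * \<kappa> \<beta> * \<beta>))) \<and>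
        (\<forall>K. compact K \<and> K \<subseteq> {0..} \<longrightarrow>
           (\<forall>k. uniform_limit K
                  (\<lambda>\<beta>. hderiv_on {0..1/\<beta>} k (\<lambda>x. \<phi> \<beta> (1 - \<beta> * x) / (2 * \<kappa> \<beta> * \<beta>)))
                  (hderiv_on {0..} k (\<lambda>x. exp (- x)))
                  (at_right 0)))"
    if lim: "((\<lambda>\<beta>. \<kappa> \<beta> * \<beta>) \<longlongrightarrow> 0) (at_right 0)"
  proof (intro conjI allI impI)
    have k0: "(k \<longlongrightarrow> 0) (at_right 0)" using lim unfolding k_def[abs_def] .
    have kk: "2 * \<kappa> \<beta> * \<beta> = 2 * k \<beta>" for \<beta> by (simp add: k_def)
    have kpos': "0 < k \<beta>" if "0 < \<beta>" for \<beta> using profile.k[OF P[OF that]] by simp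
    define err where "err \<beta> = profile.err \<beta> (k \<beta>)" for \<beta>
    have err_eq: "err \<beta> = 2 * k \<beta> / decay_rate\<^sup>2 + 2 * exp (- decay_rate / \<beta>)" if "0 < \<beta>" for \<beta>
      unfolding err_def profile.err_def[OF P[OF that]] ..
    have err0: "(err \<longlongrightarrow> 0) (at_right 0)"
    proof (rule Lim_transform_eventually)
      show "((\<lambda>\<beta>. 2 * k \<beta> / decay_rate\<^sup>2 + 2 * exp (- decay_rate / \<beta>)) \<longlongrightarrow> 0) (at_right 0)"
        using tendsto_add[OF tendsto_divide[OF tendsto_mult[OF tendsto_const[of 2] k0] tendsto_const[of "decay_rate\<^sup>2"]]
            tendsto_mult[OF tendsto_const[of 2] e0]] decay_rate_pos by simp
      show "\<forall>\<^sub>F \<beta> in at_right 0. 2 * k \<beta> / decay_rate\<^sup>2 + 2 * exp (- decay_rate / \<beta>) = err \<beta>"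
        using pos by eventually_elim (simp add: err_eq)
    qed
    have aq: "((\<lambda>\<beta>. a \<beta> / (2 * k \<beta>)) \<longlongrightarrow> 1) (at_right 0)"
    proof (rule LIM_zero_cancel, rule Lim_null_comparison[OF _ err0])
      show "\<forall>\<^sub>F \<beta> in at_right 0. norm (a \<beta> / (2 * k \<beta>) - 1) \<le> err \<beta>"
        using pos by eventually_elim (simp add: err_def profile.a_quotient[OF P])
    qed
    have cq: "((\<lambda>\<beta>. c \<beta> / (2 * k \<beta>)) \<longlongrightarrow> 0) (at_right 0)"
    proof (rule Lim_null_comparison)
      show "\<forall>\<^sub>F \<beta> in at_right 0. norm (c \<beta> / (2 * k \<beta>)) \<le> 2 * exp (- decay_rate / \<beta>)"
        using pos
      proof eventually_elim
        case (elim \<beta>)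
        show ?case using profile.c_quotient_le[OF P[OF elim]] profile.c[OF P[OF elim]] kpos'[OF elim] by simp
      qed
      show "((\<lambda>\<beta>. 2 * exp (- decay_rate / \<beta>)) \<longlongrightarrow> 0) (at_right 0)"
        using tendsto_mult[OF tendsto_const[of 2] e0] by simp
    qed
    show "(\<lambda>\<beta>. \<phi> \<beta> 1) \<sim>[at_right 0] (\<lambda>\<beta>. 2 * \<kappa> \<beta> * \<beta>)"
    proof (rule asymp_equivI', rule Lim_transform_eventually[OF aq])
      show "\<forall>\<^sub>F \<beta> in at_right 0. a \<beta> / (2 * k \<beta>) = \<phi> \<beta> 1 / (2 * \<kappa> \<beta> * \<beta>)"
        using pos by eventually_elim (simp add: \<phi>_at_1 kk)
    qed
    have a0: "(a \<longlongrightarrow> 0) (at_right 0)"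
    proof (rule Lim_transform_eventually)
      show "((\<lambda>\<beta>. a \<beta> / (2 * k \<beta>) * (2 * k \<beta>)) \<longlongrightarrow> 0) (at_right 0)"
        using tendsto_mult[OF aq tendsto_mult[OF tendsto_const[of 2] k0]] by simp
      show "\<forall>\<^sub>F \<beta> in at_right 0. a \<beta> / (2 * k \<beta>) * (2 * k \<beta>) = a \<beta>"
        using pos by eventually_elim (use kpos' in force)
    qed
    \<comment> \<open>This is \<open>2 * (1 - cos a) / (2 * k)\<^sup>2\<close>, rewritten through (1
      - cos a)(1 + cos a) = sin^2 a = (2k)^2 - c^2. The limit 1 is then visible without a Taylor
      expansion, and the bounds on \<open>H\<close> squeeze \<open>h\<close> against it.\<close>
    define X where "X \<beta> = (1 - (c \<beta> / (2 * k \<beta>))\<^sup>2) * (2 / (1 + cos (a \<beta>)))" for \<beta>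
    have X1: "(X \<longlongrightarrow> 1) (at_right 0)"
    proof -
      have "((\<lambda>\<beta>. cos (a \<beta>)) \<longlongrightarrow> 1) (at_right 0)" using tendsto_cos[OF a0] by simp
      from tendsto_mult[OF tendsto_diff[OF tendsto_const[of 1] tendsto_power[OF cq, of 2]]
          tendsto_divide[OF tendsto_const[of 2] tendsto_add[OF tendsto_const[of 1] this]]]
      show ?thesis unfolding X_def[abs_def] by simp
    qed
    define h where "h \<beta> = 2 * profile.H (c \<beta>) (a \<beta>) / (2 * k \<beta>)\<^sup>2" for \<beta>
    have X_eq: "2 * (1 - cos (a \<beta>)) / (2 * k \<beta>)\<^sup>2 = X \<beta>" if "0 < \<beta>" for \<beta>
    proof -
      interpret profile \<beta> "k \<beta>" "c \<beta>" "a \<beta>" "\<Phi> \<beta>" by (rule P[OF that])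
      have "0 < cos (a \<beta>)" using a by (intro cos_gt_zero_pi) auto
      then have nz: "1 + cos (a \<beta>) \<noteq> 0" by simp
      have "(1 - cos (a \<beta>)) * (1 + cos (a \<beta>)) = (sin (a \<beta>))\<^sup>2"
        by (simp add: sin_squared_eq power2_eq_square algebra_simps)
      then have "1 - cos (a \<beta>) = (sin (a \<beta>))\<^sup>2 / (1 + cos (a \<beta>))" using nz by (simp add: nonzero_eq_divide_eq)
      moreover have "(sin (a \<beta>))\<^sup>2 / (2 * k \<beta>)\<^sup>2 = 1 - (c \<beta> / (2 * k \<beta>))\<^sup>2"
      proof -
        have "(sin (a \<beta>))\<^sup>2 = (2 * k \<beta>)\<^sup>2 - (c \<beta>)\<^sup>2" using sin_a by linarith
        then show ?thesis using k by (simp add: diff_divide_distrib power_divide)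
      qed
      ultimately show ?thesis unfolding X_def by (metis (no_types, lifting) mult.commute times_divide_eq_left times_divide_eq_right divide_divide_eq_left)
    qed
    have h1: "(h \<longlongrightarrow> 1) (at_right 0)"
    proof (rule tendsto_sandwich[OF _ _ X1])
      show "\<forall>\<^sub>F \<beta> in at_right 0. X \<beta> \<le> h \<beta>"
        using pos
      proof eventually_elim
        case (elim \<beta>)
        show ?case unfolding X_eq[OF elim, symmetric] h_def
          using profile.H_a_bounds(1)[OF P[OF elim]] by (intro divide_right_mono) auto
      qed
      show "\<forall>\<^sub>F \<beta> in at_right 0. h \<beta> \<le> X \<beta> + 2 * (c \<beta> / (2 * k \<beta>)) * (a \<beta> / (2 * k \<beta>))"
        using pos
      proof eventually_elim
        case (elim \<beta>)
        have "h \<beta> \<le> 2 * (1 - cos (a \<beta>) + c \<beta> * a \<beta>) / (2 * k \<beta>)\<^sup>2"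
          unfolding h_def using profile.H_a_bounds(2)[OF P[OF elim]] by (intro divide_right_mono) auto
        also have "\<dots> = X \<beta> + 2 * (c \<beta> * a \<beta>) / (2 * k \<beta>)\<^sup>2"
          unfolding X_eq[OF elim, symmetric] by (simp add: distrib_left add_divide_distrib)
        finally show ?case by (simp add: power2_eq_square mult_ac)
      qed
      show "((\<lambda>\<beta>. X \<beta> + 2 * (c \<beta> / (2 * k \<beta>)) * (a \<beta> / (2 * k \<beta>))) \<longlongrightarrow> 1) (at_right 0)"
        using tendsto_add[OF X1 tendsto_mult[OF tendsto_mult[OF tendsto_const[of 2] cq] aq]] by simp
    qed
    \<comment> \<open>Convergence of \<open>c / (2 * k)\<close> to 0 would not compensate the
      divisor \<beta>; its exponential bound does.\<close>
    have z: "((\<lambda>\<beta>. (c \<beta> / (2 * k \<beta>))\<^sup>2 / \<beta>) \<longlongrightarrow> 0) (at_right 0)"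
    proof (rule Lim_null_comparison)
      show "\<forall>\<^sub>F \<beta> in at_right 0. norm ((c \<beta> / (2 * k \<beta>))\<^sup>2 / \<beta>) \<le> 4 * (exp (- (decay_rate / \<beta>)) * (1 / \<beta>) ^ 1)"
        using pos
      proof eventually_elim
        case (elim \<beta>)
        define e where "e = exp (- (decay_rate / \<beta>))"
        have e: "0 < e" "e \<le> 1" using decay_rate_pos elim by (auto simp: e_def)
        have q: "0 \<le> c \<beta> / (2 * k \<beta>)" "c \<beta> / (2 * k \<beta>) \<le> 2 * e"
          using profile.c_quotient_le[OF P[OF elim]] profile.c[OF P[OF elim]] kpos'[OF elim] by (auto simp: e_def)
        have "(c \<beta> / (2 * k \<beta>))\<^sup>2 \<le> (2 * e)\<^sup>2" using q by (intro power_mono) auto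
        also have "\<dots> \<le> 4 * e" using e mult_left_mono[of e 1 e] by (simp add: power2_eq_square)
        finally have "(c \<beta> / (2 * k \<beta>))\<^sup>2 / \<beta> \<le> 4 * e / \<beta>" using elim by (intro divide_right_mono) auto
        then show ?case using elim by (simp add: e_def)
      qed
      show "((\<lambda>\<beta>. 4 * (exp (- (decay_rate / \<beta>)) * (1 / \<beta>) ^ 1)) \<longlongrightarrow> 0) (at_right 0)"
        using tendsto_mult[OF tendsto_const[of 4] exp_decay_power_tendsto_0[OF decay_rate_pos, of 1]] by simp
    qed
    show "(\<lambda>\<beta>. F \<beta> (\<kappa> \<beta>) (\<phi> \<beta>)) \<sim>[at_right 0] (\<lambda>\<beta>. - ((\<kappa> \<beta>)\<^sup>2 * \<beta> / 2))"
    proof (rule asymp_equivI', rule Lim_transform_eventually)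
      \<comment> \<open>The limits combine to 2 - 1 + 0.\<close>
      show "((\<lambda>\<beta>. 2 * (a \<beta> / (2 * k \<beta>)) - h \<beta> + (c \<beta> / (2 * k \<beta>))\<^sup>2 / \<beta>) \<longlongrightarrow> 1) (at_right 0)"
        using tendsto_add[OF tendsto_diff[OF tendsto_mult[OF tendsto_const[of 2] aq] h1] z] by simp
      show "\<forall>\<^sub>F \<beta> in at_right 0. 2 * (a \<beta> / (2 * k \<beta>)) - h \<beta> + (c \<beta> / (2 * k \<beta>))\<^sup>2 / \<beta>
          = F \<beta> (\<kappa> \<beta>) (\<phi> \<beta>) / - ((\<kappa> \<beta>)\<^sup>2 * \<beta> / 2)"
        using pos
      proof eventually_elim
        case (elim \<beta>)
        have "(\<kappa> \<beta>)\<^sup>2 * \<beta> / 2 = (k \<beta>)\<^sup>2 / (2 * \<beta>)"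
          using elim by (simp add: k_def power2_eq_square)
        then show ?case
          unfolding F_V[OF elim] h_def using profile.V_quotient[OF P[OF elim]] by simp
      qed
    qed
    show "\<forall>\<^sub>F \<beta> in at_right 0. smooth_at_within {0..1/\<beta>} {0..1/\<beta>} (\<lambda>x. \<phi> \<beta> (1 - \<beta> * x) / (2 * \<kappa> \<beta> * \<beta>))"
      using pos
    proof eventually_elim
      case (elim \<beta>)
      have "0 < 1 / \<beta>" "2 * k \<beta> \<noteq> 0" using elim kpos'[OF elim] by auto
      from pendulum_smooth[OF at_within_Icc_nontrivial[OF this(1)] profile.pendulum_rescaled[OF P[OF elim] this(2)] order_refl]
      show ?case unfolding kk \<phi>_eq[OF elim] .
    qed
    fix K :: "real set" and n :: nat assume "compact K \<and> K \<subseteq> {0..}"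
    then have K: "compact K" "K \<subseteq> {0..}" by auto
    obtain R where R: "0 \<le> R" "\<And>x. x \<in> K \<Longrightarrow> x \<le> R" using compact_bounded_above[OF K(1)] by blast
    define m where "m = sqrt (2 * exp (3 * R))"
    have est: "\<forall>\<^sub>F \<beta> in at_right 0. \<forall>x\<in>K. \<bar>\<Phi> \<beta> (1 - \<beta> * x) / (2 * k \<beta>) - exp (- x)\<bar> \<le> err \<beta> * m
        \<and> \<bar>sin (\<Phi> \<beta> (1 - \<beta> * x)) / (2 * k \<beta>) - exp (- x)\<bar> \<le> err \<beta> * m + err \<beta>
        \<and> \<bar>profile.w (c \<beta>) (\<Phi> \<beta> (1 - \<beta> * x)) / (2 * k \<beta>) - exp (- x)\<bar> \<le> err \<beta> * m + err \<beta>
        \<and> \<bar>cos (\<Phi> \<beta> (1 - \<beta> * x)) - 1\<bar> \<le> 2 * k \<beta> / decay_rate \<and> 1 - \<beta> * x \<in> {0..1}"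
      using pos large[of R]
    proof eventually_elim
      case (elim \<beta>)
      show ?case
      proof
        fix x assume "x \<in> K"
        then have x: "x \<in> {0..R}" using R K by auto
        then have "1 - \<beta> * x \<in> {0..1}" using elim by (intro profile.rescaled_in[OF P[OF elim(1)]]) auto
        with profile.rescaled_quotient[OF P[OF elim(1)] elim(2) x]
        show "\<bar>\<Phi> \<beta> (1 - \<beta> * x) / (2 * k \<beta>) - exp (- x)\<bar> \<le> err \<beta> * m
        \<and> \<bar>sin (\<Phi> \<beta> (1 - \<beta> * x)) / (2 * k \<beta>) - exp (- x)\<bar> \<le> err \<beta> * m + err \<beta>
        \<and> \<bar>profile.w (c \<beta>) (\<Phi> \<beta> (1 - \<beta> * x)) / (2 * k \<beta>) - exp (- x)\<bar> \<le> err \<beta> * m + err \<beta>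
        \<and> \<bar>cos (\<Phi> \<beta> (1 - \<beta> * x)) - 1\<bar> \<le> 2 * k \<beta> / decay_rate \<and> 1 - \<beta> * x \<in> {0..1}"
          unfolding m_def err_def by blast
      qed
    qed
    have r: "((\<lambda>\<beta>. err \<beta> * m + err \<beta>) \<longlongrightarrow> 0) (at_right 0)" "((\<lambda>\<beta>. err \<beta> * m) \<longlongrightarrow> 0) (at_right 0)"
      "((\<lambda>\<beta>. 2 * k \<beta> / decay_rate) \<longlongrightarrow> 0) (at_right 0)"
      using tendsto_mult[OF err0 tendsto_const[of m]] tendsto_add[OF tendsto_mult[OF err0 tendsto_const[of m]] err0]
        tendsto_divide[OF tendsto_mult[OF tendsto_const[of 2] k0] tendsto_const[of decay_rate]] decay_rate_pos by auto
    show "uniform_limit K (\<lambda>\<beta>. hderiv_on {0..1/\<beta>} n (\<lambda>x. \<phi> \<beta> (1 - \<beta> * x) / (2 * \<kappa> \<beta> * \<beta>)))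
        (hderiv_on {0..} n (\<lambda>x. exp (- x))) (at_right 0)"
      unfolding kk
    \<comment> \<open>Here the amplitude \<open>2 * k \<beta>\<close> tends to 0, so the limit
      system is the linear one, with cosine component 1.\<close>
    proof (rule pendulum_uniform_limit[OF K, where E = "\<lambda>\<beta>. 2 * k \<beta>"])
      show "\<forall>\<^sub>F \<beta> in at_right 0. pendulum (- 1) {0..1/\<beta>} (2 * k \<beta>) (\<lambda>x. \<phi> \<beta> (1 - \<beta> * x) / (2 * k \<beta>))
        (\<lambda>x. sin (\<Phi> \<beta> (1 - \<beta> * x)) / (2 * k \<beta>)) (\<lambda>x. cos (\<Phi> \<beta> (1 - \<beta> * x)))
        (\<lambda>x. profile.w (c \<beta>) (\<Phi> \<beta> (1 - \<beta> * x)) / (2 * k \<beta>))"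
        using pos
      proof eventually_elim
        case (elim \<beta>)
        have "2 * k \<beta> \<noteq> 0" using kpos'[OF elim] by simp
        from profile.pendulum_rescaled[OF P[OF elim] this] show ?case unfolding \<phi>_eq[OF elim] .
      qed
      show "pendulum (- 1) {0..} 0 (\<lambda>x. exp (- x)) (\<lambda>x. exp (- x)) (\<lambda>x. 1) (\<lambda>x. exp (- x))"
        by (rule pendulum_exp)
      show "uniform_limit K (\<lambda>\<beta> x. \<phi> \<beta> (1 - \<beta> * x) / (2 * k \<beta>)) (\<lambda>x. exp (- x)) (at_right 0)"
        by (rule uniform_limit_by_bound[OF _ r(2)]) (use est pos in \<open>eventually_elim, simp add: \<phi>_\<Phi>\<close>)
      show "uniform_limit K (\<lambda>\<beta> x. sin (\<Phi> \<beta> (1 - \<beta> * x)) / (2 * k \<beta>)) (\<lambda>x. exp (- x)) (at_right 0)"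
        by (rule uniform_limit_by_bound[OF _ r(1)]) (use est in \<open>eventually_elim, blast\<close>)
      show "uniform_limit K (\<lambda>\<beta> x. cos (\<Phi> \<beta> (1 - \<beta> * x))) (\<lambda>x. 1) (at_right 0)"
        by (rule uniform_limit_by_bound[OF _ r(3)]) (use est in \<open>eventually_elim, blast\<close>)
      show "uniform_limit K (\<lambda>\<beta> x. profile.w (c \<beta>) (\<Phi> \<beta> (1 - \<beta> * x)) / (2 * k \<beta>)) (\<lambda>x. exp (- x)) (at_right 0)"
        by (rule uniform_limit_by_bound[OF _ r(1)]) (use est in \<open>eventually_elim, blast\<close>)
      show "((\<lambda>\<beta>. 2 * k \<beta>) \<longlongrightarrow> 0) (at_right 0)"
        using tendsto_mult[OF tendsto_const[of 2] k0] by simp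
    qed
  qed

  show ?thesis using A B C D by blast
qed

end
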